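(* Fix a finite field $\mathbb{F}_q$ of characteristic $p$. For each $n\ge1$ let $g$ be chosen uniformly at random from $\mathrm{GL}_n(\mathbb{F}_q)$. Let $k=k(n)$ be a positive integer with $p\nmid k$ and $\log k=o(n)$ as $n\to\infty$, and let $a_1,\dots,a_k\in\mathbb{F}_q$ (possibly depending on $n$) be arbitrary with $a_k\neq 0$. Then the distribution of $\sum_{i=1}^k a_i\,\mathrm{Tr}(g^i)$ tends to the uniform distribution on $\mathbb{F}_q$ as $n\to\infty$.
   Context: $q$ is a fixed prime power; $\mathrm{GL}_n(\mathbb{F}_q)$ carries the uniform probability measure. *)

theory Defs
  imports
    "HOL-Probability.Probability"
    "HOL-Library.Landau_Symbols"
    "Jordan_Normal_Form.Matrix"
begin

definition GL :: "nat \<Rightarrow> 'a :: field mat set" where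
  "GL n = {A \<in> carrier_mat n n. invertible_mat A}"

definition mat_trace :: "'a :: comm_monoid_add mat \<Rightarrow> 'a" where
  "mat_trace A = (\<Sum>i<dim_row A. A $$ (i, i))"

text \<open>The next two facts make \<^term>\<open>pmf_of_set (GL n)\<close> the uniform distribution on
  \<^term>\<open>GL n\<close>: on infinite or empty sets \<^term>\<open>pmf_of_set\<close> is unspecified.\<close>

lemma finite_GL [simp]: "finite (GL n :: 'a :: {field, finite} mat set)"
proof -
  have "GL n \<subseteq> mat n n ` (({..<n} \<times> {..<n}) \<rightarrow>\<^sub>E (UNIV :: 'a set))"
  proof
    fix A :: "'a mat" assume "A \<in> GL n"
    then have A: "A \<in> carrier_mat n n" by (simp add: GL_def)
    let ?f = "restrict (\<lambda>ij. A $$ ij) ({..<n} \<times> {..<n})"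
    have "A = mat n n ?f" using A by (intro eq_matI) auto
    moreover have "?f \<in> ({..<n} \<times> {..<n}) \<rightarrow>\<^sub>E UNIV" by auto
    ultimately show "A \<in> mat n n ` (({..<n} \<times> {..<n}) \<rightarrow>\<^sub>E (UNIV :: 'a set))" by blast
  qed
  then show ?thesis by (rule finite_subset) (auto intro!: finite_PiE)
qed

lemma GL_nonempty [simp]: "(GL n :: 'a :: field mat set) \<noteq> {}"
proof -
  have "inverts_mat (1\<^sub>m n :: 'a mat) (1\<^sub>m n)"
    by (simp add: inverts_mat_def)
  then have "1\<^sub>m n \<in> (GL n :: 'a mat set)"
    by (auto simp: GL_def invertible_mat_def)
  then show ?thesis by blast
qed

end

theory Submission
  imports Defs "HOL-Number_Theory.Cong" "HOL-Algebra.Algebraic_Closure_Type" "Jordan_Normal_Form.Char_Poly"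
begin

text \<open>Put \<open>f = (\<Sum> a i * x ^ i)\<close>, of degree \<open>k\<close> prime to \<open>q\<close>; the statistic is the sum of \<open>f\<close> over the
  eigenvalues of \<open>g\<close>, hence additive on products of characteristic polynomials.

  The cyclic subspace generated by the first basis vector has dimension close to \<open>n\<close> with high
  probability. Given that subspace and the action on the quotient, the characteristic polynomial
  of \<open>g\<close> on the subspace is uniform among the monic polynomials of its degree with nonzero constant
  term. So it suffices to treat a uniform monic polynomial of large degree \<open>n\<close>.

  Writing its degree as the sum of the degrees of the prime powers dividing it gives a convolution
  recurrence which expresses the distribution in degree \<open>n\<close> as the average over \<open>d \<le> n\<close> of
  distributions convolved with that of the trace of \<open>f\<close> on the field with \<open>q ^ d\<close> elements. The latter is
  nearly uniform as soon as \<open>d\<close> exceeds a fixed multiple of \<open>log k\<close>, which is \<open>o(n)\<close>; this weak form of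
  Weil's bound for Artin-Schreier curves is proved by Stepanov's polynomial method. An upper bound
  for every value suffices, since the counts add up to \<open>q ^ d\<close>.\<close>

text \<open>Some condition on \<open>k\<close> is unavoidable: \<open>x ^ q - x\<close> has trace 0
  on every finite extension of the field. In Stepanov's method coprimality keeps the leading terms
  of the auxiliary polynomial apart.

  The recurrence takes the place of characters and L-functions. A nearly uniform distribution stays
  nearly uniform under convolution with any other one, so nothing is needed about polynomials of
  smaller degree and errors do not accumulate. Small \<open>d\<close> are estimated trivially and
  cost only their proportion among \<open>1..n\<close>; this is where \<open>log k = o(n)\<close>
  enters. The error for large \<open>d\<close> does not tend to 0 with \<open>n\<close>, but a
  parameter \<open>t\<close>, fixed before \<open>n\<close> grows, makes it as small as desired.

  The characteristic polynomial of \<open>g\<close> itself is in general not uniform, hence the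
  passage to a cyclic subspace. Sums over eigenvalues are expressed by traces of powers of companion
  matrices: additivity then is a similarity of matrices over the coefficient field, and explicit
  roots are required only for irreducible polynomials.\<close>

hide_const (open) Divisibility.prime Divisibility.irreducible Polynomials.degree Polynomials.lead_coeff
  up_ring.coeff up_ring.monom Module.smult Coset.order

section \<open>Finite fields\<close>

lemma prime_CHAR_finite: "prime CHAR('a :: {field, finite})"
  using prime_CHAR_semidom[where ?'a = 'a] finite_imp_CHAR_pos[where ?'a = 'a] by simp

lemma power_CARD_eq_same: "(x :: 'a :: {field, finite}) ^ CARD('a) = x"
proof (cases "x = 0")
  case False
  \<comment> \<open>The extra factor \<open>x\<close> raises the exponent from \<open>q - 1\<close>
    to \<open>q\<close>, so cancelling the nonzero product gives the claim directly.\<close>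
  have "x * (\<Prod>y\<in>UNIV-{0}. x * y) = x ^ Suc (CARD('a) - 1) * \<Prod>(UNIV-{0})"
    by (simp only: prod.distrib prod_constant power_Suc) (simp add: mult_ac card_Diff_singleton)
  also have "Suc (CARD('a) - 1) = CARD('a)"
    using finite_UNIV_card_ge_0[where ?'a = 'a] by simp
  also have "(\<Prod>y\<in>UNIV-{0}. x * y) = (\<Prod>y\<in>UNIV-{0}. y)"
    by (rule prod.reindex_bij_witness[of _ "\<lambda>y. y / x" "\<lambda>y. x * y"]) (use False in auto)
  finally show ?thesis by simp
qed simp

lemma poly_eq_0_if_vanishing:
  fixes p :: "'a :: {field, finite} poly"
  assumes "degree p < CARD('a)" "\<And>x. poly p x = 0"
  shows "p = 0"
proof (rule ccontr)
  assume "p \<noteq> 0"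
  then have "card {x. poly p x = 0} \<le> degree p" by (rule card_poly_roots_bound)
  then show False using assms by simp
qed

lemma CARD_ge_2: "2 \<le> CARD('a :: {field, finite})"
proof -
  have "card {0 :: 'a, 1} \<le> CARD('a)" by (rule card_mono) auto
  then show ?thesis by simp
qed

text \<open>Write \<open>q = p ^ s * t\<close> with \<open>t\<close> prime to \<open>p\<close>.
  Every element is a \<open>p ^ s\<close>-th power, so \<open>(y + 1) ^ t = y ^ t + 1\<close> holds
  at all \<open>q\<close> points. For \<open>t \<ge> 2\<close> the difference of the two sides has
  degree below \<open>t \<le> q\<close>, hence vanishes identically, although its linear coefficient
  is \<open>t\<close>, which is nonzero in the field.\<close>

lemma CARD_eq_CHAR_power: "\<exists>s. CARD('a :: {field, finite}) = CHAR('a) ^ s"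
proof -
  let ?q = "CARD('a)" and ?p = "CHAR('a)"
  have pr: "prime ?p" by (rule prime_CHAR_finite)
  define s where "s = multiplicity ?p ?q"
  obtain t where t: "?q = ?p ^ s * t" "\<not> ?p dvd t"
    using multiplicity_decompose'[of ?q ?p] pr prime_gt_1_nat[OF pr]
    unfolding s_def by (metis CARD_ge_2 not_numeral_le_zero not_prime_unit)
  have "t = 1"
  proof (rule ccontr)
    assume "t \<noteq> 1"
    with t have t2: "t \<ge> 2" by (cases t) auto
    define R :: "'a poly" where "R = [:1, 1:] ^ t - monom 1 t - 1"
    have "degree R < t"
    proof -
      have "degree ([:1, 1 :: 'a:] ^ t) = t" by (simp add: degree_power_eq)
      then have "degree R \<le> t" unfolding R_def
        by (intro degree_diff_le) (auto simp: degree_monom_eq)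
      moreover have "coeff R t = 0"
        using t2 unfolding R_def by (simp add: coeff_linear_poly_power)
      ultimately show ?thesis using t2
        by (metis degree_0 leading_coeff_0_iff le_neq_implies_less le_0_eq not_numeral_le_zero)
    qed
    also have "t \<le> ?q" using t(1) prime_gt_0_nat[OF pr] by simp
    finally have deg: "degree R < ?q" .
    have inj: "inj (\<lambda>x :: 'a. x ^ (?p ^ s))"
    proof (rule injI)
      fix x y :: 'a assume eq: "x ^ (?p ^ s) = y ^ (?p ^ s)"
      have "x ^ (?p ^ s) = (x - y + y) ^ (?p ^ s)" by simp
      also have "\<dots> = (x - y) ^ (?p ^ s) + y ^ (?p ^ s)" by (rule freshmans_dream'[OF pr refl])
      finally show "x = y" using eq by simp
    qed
    then have surj: "surj (\<lambda>x :: 'a. x ^ (?p ^ s))" by (simp add: finite_UNIV_inj_surj)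
    have "poly R y = 0" for y
    proof -
      obtain x where y: "y = x ^ (?p ^ s)" using surj by blast
      have "(y + 1) ^ t = ((x + 1) ^ (?p ^ s)) ^ t"
        using freshmans_dream'[OF pr refl, of x 1 s] y by simp
      also have "\<dots> = (x + 1) ^ ?q" by (simp add: t(1) power_mult)
      also have "\<dots> = x ^ ?q + 1" by (simp only: power_CARD_eq_same)
      also have "\<dots> = y ^ t + 1" by (simp add: t(1) power_mult y)
      finally show ?thesis by (simp add: R_def poly_monom add.commute)
    qed
    then have "R = 0" by (intro poly_eq_0_if_vanishing deg)
    moreover have "coeff R 1 = of_nat t"
      using t2 by (simp add: R_def coeff_linear_poly_power)
    ultimately show False using t(2) by (simp add: of_nat_eq_0_iff_char_dvd)
  qed
  with t show ?thesis by auto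
qed

lemma coprime_CARD:
  assumes "\<not> CHAR('a :: {field, finite}) dvd k"
  shows "coprime k CARD('a)"
proof -
  have "coprime CHAR('a) k" using prime_CHAR_finite assms by (rule prime_imp_coprime)
  then show ?thesis
    using CARD_eq_CHAR_power[where ?'a = 'a] by (auto simp: coprime_commute)
qed

section \<open>Evaluation in the algebraic closure and the Frobenius map\<close>

abbreviation eval_ac :: "'a :: field poly \<Rightarrow> 'a alg_closure \<Rightarrow> 'a alg_closure" where
  "eval_ac F \<equiv> poly (map_poly to_ac F)"

interpretation to_ac_poly: map_poly_inj_idom_hom to_ac
  by unfold_locales auto

lemma eval_ac_const: "eval_ac [:c:] \<alpha> = to_ac c"
  by (cases "c = 0") (auto simp: map_poly_pCons)

lemma frobenius_sum_ac:
  fixes u :: "'b \<Rightarrow> 'a :: {field, finite} alg_closure"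
  shows "(\<Sum>i\<in>A. u i) ^ (CARD('a) ^ j) = (\<Sum>i\<in>A. u i ^ (CARD('a) ^ j))"
proof -
  obtain s where "CARD('a) = CHAR('a) ^ s" using CARD_eq_CHAR_power by blast
  then have "CARD('a) ^ j = CHAR('a alg_closure) ^ (s * j)" by (simp add: power_mult)
  then show ?thesis using prime_CHAR_finite[where ?'a = 'a]
    by (intro freshmans_dream_sum') auto
qed

lemma power_CARD_power_eq_same: "(x :: 'a :: {field, finite}) ^ (CARD('a) ^ j) = x"
  by (induction j) (simp_all add: power_CARD_eq_same power_mult)

lemma to_ac_power_CARD: "to_ac (c :: 'a :: {field, finite}) ^ (CARD('a) ^ j) = to_ac c"
  by (metis to_ac_power power_CARD_power_eq_same)

lemma eval_ac_frobenius:
  fixes F :: "'a :: {field, finite} poly"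
  shows "eval_ac F \<alpha> ^ (CARD('a) ^ j) = eval_ac F (\<alpha> ^ (CARD('a) ^ j))"
  unfolding poly_altdef frobenius_sum_ac
  by (simp add: power_mult_distrib to_ac_power_CARD mult.commute flip: power_mult)

section \<open>Stepanov's auxiliary polynomial\<close>

text \<open>The condition on coefficients admits the zero polynomial for every \<open>n\<close>,
  including \<open>n = 0\<close>, so that a field with \<open>q\<close> elements has exactly
  \<open>q ^ n\<close> of these polynomials.\<close>

definition polys_below :: "nat \<Rightarrow> 'a :: zero poly set" where
  "polys_below n = {p. \<forall>i\<ge>n. coeff p i = 0}"

lemma polys_below_iff: "p \<in> polys_below n \<longleftrightarrow> p = 0 \<or> degree p < n"
proof
  assume "p \<in> polys_below n"
  then have "lead_coeff p = 0 \<or> degree p < n" unfolding polys_below_def by force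
  then show "p = 0 \<or> degree p < n" by simp
qed (auto simp: polys_below_def coeff_eq_0)

lemma bij_betw_polys_below:
  "bij_betw (\<lambda>c. \<Sum>i<n. monom (c i) i) ({..<n} \<rightarrow>\<^sub>E UNIV) (polys_below n :: 'a :: comm_monoid_add poly set)"
proof (rule bij_betw_byWitness[where f' = "\<lambda>p. restrict (coeff p) {..<n}"])
  have c: "coeff (\<Sum>i<n. monom (c i) i) j = (if j < n then c j else 0)" for c :: "nat \<Rightarrow> 'a" and j
    by (simp add: coeff_sum)
  show "\<forall>c\<in>{..<n} \<rightarrow>\<^sub>E (UNIV :: 'a set). restrict (coeff (\<Sum>i<n. monom (c i) i)) {..<n} = c"
    by (intro ballI ext) (simp only: restrict_def c, auto simp: PiE_def extensional_def)
  show "\<forall>p\<in>polys_below n. (\<Sum>i<n. monom (restrict (coeff p) {..<n} i) i) = (p :: 'a poly)"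
    by (auto simp: poly_eq_iff c polys_below_def)
  show "(\<lambda>c. \<Sum>i<n. monom (c i) i) ` ({..<n} \<rightarrow>\<^sub>E (UNIV :: 'a set)) \<subseteq> polys_below n"
    by (intro image_subsetI) (simp add: polys_below_def c)
  show "(\<lambda>p. restrict (coeff p) {..<n}) ` polys_below n \<subseteq> {..<n} \<rightarrow>\<^sub>E (UNIV :: 'a set)"
    by (intro image_subsetI) (simp add: restrict_PiE_iff)
qed

lemma finite_polys_below [simp]: "finite (polys_below n :: 'a :: {comm_monoid_add, finite} poly set)"
  using bij_betw_finite[OF bij_betw_polys_below[of n, where ?'a = 'a]] by (simp add: finite_PiE)

lemma card_polys_below: "card (polys_below n :: 'a :: {comm_monoid_add, finite} poly set) = CARD('a) ^ n"
  using bij_betw_same_card[OF bij_betw_polys_below[of n, where ?'a = 'a]] by (simp add: card_PiE)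

text \<open>Only one of the nonzero terms has maximal degree, so its leading coefficient survives in
  the sum.\<close>

lemma sum_nonzero_if_degrees_distinct:
  fixes g :: "'b \<Rightarrow> 'a :: comm_ring_1 poly"
  assumes "finite I" "\<exists>i\<in>I. g i \<noteq> 0"
    and "\<And>i j. i \<in> I \<Longrightarrow> j \<in> I \<Longrightarrow> g i \<noteq> 0 \<Longrightarrow> g j \<noteq> 0 \<Longrightarrow> degree (g i) = degree (g j) \<Longrightarrow> i = j"
  shows "sum g I \<noteq> 0"
proof -
  let ?J = "{i \<in> I. g i \<noteq> 0}"
  have J: "finite ?J" "?J \<noteq> {}" using assms by auto
  obtain i where i: "i \<in> ?J" "degree (g i) = Max ((degree \<circ> g) ` ?J)"
    using Max_in[of "(degree \<circ> g) ` ?J"] J by fastforce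
  have "coeff (g j) (degree (g i)) = 0" if "j \<in> I - {i}" for j
  proof (cases "g j = 0")
    case False
    with that have "j \<in> ?J" by auto
    then have "degree (g j) \<le> degree (g i)" unfolding i(2) using J by (intro Max_ge) auto
    moreover have "degree (g j) \<noteq> degree (g i)" using assms(3)[of j i] that False i(1) by auto
    ultimately show ?thesis by (simp add: coeff_eq_0)
  qed auto
  then have "coeff (sum g I) (degree (g i)) = lead_coeff (g i)"
    using assms(1) i(1) by (simp add: coeff_sum sum.remove[of I i])
  with i(1) show ?thesis by auto
qed

text \<open>At a point fixed by the \<open>q ^ n\<close>-power map this is the trace of the value of
  \<open>f\<close>, from the field with \<open>q ^ n\<close> elements down to the base field.
  Stepanov's method also needs the truncations of that trace to fewer Frobenius powers.\<close>

definition partial_trace :: "'a :: {field, finite} poly \<Rightarrow> nat \<Rightarrow> 'a poly" where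
  "partial_trace f n = (\<Sum>j<n. f ^ (CARD('a) ^ j))"

lemma degree_partial_trace:
  fixes f :: "'a :: {field, finite} poly"
  assumes "degree f > 0" "n > 0"
  shows "degree (partial_trace f n) = degree f * CARD('a) ^ (n - 1)"
  using assms(2)
proof (induction n)
  case (Suc n)
  have "degree f \<noteq> 0" "f \<noteq> 0" using assms(1) by auto
  note dp = degree_power_eq[OF \<open>f \<noteq> 0\<close>]
  show ?case
  proof (cases n)
    case 0
    then show ?thesis by (simp add: partial_trace_def)
  next
    case n: (Suc m)
    have "degree f * CARD('a) ^ m < degree f * CARD('a) ^ n"
      using assms(1) CARD_ge_2[where ?'a = 'a] n by simp
    then have "degree (partial_trace f n) < degree (f ^ (CARD('a) ^ n))"
      using Suc.IH n by (simp add: dp mult.commute)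
    then have "degree (partial_trace f n + f ^ (CARD('a) ^ n)) = degree (f ^ (CARD('a) ^ n))"
      by (rule degree_add_eq_right)
    then show ?thesis by (simp add: partial_trace_def dp mult.commute)
  qed
qed simp

lemma eval_ac_partial_trace:
  "eval_ac (partial_trace f n) \<alpha> = (\<Sum>j<n. eval_ac f \<alpha> ^ (CARD('a) ^ j))"
  for f :: "'a :: {field, finite} poly"
  by (simp add: partial_trace_def to_ac_poly.hom_sum to_ac_poly.hom_power poly_sum poly_power)

lemma sum_lessThan_add: "(\<Sum>j<m + n. g j) = (\<Sum>j<m. g j) + (\<Sum>j<n. g (m + j))"
  for g :: "nat \<Rightarrow> 'a :: comm_monoid_add"
  by (induction n) (simp_all add: add.assoc)

text \<open>The \<open>q ^ m\<close>-th power shifts every Frobenius exponent by \<open>m\<close>,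
  turning a trace of length \<open>d - m\<close> into the top part of the one of length
  \<open>d\<close>.\<close>

lemma partial_trace_split:
  fixes f :: "'a :: {field, finite} poly"
  assumes "m \<le> d"
  shows "eval_ac (partial_trace f (d - m)) \<alpha> ^ (CARD('a) ^ m) =
    eval_ac (partial_trace f d) \<alpha> - eval_ac (partial_trace f m) \<alpha>"
proof -
  have "eval_ac (partial_trace f d) \<alpha> = (\<Sum>j<m + (d - m). eval_ac f \<alpha> ^ (CARD('a) ^ j))"
    using assms by (simp add: eval_ac_partial_trace)
  also have "\<dots> = (\<Sum>j<m. eval_ac f \<alpha> ^ (CARD('a) ^ j)) + (\<Sum>j<d - m. eval_ac f \<alpha> ^ (CARD('a) ^ (j + m)))"
    unfolding sum_lessThan_add[of _ m "d - m"] by (simp add: add.commute)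
  also have "(\<Sum>j<d - m. eval_ac f \<alpha> ^ (CARD('a) ^ (j + m))) = eval_ac (partial_trace f (d - m)) \<alpha> ^ (CARD('a) ^ m)"
    by (simp add: eval_ac_partial_trace frobenius_sum_ac power_add power_mult)
  finally show ?thesis by (simp add: eval_ac_partial_trace)
qed


lemma degree_pcompose_monom: "degree (p \<circ>\<^sub>p monom 1 n) = degree p * n"
  for p :: "'a :: idom poly"
  by (simp add: degree_pcompose degree_monom_eq)

text \<open>Reduction modulo \<open>q\<close> determines \<open>j\<close>, since \<open>k\<close> is
  invertible there and \<open>j < q\<close>.\<close>

lemma linear_combination_coprime_inj:
  fixes i j :: nat
  assumes "coprime k q" "j < q" "j' < q" "i * q + j * k = i' * q + j' * k"
  shows "i = i' \<and> j = j'"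
proof -
  have "[j * k = j' * k] (mod q)"
    using assms(4) by (metis cong_def mod_mult_self3)
  then have "[j = j'] (mod q)" using assms(1) by (simp add: cong_mult_rcancel_nat)
  then have "j = j'" using assms by (simp add: cong_less_modulus_unique_nat)
  with assms show ?thesis by auto
qed

text \<open>Let \<open>h\<close> and \<open>g\<close> be the partial traces of length \<open>d - m\<close> and \<open>m\<close>. On the points in question
  \<open>h ^ (q ^ m) = c - g\<close>, so the \<open>q ^ m\<close>-th power of \<open>E = (\<Sum> e i j * x ^ (i * q ^ (d - m)) * h ^ j)\<close> agrees
  there with \<open>S = (\<Sum> e i j (x ^ (q ^ m)) * x ^ i * (c - g) ^ j)\<close>, which has much smaller degree. There are
  more coefficient families \<open>e\<close> than values of \<open>S\<close>, so some nonzero family has \<open>S = 0\<close>; the terms of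
  \<open>E\<close> have distinct degrees because \<open>k\<close> is prime to \<open>q\<close>, so \<open>E \<noteq> 0\<close>.\<close>

theorem stepanov_auxiliary_polynomial:
  fixes f :: "'a :: {field, finite} poly" and c :: 'a
  defines "q \<equiv> CARD('a)"
  assumes deg: "degree f = k" "k > 0" and cop: "coprime k q"
    and m: "0 < m" "m < d" and km: "k * q ^ m \<le> q ^ (d - m - 1)"
  obtains E where "E \<noteq> 0" "degree E \<le> q ^ (d - 1) + 2 * k * q ^ (d - m)"
    "\<And>\<alpha>. \<alpha> ^ (q ^ d) = \<alpha> \<Longrightarrow> eval_ac (partial_trace f d) \<alpha> = to_ac c \<Longrightarrow> eval_ac E \<alpha> = 0"
proof -
  have q2: "q \<ge> 2" unfolding q_def by (rule CARD_ge_2)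
  define Q where "Q = q ^ (m - 1)"
  define R where "R = q ^ (d - m - 1)"
  have Q: "q ^ m = q * Q" "Q \<ge> 1" using m q2 by (cases m; simp add: Q_def)+
  have dm: "d - m = Suc (d - m - 1)" using m by simp
  have R: "q ^ (d - m) = q * R" "R \<ge> 1" "q ^ (d - 1) = q * R * Q"
  proof -
    show "q ^ (d - m) = q * R" unfolding R_def using dm by (metis power_Suc)
    show "R \<ge> 1" using q2 by (simp add: R_def)
    have "d - 1 = Suc ((d - m - 1) + (m - 1))" using m by simp
    then show "q ^ (d - 1) = q * R * Q" unfolding R_def Q_def by (simp only: power_Suc power_add mult_ac)
  qed
  \<comment> \<open>The coefficients \<open>e i j\<close> range over degrees below \<open>A\<close>.
    The hypothesis \<open>km\<close> says \<open>A \<le> R\<close>, which keeps the terms of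
    \<open>E\<close> at distinct degrees.\<close>
  define A where "A = k * q ^ m"
  have A: "A = k * q * Q" "A \<le> R" "A \<ge> k" using km q2 Q by (auto simp: A_def R_def)
  \<comment> \<open>\<open>i\<close> takes \<open>Q + 1\<close> values rather than \<open>Q\<close>,
    so \<open>card I = q ^ m + q\<close>. The surplus of \<open>A * q\<close> unknowns outweighs the
    degrees that \<open>monom 1 i\<close> and \<open>G ^ j\<close> add to \<open>S\<close>.\<close>
  define I where "I = {..Q} \<times> {..<q}"
  have finI: "finite I" and cardI: "card I = (Q + 1) * q" by (auto simp: I_def)
  define h where "h = partial_trace f (d - m)"
  define G where "G = [:c:] - partial_trace f m"
  define S where "S e = (\<Sum>(i, j)\<in>I. (e (i, j) \<circ>\<^sub>p monom 1 (q ^ m)) * monom 1 i * G ^ j)" for e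
  define E where "E e = (\<Sum>(i, j)\<in>I. e (i, j) * monom 1 (i * q ^ (d - m)) * h ^ j)" for e
  have degh: "degree h = k * R"
    unfolding h_def R_def using deg m by (subst degree_partial_trace) (auto simp: q_def)
  have degG: "degree G \<le> k * Q"
    unfolding G_def Q_def using deg m
    by (intro degree_diff_le) (auto simp: degree_partial_trace q_def)
  define D where "D = (A - 1) * q ^ m + Q + (q - 1) * (k * Q) + 1"
  have S_in: "S e \<in> polys_below D" if "e \<in> I \<rightarrow>\<^sub>E polys_below A" for e
  proof -
    have "degree ((e (i, j) \<circ>\<^sub>p monom 1 (q ^ m)) * monom 1 i * G ^ j) \<le> D - 1" if ij: "(i, j) \<in> I" for i j
    proof -
      have "e (i, j) \<in> polys_below A" using that \<open>e \<in> _\<close> by auto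
      then have "degree (e (i, j)) \<le> A - 1" by (auto simp: polys_below_iff)
      then have "degree (e (i, j)) * q ^ m \<le> (A - 1) * q ^ m" by simp
      moreover have "degree (G ^ j) \<le> (q - 1) * (k * Q)"
      proof -
        have "degree (G ^ j) \<le> degree G * j" by (rule degree_power_le)
        also have "\<dots> \<le> (k * Q) * (q - 1)" using degG ij by (intro mult_mono) (auto simp: I_def)
        finally show ?thesis by (simp add: mult.commute)
      qed
      moreover have "i \<le> Q" using ij by (auto simp: I_def)
      moreover have "degree ((e (i, j) \<circ>\<^sub>p monom 1 (q ^ m)) * monom 1 i * G ^ j)
          \<le> degree (e (i, j)) * q ^ m + i + degree (G ^ j)"
        by (rule order.trans[OF degree_mult_le] add_right_mono order.trans[OF degree_mult_le]
            | simp add: degree_pcompose_monom degree_monom_eq)+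
      ultimately show ?thesis unfolding D_def by linarith
    qed
    then have "degree (S e) \<le> D - 1"
      unfolding S_def by (intro degree_sum_le finI) (auto split: prod.splits)
    then show ?thesis by (auto simp: polys_below_iff D_def)
  qed
  have "D < A * card I"
  proof -
    have "(q - 1) * (k * Q) \<le> q * (k * Q)" by simp
    then have "(q - 1) * (k * Q) \<le> A" by (simp add: A mult_ac)
    moreover have "(A - 1) * q ^ m + q ^ m = A * q ^ m" using A deg by (simp add: algebra_simps)
    moreover have "Q < q ^ m" using Q q2 by simp
    moreover have "A * card I = A * q ^ m + A * q" by (simp add: cardI Q algebra_simps)
    moreover have "A * 2 \<le> A * q" using q2 by simp
    moreover have "1 \<le> A" using A deg by simp
    ultimately show ?thesis unfolding D_def by linarith
  qed
  \<comment> \<open>Pigeonhole in place of linear algebra: \<open>S\<close> is additive, so two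
    families with the same image differ by a nonzero one in its kernel.\<close>
  then have "card (polys_below D :: 'a poly set) < card (I \<rightarrow>\<^sub>E (polys_below A :: 'a poly set))"
    using q2 finI by (simp add: card_polys_below card_PiE flip: power_mult q_def)
  then have "\<not> inj_on S (I \<rightarrow>\<^sub>E polys_below A)"
    using S_in by (metis card_inj_on_le finite_polys_below image_subsetI not_le)
  then obtain e1 e2 where e12: "e1 \<in> I \<rightarrow>\<^sub>E polys_below A" "e2 \<in> I \<rightarrow>\<^sub>E polys_below A"
      "S e1 = S e2" "e1 \<noteq> e2"
    unfolding inj_on_def by blast
  define e where "e ij = e1 ij - e2 ij" for ij
  have Se: "S e = 0"
  proof -
    have "S e = S e1 - S e2"
      unfolding S_def e_def sum_subtractf[symmetric]
      by (intro sum.cong) (auto simp: pcompose_diff algebra_simps)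
    then show ?thesis using e12 by simp
  qed
  have e_in: "e ij \<in> polys_below A" if "ij \<in> I" for ij
  proof -
    have "e1 ij \<in> polys_below A" "e2 ij \<in> polys_below A"
      using that e12 by (blast dest: PiE_mem)+
    then show ?thesis by (simp add: e_def polys_below_def)
  qed
  have e_nz: "\<exists>ij\<in>I. e ij \<noteq> 0"
  proof (rule ccontr)
    assume "\<not> ?thesis"
    then have "e1 ij = e2 ij" if "ij \<in> I" for ij using that by (simp add: e_def)
    then have "e1 = e2" using e12 by (intro PiE_ext)
    with e12 show False by simp
  qed
  have hnz: "h \<noteq> 0" using degh deg R by auto
  have degt: "degree (e (i, j) * monom 1 (i * q ^ (d - m)) * h ^ j) = degree (e (i, j)) + R * (i * q + j * k)"
    if "e (i, j) \<noteq> 0" for i j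
    using that hnz by (simp add: degree_mult_eq degree_monom_eq degree_power_eq degh R algebra_simps)
  show ?thesis
  proof
    show "E e \<noteq> 0" unfolding E_def
    proof (rule sum_nonzero_if_degrees_distinct[OF finI])
      show "\<exists>ij\<in>I. (case ij of (i, j) \<Rightarrow> e (i, j) * monom 1 (i * q ^ (d - m)) * h ^ j) \<noteq> 0"
        using e_nz hnz by (auto split: prod.splits)
      fix x y assume xy: "x \<in> I" "y \<in> I"
        "(case x of (i, j) \<Rightarrow> e (i, j) * monom 1 (i * q ^ (d - m)) * h ^ j) \<noteq> 0"
        "(case y of (i, j) \<Rightarrow> e (i, j) * monom 1 (i * q ^ (d - m)) * h ^ j) \<noteq> 0"
        "degree (case x of (i, j) \<Rightarrow> e (i, j) * monom 1 (i * q ^ (d - m)) * h ^ j)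
         = degree (case y of (i, j) \<Rightarrow> e (i, j) * monom 1 (i * q ^ (d - m)) * h ^ j)"
      obtain i j i' j' where [simp]: "x = (i, j)" "y = (i', j')" by (cases x; cases y)
      have nz: "e (i, j) \<noteq> 0" "e (i', j') \<noteq> 0" using xy by auto
      have lt: "degree (e (i, j)) < R" "degree (e (i', j')) < R"
        using e_in[of x] e_in[of y] xy nz A by (auto simp: polys_below_iff)
      have "degree (e (i, j)) + R * (i * q + j * k) = degree (e (i', j')) + R * (i' * q + j' * k)"
        using xy(5) by (simp add: degt nz)
      \<comment> \<open>Division by \<open>R\<close> discards the coefficient degrees, which lie
        below \<open>A \<le> R\<close>.\<close>
      then have "(degree (e (i, j)) + R * (i * q + j * k)) div R = (degree (e (i', j')) + R * (i' * q + j' * k)) div R"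
        by (rule arg_cong)
      then have "i * q + j * k = i' * q + j' * k" using lt R by simp
      then show "x = y" using linear_combination_coprime_inj[OF cop] xy by (auto simp: I_def)
    qed
    have "degree (e (i, j) * monom 1 (i * q ^ (d - m)) * h ^ j) \<le> q ^ (d - 1) + 2 * k * q ^ (d - m)"
      if ij: "(i, j) \<in> I" for i j
    proof (cases "e (i, j) = 0")
      case False
      \<comment> \<open>Only the monomial indexed by \<open>i\<close> reaches the main term
        \<open>q ^ (d - 1)\<close>; the coefficient and \<open>h ^ j\<close> contribute at most
        \<open>k * q ^ (d - m)\<close> each.\<close>
      have "degree (e (i, j)) \<le> R" using e_in[OF ij] False A by (auto simp: polys_below_iff)
      moreover have "R * (i * q) \<le> R * (Q * q)" using ij by (auto simp: I_def)
      moreover have "R * (j * k) \<le> R * (q * k)" using ij by (auto simp: I_def)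
      moreover have "R \<le> R * (q * k)" using q2 deg by simp
      ultimately have "degree (e (i, j)) + R * (i * q + j * k) \<le> R * (Q * q) + 2 * (R * (q * k))"
        unfolding distrib_left by linarith
      then show ?thesis unfolding degt[OF False] unfolding R(1,3) by (simp only: mult_ac)
    qed auto
    then show "degree (E e) \<le> q ^ (d - 1) + 2 * k * q ^ (d - m)"
      unfolding E_def by (intro degree_sum_le finI) (auto split: prod.splits)
    fix \<alpha> :: "'a alg_closure"
    assume \<alpha>: "\<alpha> ^ (q ^ d) = \<alpha>" "eval_ac (partial_trace f d) \<alpha> = to_ac c"
    have h\<alpha>: "eval_ac h \<alpha> ^ (q ^ m) = eval_ac G \<alpha>"
      using partial_trace_split[of m d f \<alpha>] m \<alpha>(2)
      by (simp add: h_def G_def q_def to_ac_poly.hom_minus eval_ac_const)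
    have "eval_ac (E e) \<alpha> = (\<Sum>(i, j)\<in>I. eval_ac (e (i, j)) \<alpha> * \<alpha> ^ (i * q ^ (d - m)) * eval_ac h \<alpha> ^ j)"
      unfolding E_def to_ac_poly.hom_sum poly_sum
      by (intro sum.cong refl)
        (auto simp: to_ac_poly.hom_mult to_ac_poly.hom_power map_poly_monom poly_monom)
    then have "eval_ac (E e) \<alpha> ^ (q ^ m) = (\<Sum>(i, j)\<in>I. (eval_ac (e (i, j)) \<alpha> * \<alpha> ^ (i * q ^ (d - m)) * eval_ac h \<alpha> ^ j) ^ (q ^ m))"
      unfolding q_def frobenius_sum_ac
      by (simp only: frobenius_sum_ac) (intro sum.cong refl, auto simp only: split: prod.splits)
    also have "\<dots> = (\<Sum>(i, j)\<in>I. eval_ac (e (i, j)) (\<alpha> ^ (q ^ m)) * \<alpha> ^ i * eval_ac G \<alpha> ^ j)"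
    proof (intro sum.cong refl, clarify)
      fix i j
      \<comment> \<open>The exponent \<open>i * q ^ (d - m)\<close> was chosen so that it becomes
        \<open>i * q ^ d\<close> here and the monomial collapses to
        \<open>\<alpha> ^ i\<close>.\<close>
      have "q ^ (d - m) * q ^ m = q ^ d" unfolding power_add[symmetric] using m by simp
      then have "i * q ^ (d - m) * q ^ m = q ^ d * i" by (metis mult.assoc mult.commute)
      then have "(\<alpha> ^ (i * q ^ (d - m))) ^ (q ^ m) = (\<alpha> ^ (q ^ d)) ^ i"
        by (simp only: power_mult[symmetric])
      moreover have "(eval_ac h \<alpha> ^ j) ^ (q ^ m) = eval_ac G \<alpha> ^ j"
        unfolding h\<alpha>[symmetric] by (simp only: power_mult[symmetric] mult.commute)
      moreover have "eval_ac (e (i, j)) \<alpha> ^ (q ^ m) = eval_ac (e (i, j)) (\<alpha> ^ (q ^ m))"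
        unfolding q_def by (rule eval_ac_frobenius)
      ultimately show "(eval_ac (e (i, j)) \<alpha> * \<alpha> ^ (i * q ^ (d - m)) * eval_ac h \<alpha> ^ j) ^ (q ^ m)
          = eval_ac (e (i, j)) (\<alpha> ^ (q ^ m)) * \<alpha> ^ i * eval_ac G \<alpha> ^ j"
        by (simp add: power_mult_distrib \<alpha>(1))
    qed
    also have "\<dots> = eval_ac (S e) \<alpha>"
      unfolding S_def to_ac_poly.hom_sum poly_sum
      by (intro sum.cong refl)
        (auto simp: to_ac_poly.hom_mult to_ac_poly.hom_power map_poly_monom poly_monom
          to_ac_poly.base.map_poly_pcompose poly_pcompose)
    finally show "eval_ac (E e) \<alpha> = 0" using Se by simp
  qed
qed

section \<open>Traces of polynomials in a matrix\<close>

lemma mat_trace_mult_commute: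
  fixes A :: "'a :: comm_semiring_0 mat"
  assumes "A \<in> carrier_mat n m" "B \<in> carrier_mat m n"
  shows "mat_trace (A * B) = mat_trace (B * A)"
proof -
  have "mat_trace (A * B) = (\<Sum>i<n. \<Sum>j<m. A $$ (i, j) * B $$ (j, i))"
    using assms by (simp add: mat_trace_def scalar_prod_def lessThan_atLeast0)
  also have "\<dots> = (\<Sum>j<m. \<Sum>i<n. B $$ (j, i) * A $$ (i, j))"
    by (subst sum.swap) (simp add: mult.commute)
  also have "\<dots> = mat_trace (B * A)"
    using assms by (simp add: mat_trace_def scalar_prod_def lessThan_atLeast0)
  finally show ?thesis .
qed

lemma mat_trace_similar:
  fixes A :: "'a :: comm_ring_1 mat"
  assumes "similar_mat_wit A B P Q"
  shows "mat_trace A = mat_trace B"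
proof -
  define n where "n = dim_row A"
  from similar_mat_witD[OF n_def assms] have w: "Q * P = 1\<^sub>m n" "A = P * B * Q"
    "B \<in> carrier_mat n n" "P \<in> carrier_mat n n" "Q \<in> carrier_mat n n" by auto
  have "mat_trace A = mat_trace (P * (B * Q))"
    unfolding w(2) using w(3-5) by (simp add: assoc_mult_mat[of _ n n _ n _ n])
  also have "\<dots> = mat_trace (B * Q * P)" using w(3-5) by (intro mat_trace_mult_commute[of _ n n]) auto
  also have "B * Q * P = B * (Q * P)" using w(3-5) by (intro assoc_mult_mat[of _ n n _ n _ n])
  also have "\<dots> = B" using w(1,3) by simp
  finally show ?thesis .
qed

lemma mat_trace_four_block:
  assumes "A \<in> carrier_mat n n" "D \<in> carrier_mat m m"
  shows "mat_trace (four_block_mat A B C D) = mat_trace A + mat_trace D"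
proof -
  have "mat_trace (four_block_mat A B C D) = (\<Sum>i<n + m. if i < n then A $$ (i, i) else D $$ (i - n, i - n))"
  proof -
    have "dim_row A = n" "dim_col A = n" "dim_row D = m" "dim_col D = m" using assms by blast+
    then show ?thesis unfolding mat_trace_def by (intro sum.cong) auto
  qed
  also have "\<dots> = mat_trace A + mat_trace D"
    using assms by (simp add: sum_lessThan_add mat_trace_def)
  finally show ?thesis .
qed

text \<open>The off-diagonal block of the power stays existential because it does not meet the
  diagonal. The upper form serves for a matrix with an invariant subspace, the lower one for
  products of companion matrices.\<close>

lemma pow_four_block_upper:
  fixes A :: "'a :: comm_ring_1 mat"
  assumes [simp]: "A \<in> carrier_mat n n" "B \<in> carrier_mat n m" "D \<in> carrier_mat m m"
  shows "\<exists>B'\<in>carrier_mat n m. four_block_mat A B (0\<^sub>m m n) D ^\<^sub>m i = four_block_mat (A ^\<^sub>m i) B' (0\<^sub>m m n) (D ^\<^sub>m i)"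
proof (induction i)
  case 0
  have "dim_row A = n" "dim_row D = m" using assms by blast+
  then show ?case by (intro bexI[of _ "0\<^sub>m n m"]) (auto simp: four_block_one_mat)
next
  case (Suc i)
  then obtain B' where B': "B' \<in> carrier_mat n m"
    "four_block_mat A B (0\<^sub>m m n) D ^\<^sub>m i = four_block_mat (A ^\<^sub>m i) B' (0\<^sub>m m n) (D ^\<^sub>m i)" by blast
  have c: "A ^\<^sub>m i * A \<in> carrier_mat n n" "D ^\<^sub>m i * D \<in> carrier_mat m m"
    by (rule mult_carrier_mat[OF pow_carrier_mat]; simp)+
  have "four_block_mat A B (0\<^sub>m m n) D ^\<^sub>m Suc i =
    four_block_mat (A ^\<^sub>m i) B' (0\<^sub>m m n) (D ^\<^sub>m i) * four_block_mat A B (0\<^sub>m m n) D"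
    by (simp add: B')
  also have "\<dots> = four_block_mat (A ^\<^sub>m Suc i) (A ^\<^sub>m i * B + B' * D) (0\<^sub>m m n) (D ^\<^sub>m Suc i)"
    using B'(1) pow_carrier_mat[OF assms(1), of i] pow_carrier_mat[OF assms(3), of i]
    by (subst mult_four_block_mat[of _ n n _ m _ m _ _ n _ m])
      (auto simp: right_add_zero_mat[OF c(1)] left_add_zero_mat[OF c(2)] left_mult_zero_mat[OF assms(1)] left_mult_zero_mat[OF assms(2)]
        right_mult_zero_mat[of _ m m])
  finally have "four_block_mat A B (0\<^sub>m m n) D ^\<^sub>m Suc i =
    four_block_mat (A ^\<^sub>m Suc i) (A ^\<^sub>m i * B + B' * D) (0\<^sub>m m n) (D ^\<^sub>m Suc i)" .
  moreover have "A ^\<^sub>m i * B + B' * D \<in> carrier_mat n m"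
    by (rule add_carrier_mat[OF mult_carrier_mat[OF B'(1) assms(3)]])
  ultimately show ?case by auto
qed

lemma pow_four_block_lower:
  fixes A :: "'a :: comm_ring_1 mat"
  assumes [simp]: "A \<in> carrier_mat n n" "C \<in> carrier_mat m n" "D \<in> carrier_mat m m"
  shows "\<exists>C'\<in>carrier_mat m n. four_block_mat A (0\<^sub>m n m) C D ^\<^sub>m i = four_block_mat (A ^\<^sub>m i) (0\<^sub>m n m) C' (D ^\<^sub>m i)"
proof (induction i)
  case 0
  have "dim_row A = n" "dim_row D = m" using assms by blast+
  then show ?case by (intro bexI[of _ "0\<^sub>m m n"]) (auto simp: four_block_one_mat)
next
  case (Suc i)
  then obtain C' where C': "C' \<in> carrier_mat m n"
    "four_block_mat A (0\<^sub>m n m) C D ^\<^sub>m i = four_block_mat (A ^\<^sub>m i) (0\<^sub>m n m) C' (D ^\<^sub>m i)" by blast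
  have c: "A ^\<^sub>m i * A \<in> carrier_mat n n" "D ^\<^sub>m i * D \<in> carrier_mat m m"
    by (rule mult_carrier_mat[OF pow_carrier_mat]; simp)+
  have "four_block_mat A (0\<^sub>m n m) C D ^\<^sub>m Suc i =
    four_block_mat (A ^\<^sub>m i) (0\<^sub>m n m) C' (D ^\<^sub>m i) * four_block_mat A (0\<^sub>m n m) C D"
    by (simp add: C')
  also have "\<dots> = four_block_mat (A ^\<^sub>m Suc i) (0\<^sub>m n m) (C' * A + D ^\<^sub>m i * C) (D ^\<^sub>m Suc i)"
    using C'(1) pow_carrier_mat[OF assms(1), of i] pow_carrier_mat[OF assms(3), of i]
    by (subst mult_four_block_mat[of _ n n _ m _ m _ _ n _ m])
      (auto simp: right_add_zero_mat[OF c(1)] left_add_zero_mat[OF c(2)] left_mult_zero_mat[OF assms(2)] left_mult_zero_mat[OF assms(3)]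
        right_mult_zero_mat[of _ n n])
  finally have "four_block_mat A (0\<^sub>m n m) C D ^\<^sub>m Suc i =
    four_block_mat (A ^\<^sub>m Suc i) (0\<^sub>m n m) (C' * A + D ^\<^sub>m i * C) (D ^\<^sub>m Suc i)" .
  moreover have "C' * A + D ^\<^sub>m i * C \<in> carrier_mat m n"
    by (rule add_carrier_mat[OF mult_carrier_mat[OF pow_carrier_mat[OF assms(3)] assms(2)]])
  ultimately show ?case by auto
qed

text \<open>The trace of \<open>f\<close> evaluated at \<open>A\<close>, spelt out by powers as in
  the statistic of the theorem.\<close>

definition poly_trace :: "'a :: comm_ring_1 poly \<Rightarrow> 'a mat \<Rightarrow> 'a" where
  "poly_trace f A = (\<Sum>i\<le>degree f. coeff f i * mat_trace (A ^\<^sub>m i))"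

lemma poly_trace_similar:
  assumes "similar_mat_wit A B P Q"
  shows "poly_trace f A = poly_trace f B"
  unfolding poly_trace_def using mat_trace_similar[OF similar_mat_wit_pow[OF assms]] by simp

lemma poly_trace_block_upper:
  assumes "A \<in> carrier_mat n n" "B \<in> carrier_mat n m" "D \<in> carrier_mat m m"
  shows "poly_trace f (four_block_mat A B (0\<^sub>m m n) D) = poly_trace f A + poly_trace f D"
proof -
  have "mat_trace (four_block_mat A B (0\<^sub>m m n) D ^\<^sub>m i) = mat_trace (A ^\<^sub>m i) + mat_trace (D ^\<^sub>m i)" for i
    using pow_four_block_upper[OF assms, of i] assms
    by (auto simp: mat_trace_four_block[of _ n _ m])
  then show ?thesis by (simp add: poly_trace_def sum.distrib distrib_left)
qed

lemma poly_trace_block_lower: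
  assumes "A \<in> carrier_mat n n" "C \<in> carrier_mat m n" "D \<in> carrier_mat m m"
  shows "poly_trace f (four_block_mat A (0\<^sub>m n m) C D) = poly_trace f A + poly_trace f D"
proof -
  have "mat_trace (four_block_mat A (0\<^sub>m n m) C D ^\<^sub>m i) = mat_trace (A ^\<^sub>m i) + mat_trace (D ^\<^sub>m i)" for i
    using pow_four_block_lower[OF assms, of i] assms
    by (auto simp: mat_trace_four_block[of _ n _ m])
  then show ?thesis by (simp add: poly_trace_def sum.distrib distrib_left)
qed

section \<open>Companion matrices\<close>

text \<open>Multiplication by \<open>x\<close> modulo a monic \<open>F\<close> in the basis of
  powers of \<open>x\<close>, with images as columns; the last column represents
  \<open>x ^ degree F\<close>.\<close>

definition companion :: "'a :: comm_ring_1 poly \<Rightarrow> 'a mat" where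
  "companion F = mat (degree F) (degree F)
     (\<lambda>(i, j). if Suc j < degree F then if i = Suc j then 1 else 0 else - coeff F i)"

lemma companion_carrier [simp]: "companion F \<in> carrier_mat (degree F) (degree F)"
  by (simp add: companion_def)

text \<open>Read column \<open>j\<close> of \<open>M\<close> as the coefficients of a polynomial
  \<open>v\<close> of degree at most \<open>n\<close>. The right side is then a coefficient of
  \<open>x * v\<close> minus \<open>F\<close> times the top coefficient of \<open>v\<close>.\<close>

lemma companion_mult_index:
  assumes "degree F = Suc n" "M \<in> carrier_mat (Suc n) m" "i < Suc n" "j < m"
  shows "(companion F * M) $$ (i, j) = (if i = 0 then 0 else M $$ (i - 1, j)) - coeff F i * M $$ (n, j)"
proof -
  have "(companion F * M) $$ (i, j) = (\<Sum>l<Suc n. companion F $$ (i, l) * M $$ (l, j))"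
    using assms companion_carrier[of F]
    by (simp add: scalar_prod_def lessThan_atLeast0 del: sum.op_ivl_Suc)
  also have "\<dots> = (\<Sum>l<n. (if i = Suc l then M $$ (l, j) else 0)) - coeff F i * M $$ (n, j)"
    using assms by (simp add: companion_def if_distrib[of "\<lambda>x. x * _"] cong: if_cong)
  also have "(\<Sum>l<n. (if i = Suc l then M $$ (l, j) else 0)) = (if i = 0 then 0 else M $$ (i - 1, j))"
    using assms(3) by (cases i) auto
  finally show ?thesis .
qed

lemma sum_monom_below_degree:
  fixes F :: "'a :: comm_ring_1 poly"
  assumes "monic F" "degree F = n"
  shows "(\<Sum>l<n. monom (coeff F l) l) = F - monom 1 n"
proof -
  have "(\<Sum>l<n. monom (coeff F l) l) + monom (coeff F n) n = (\<Sum>l\<le>n. monom (coeff F l) l)"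
    by (simp add: lessThan_Suc_atMost[symmetric] del: lessThan_Suc_atMost)
  also have "\<dots> = F" unfolding assms(2)[symmetric] by (rule poly_as_sum_of_monoms)
  finally show ?thesis using assms by (simp add: eq_diff_eq)
qed

lemma poly_trace_companion_1 [simp]: "poly_trace f (companion 1) = 0"
  for f :: "'a :: comm_ring_1 poly"
proof -
  have "companion (1 :: 'a poly) \<in> carrier_mat 0 0" using companion_carrier[of 1] by simp
  then have "dim_row (companion (1 :: 'a poly) ^\<^sub>m i) = 0" for i
    using pow_carrier_mat[of "companion 1" 0 i] by blast
  then show ?thesis by (simp add: poly_trace_def mat_trace_def)
qed

text \<open>Modulo \<open>F * G\<close> the multiples of \<open>F\<close> form a subspace invariant
  under multiplication by \<open>x\<close>. In the basis
  \<open>1, ..., x ^ (a - 1), F, x * F, ..., x ^ (b - 1) * F\<close> this multiplication is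
  therefore block triangular, with the two companion matrices on the diagonal. The base change is
  unitriangular, as the basis element with index \<open>j\<close> is monic of degree
  \<open>j\<close>.\<close>

theorem poly_trace_companion_mult:
  fixes F G :: "'a :: field poly"
  assumes F: "monic F" and G: "monic G"
  shows "poly_trace f (companion (F * G)) = poly_trace f (companion F) + poly_trace f (companion G)"
proof -
  show ?thesis
  proof (cases "degree F = 0 \<or> degree G = 0")
    case True
    then have "F = 1 \<or> G = 1" using F G monic_degree_0 by blast
    then show ?thesis using poly_trace_companion_1[where f = f] by auto
  next
    case False
    define a b n where "a = degree F" and "b = degree G" and "n = a + b - 1"
    have ab: "a > 0" "b > 0" "Suc n = a + b" using False by (auto simp: a_def b_def n_def)
    have nz: "F \<noteq> 0" "G \<noteq> 0" using F G by auto
    have deg: "degree (F * G) = Suc n"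
      using nz ab by (simp add: degree_mult_eq a_def b_def)
    define v where "v j = (if j < a then monom 1 j else F * monom 1 (j - a))" for j
    define M where "M = mat (Suc n) (Suc n) (\<lambda>(i, j). coeff (v j) i)"
    \<comment> \<open>The single 1 outside the diagonal blocks accounts for
      \<open>x * x ^ (a - 1)\<close>, which is \<open>F\<close> plus a combination of lower powers
      of \<open>x\<close>.\<close>
    define T where "T = four_block_mat (companion F) (0\<^sub>m a b)
      (mat b a (\<lambda>(i, j). if i = 0 \<and> j = a - 1 then 1 else 0)) (companion G)"
    have [simp]: "companion F \<in> carrier_mat a a" "companion G \<in> carrier_mat b b"
      by (simp_all add: a_def b_def)
    have [simp]: "dim_row (companion F) = a" "dim_col (companion F) = a"
      "dim_row (companion G) = b" "dim_col (companion G) = b"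
      by (simp_all add: a_def b_def companion_def)
    have M: "M \<in> carrier_mat (Suc n) (Suc n)" by (simp add: M_def)
    have T: "T \<in> carrier_mat (Suc n) (Suc n)" unfolding T_def ab(3) by (rule four_block_carrier_mat) auto
    have degv: "degree (v j) = j" if "j < Suc n" for j
      using that nz by (auto simp: v_def degree_monom_eq degree_mult_eq a_def)
    have monv: "coeff (v j) j = 1" if "j < Suc n" for j
    proof (cases "j < a")
      case False
      then have "coeff (v j) j = lead_coeff (F * monom 1 (j - a))"
        using degv[OF that] by (simp add: v_def)
      then show ?thesis using F by (simp add: lead_coeff_mult degree_monom_eq)
    qed (simp add: v_def)
    have "det M = 1"
    proof -
      have "upper_triangular M"
        unfolding upper_triangular_def by (auto simp: M_def degv intro!: coeff_eq_0)
      then have "det M = prod_list (diag_mat M)" using M by (rule det_upper_triangular)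
      also have "diag_mat M = map (\<lambda>_. 1) [0..<Suc n]"
        unfolding diag_mat_def using M by (intro map_cong) (auto simp: M_def monv simp del: upt_Suc)
      also have "prod_list \<dots> = (1 :: 'a)" by (induction n) auto
      finally show ?thesis .
    qed
    then obtain N where N: "N \<in> carrier_mat (Suc n) (Suc n)" "M * N = 1\<^sub>m (Suc n)" "N * M = 1\<^sub>m (Suc n)"
      using det_non_zero_imp_unit[OF M] by (auto simp: Units_def ring_mat_def)
    \<comment> \<open>Coefficientwise this is \<open>companion (F * G) * M = M * T\<close>;
      reduction modulo \<open>F * G\<close> takes place only for \<open>j = n\<close>.\<close>
    have step: "v j * monom 1 1 - smult (coeff (v j) n) (F * G) = (\<Sum>l<Suc n. smult (T $$ (l, j)) (v l))"
      if j: "j < Suc n" for j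
    proof -
      have split: "(\<Sum>l<Suc n. smult (T $$ (l, j)) (v l)) =
        (\<Sum>l<a. smult (T $$ (l, j)) (monom 1 l)) + (\<Sum>l<b. smult (T $$ (a + l, j)) (F * monom 1 l))"
        unfolding ab(3) sum_lessThan_add by (simp add: v_def)
      have T1: "T $$ (l, j) = companion F $$ (l, j)" if "l < a" "j < a" for l
        using that ab by (simp add: T_def)
      have T2: "T $$ (l, j) = 0" if "l < a" "\<not> j < a" for l
        using that ab j by (simp add: T_def)
      have T3: "T $$ (a + l, j) = (if l = 0 \<and> j = a - 1 then 1 else 0)" if "l < b" "j < a" for l
        using that ab by (simp add: T_def)
      have T4: "T $$ (a + l, j) = companion G $$ (l, j - a)" if "l < b" "\<not> j < a" for l
        using that ab j by (simp add: T_def)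
      consider "Suc j < a" | "Suc j = a" | "a \<le> j" "j < n" | "j = n" "a \<le> j"
        using j ab by linarith
      then show ?thesis
      proof cases
        case 1
        have "(\<Sum>l<a. smult (T $$ (l, j)) (monom 1 l)) = (\<Sum>l<a. if l = Suc j then monom 1 l else 0)"
          using 1 T1 by (intro sum.cong) (auto simp: companion_def a_def)
        moreover have "(\<Sum>l<b. smult (T $$ (a + l, j)) (F * monom 1 l)) = 0"
          using 1 T3 by (intro sum.neutral) auto
        moreover have "coeff (v j) n = 0" using 1 ab degv[OF j] by (intro coeff_eq_0) simp
        ultimately show ?thesis using 1 unfolding split by (simp add: v_def mult_monom)
      next
        case 2
        have "(\<Sum>l<a. smult (T $$ (l, j)) (monom 1 l)) = - (\<Sum>l<a. monom (coeff F l) l)"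
          unfolding sum_negf[symmetric]
          using 2 T1 by (intro sum.cong) (auto simp: companion_def a_def smult_monom minus_monom)
        moreover have "(\<Sum>l<b. smult (T $$ (a + l, j)) (F * monom 1 l)) = (\<Sum>l<b. if l = 0 then F else 0)"
          using 2 T3 by (intro sum.cong) (auto simp: monom_0)
        moreover have "coeff (v j) n = 0" using 2 ab degv[OF j] by (intro coeff_eq_0) simp
        ultimately show ?thesis
          using 2 ab unfolding split sum_monom_below_degree[OF F a_def[symmetric]]
          by (simp add: v_def mult_monom)
      next
        case 3
        have "(\<Sum>l<a. smult (T $$ (l, j)) (monom 1 l)) = 0"
          using 3 T2 by (intro sum.neutral) auto
        moreover have "(\<Sum>l<b. smult (T $$ (a + l, j)) (F * monom 1 l))
            = (\<Sum>l<b. if l = Suc j - a then F * monom 1 l else 0)"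
          using 3 T4 ab by (intro sum.cong) (auto simp: companion_def b_def n_def)
        moreover have "Suc j - a < b" using 3 ab by linarith
        moreover have "coeff (v j) n = 0" using 3 ab degv[OF j] by (intro coeff_eq_0) simp
        ultimately show ?thesis using 3 unfolding split
          by (simp add: v_def mult_monom mult.assoc Suc_diff_le)
      next
        case 4
        have "(\<Sum>l<a. smult (T $$ (l, j)) (monom 1 l)) = 0"
          using 4 T2 by (intro sum.neutral) auto
        moreover have "(\<Sum>l<b. smult (T $$ (a + l, j)) (F * monom 1 l)) = - (F * (\<Sum>l<b. monom (coeff G l) l))"
          unfolding sum_negf[symmetric] sum_distrib_left
          using 4 T4 ab
          by (intro sum.cong) (auto simp: companion_def b_def n_def smult_monom
            simp flip: mult_smult_right minus_monom)
        moreover have "coeff (v j) n = 1" using monv[OF j] 4 by simp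
        moreover have "v j * monom 1 1 = F * monom 1 b"
          using 4 ab by (simp add: v_def mult_monom mult.assoc n_def)
        ultimately show ?thesis
          unfolding split sum_monom_below_degree[OF G b_def[symmetric]]
          by (simp add: right_diff_distrib)
      qed
    qed
    have CM: "companion (F * G) * M = M * T"
    proof (rule eq_matI)
      fix i j assume "i < dim_row (M * T)" "j < dim_col (M * T)"
      then have ij: "i < Suc n" "j < Suc n" using M T by auto
      have "(companion (F * G) * M) $$ (i, j) = coeff (v j * monom 1 1 - smult (coeff (v j) n) (F * G)) i"
      proof -
        have "coeff (v j * monom 1 1) i = (if i = 0 then 0 else coeff (v j) (i - 1))"
          unfolding mult.commute[of "v j"] coeff_monom_mult by simp
        moreover have "M $$ (l, j) = coeff (v j) l" if "l < Suc n" for l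
          using that ij by (simp add: M_def)
        ultimately show ?thesis
          unfolding companion_mult_index[OF deg M ij] using ij by simp
      qed
      also have "\<dots> = (\<Sum>l<Suc n. coeff (v l) i * T $$ (l, j))"
        unfolding step[OF ij(2)] by (simp add: coeff_sum mult.commute)
      also have "\<dots> = (M * T) $$ (i, j)"
        using ij M T by (simp add: scalar_prod_def M_def lessThan_atLeast0 del: sum.op_ivl_Suc)
      finally show "(companion (F * G) * M) $$ (i, j) = (M * T) $$ (i, j)" .
    qed (use M T deg in \<open>auto simp: companion_def\<close>)
    have C: "companion (F * G) \<in> carrier_mat (Suc n) (Suc n)" using companion_carrier[of "F * G"] deg by simp
    have "companion (F * G) = companion (F * G) * (M * N)" using C N by simp
    also have "\<dots> = companion (F * G) * M * N"
      using C M N by (intro assoc_mult_mat[symmetric])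
    also have "\<dots> = M * T * N" by (simp add: CM)
    finally have "similar_mat_wit (companion (F * G)) T M N"
      using C M N T by (intro similar_mat_witI[of _ _ "Suc n"])
    then have "poly_trace f (companion (F * G)) = poly_trace f T" by (rule poly_trace_similar)
    also have "\<dots> = poly_trace f (companion F) + poly_trace f (companion G)"
      unfolding T_def by (rule poly_trace_block_lower) auto
    finally show ?thesis .
  qed
qed


section \<open>Irreducible polynomials over a finite field and their roots\<close>

lemma poly_trace_companion_linear:
  fixes x :: "'a :: field"
  shows "poly_trace f (companion [:-x, 1:]) = poly f x"
proof -
  have "companion [:-x, 1:] = mat 1 1 (\<lambda>_. x)"
    unfolding companion_def by (rule eq_matI) auto
  moreover have "mat 1 1 (\<lambda>_. x) ^\<^sub>m i = mat 1 1 (\<lambda>_. x ^ i)" for i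
    by (induction i) (auto intro!: eq_matI simp: scalar_prod_def)
  ultimately show ?thesis
    by (simp add: poly_trace_def mat_trace_def poly_altdef)
qed

lemma poly_trace_companion_prod_linear:
  fixes x :: "'b \<Rightarrow> 'a :: field"
  assumes "finite A"
  shows "poly_trace f (companion (\<Prod>i\<in>A. [:-x i, 1:])) = (\<Sum>i\<in>A. poly f (x i))"
  using assms
proof (induction A)
  case empty
  show ?case by simp
next
  case (insert i A)
  have "monic (\<Prod>i\<in>A. [:-x i, 1:])" by (rule monic_prod) auto
  then have "poly_trace f (companion ([:-x i, 1:] * (\<Prod>i\<in>A. [:-x i, 1:])))
      = poly_trace f (companion [:-x i, 1:]) + poly_trace f (companion (\<Prod>i\<in>A. [:-x i, 1:]))"
    by (intro poly_trace_companion_mult) auto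
  with insert show ?case by (simp only: prod.insert[OF insert(1,2)] sum.insert[OF insert(1,2)] poly_trace_companion_linear)
qed

lemma map_mat_to_ac_pow:
  assumes "A \<in> carrier_mat n n"
  shows "map_mat to_ac A ^\<^sub>m i = map_mat to_ac (A ^\<^sub>m i)"
  by (rule to_ac_poly.base.mat_hom_pow[OF assms, symmetric])

lemma to_ac_poly_trace_companion:
  "to_ac (poly_trace f (companion F)) = poly_trace (map_poly to_ac f) (companion (map_poly to_ac F))"
proof -
  have "companion (map_poly to_ac F) = map_mat to_ac (companion F)"
    unfolding companion_def by (rule eq_matI) auto
  moreover have "mat_trace (map_mat to_ac (companion F) ^\<^sub>m i) = to_ac (mat_trace (companion F ^\<^sub>m i))" for i
  proof -
    have "companion F ^\<^sub>m i \<in> carrier_mat (degree F) (degree F)"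
      by (rule pow_carrier_mat[OF companion_carrier])
    then have "dim_row (companion F ^\<^sub>m i) = degree F" "dim_col (companion F ^\<^sub>m i) = degree F" by blast+
    then show ?thesis
      unfolding map_mat_to_ac_pow[OF companion_carrier] mat_trace_def to_ac_sum
      by (intro sum.cong) auto
  qed
  ultimately show ?thesis by (simp add: poly_trace_def to_ac_sum)
qed

lemma degree_irreducible_pos: "irreducible P \<Longrightarrow> degree P > 0"
  for P :: "'a :: field poly"
  unfolding Factorial_Ring.irreducible_def using is_unit_iff_degree[of P] by auto

text \<open>A nonzero polynomial of least degree vanishing at \<open>\<alpha>\<close> divides every
  other polynomial vanishing there, by division with remainder. As it is not constant, the
  irreducible \<open>P\<close> divides it in turn.\<close>

lemma irreducible_dvd_iff_eval_ac_eq_0: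
  fixes P Q :: "'a :: field poly"
  assumes "irreducible P" "eval_ac P \<alpha> = 0"
  shows "P dvd Q \<longleftrightarrow> eval_ac Q \<alpha> = 0"
proof
  assume "P dvd Q"
  then show "eval_ac Q \<alpha> = 0" using assms(2) by (auto elim!: dvdE simp: to_ac_poly.hom_mult)
next
  assume Q: "eval_ac Q \<alpha> = 0"
  have "\<exists>m. (m \<noteq> 0 \<and> eval_ac m \<alpha> = 0) \<and> (\<forall>r. r \<noteq> 0 \<and> eval_ac r \<alpha> = 0 \<longrightarrow> degree m \<le> degree r)"
    by (rule ex_has_least_nat[of _ P]) (use assms in auto)
  then obtain m where m: "m \<noteq> 0" "eval_ac m \<alpha> = 0"
    and least: "\<And>r. r \<noteq> 0 \<Longrightarrow> eval_ac r \<alpha> = 0 \<Longrightarrow> degree m \<le> degree r" by blast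
  have dvd: "m dvd R" if "eval_ac R \<alpha> = 0" for R
  proof -
    have "R = m * (R div m) + R mod m" by simp
    then have "eval_ac R \<alpha> = eval_ac m \<alpha> * eval_ac (R div m) \<alpha> + eval_ac (R mod m) \<alpha>"
      by (metis to_ac_poly.hom_add to_ac_poly.hom_mult poly_add poly_mult)
    then have "eval_ac (R mod m) \<alpha> = 0" using that m by simp
    then have "R mod m = 0" using least[of "R mod m"] degree_mod_less[OF m(1), of R] by force
    then show ?thesis by auto
  qed
  obtain u where u: "P = m * u" using dvd[OF assms(2)] by (elim dvdE)
  have "\<not> is_unit m"
  proof
    assume "is_unit m"
    then have "degree m = 0" using is_unit_iff_degree[OF m(1)] by simp
    then obtain c where "m = [:c:]" by (elim degree_eq_zeroE)
    with m show False by (simp add: eval_ac_const)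
  qed
  then have "is_unit u" using Factorial_Ring.irreducibleD[OF assms(1) u] by blast
  then have "P dvd m" unfolding u by simp
  then show "P dvd Q" using dvd[OF Q] by (rule dvd_trans)
qed

section \<open>Frobenius orbits and the roots of an irreducible polynomial\<close>

lemma frobenius_ac_inj:
  fixes x y :: "'a :: {field, finite} alg_closure"
  assumes "x ^ (CARD('a) ^ i) = y ^ (CARD('a) ^ i)"
  shows "x = y"
proof -
  \<comment> \<open>The two-element index set specialises \<open>frobenius_sum_ac\<close> to the sum
    of \<open>x - y\<close> and \<open>y\<close>.\<close>
  have "(\<Sum>t\<in>{True, False}. if t then x - y else y) ^ (CARD('a) ^ i)
      = (\<Sum>t\<in>{True, False}. (if t then x - y else y) ^ (CARD('a) ^ i))"
    by (rule frobenius_sum_ac)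
  then have "x ^ (CARD('a) ^ i) = (x - y) ^ (CARD('a) ^ i) + y ^ (CARD('a) ^ i)" by simp
  with assms show ?thesis by simp
qed

text \<open>The values at \<open>\<alpha>\<close> of polynomials of degree below
  \<open>degree P\<close> are pairwise distinct, by irreducibility. If \<open>\<alpha>\<close> were
  fixed, all \<open>q ^ degree P\<close> of them would be fixed too and hence be roots of
  \<open>x ^ (q ^ t) - x\<close>, which has at most \<open>q ^ t\<close> roots.\<close>

lemma frobenius_orbit_irreducible:
  fixes P :: "'a :: {field, finite} poly"
  assumes "irreducible P" "eval_ac P \<alpha> = 0" "0 < t" "t < degree P"
  shows "\<alpha> ^ (CARD('a) ^ t) \<noteq> \<alpha>"
proof
  let ?q = "CARD('a)"
  assume fx: "\<alpha> ^ (?q ^ t) = \<alpha>"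
  define W :: "'a alg_closure poly" where "W = monom 1 (?q ^ t) - monom 1 1"
  have gt: "1 < ?q ^ t" using CARD_ge_2[where ?'a = 'a] assms(3) by (intro one_less_power) auto
  then have degW: "degree W = ?q ^ t"
    unfolding W_def by (subst diff_conv_add_uminus, subst degree_add_eq_left) (auto simp: degree_monom_eq)
  then have "W \<noteq> 0" using gt by auto
  have inj: "inj_on (\<lambda>R. eval_ac R \<alpha>) (polys_below (degree P))"
  proof (rule inj_onI)
    fix R S assume RS: "R \<in> polys_below (degree P)" "S \<in> polys_below (degree P)" "eval_ac R \<alpha> = eval_ac S \<alpha>"
    then have "P dvd R - S"
      using irreducible_dvd_iff_eval_ac_eq_0[OF assms(1,2)] by (simp add: to_ac_poly.hom_minus)
    moreover have "R - S \<in> polys_below (degree P)" using RS by (simp add: polys_below_def)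
    ultimately have "R - S = 0" using dvd_imp_degree_le by (force simp: polys_below_iff)
    then show "R = S" by simp
  qed
  have "eval_ac R \<alpha> \<in> {x. poly W x = 0}" for R
    using eval_ac_frobenius[of R \<alpha> t] fx by (simp add: W_def poly_monom)
  then have "card (polys_below (degree P) :: 'a poly set) \<le> card {x. poly W x = 0}"
    using poly_roots_finite[OF \<open>W \<noteq> 0\<close>] by (intro card_inj_on_le[OF inj]) auto
  also have "\<dots> \<le> ?q ^ t" using card_poly_roots_bound[OF \<open>W \<noteq> 0\<close>] degW by simp
  finally have "?q ^ degree P \<le> ?q ^ t" by (simp add: card_polys_below)
  moreover have "?q ^ t < ?q ^ degree P"
    using CARD_ge_2[where ?'a = 'a] assms(4) by (intro power_strict_increasing) auto
  ultimately show False by simp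
qed

lemma frobenius_orbit_inj:
  fixes P :: "'a :: {field, finite} poly"
  assumes "irreducible P" "eval_ac P \<alpha> = 0"
  shows "inj_on (\<lambda>j. \<alpha> ^ (CARD('a) ^ j)) {..<degree P}"
proof -
  have "i = j" if ij: "i < degree P" "j < degree P" "i \<le> j" "\<alpha> ^ (CARD('a) ^ i) = \<alpha> ^ (CARD('a) ^ j)" for i j
  proof (rule ccontr)
    assume "i \<noteq> j"
    have "CARD('a) ^ j = CARD('a) ^ (j - i) * CARD('a) ^ i" using ij by (simp flip: power_add)
    then have "\<alpha> ^ (CARD('a) ^ i) = (\<alpha> ^ (CARD('a) ^ (j - i))) ^ (CARD('a) ^ i)"
      using ij(4) by (simp add: power_mult)
    then have "\<alpha> = \<alpha> ^ (CARD('a) ^ (j - i))" by (rule frobenius_ac_inj)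
    moreover have "0 < j - i" "j - i < degree P" using ij \<open>i \<noteq> j\<close> by auto
    ultimately show False using frobenius_orbit_irreducible[OF assms, of "j - i"] by metis
  qed
  then show ?thesis unfolding inj_on_def by (metis lessThan_iff nat_le_linear)
qed

lemma eval_ac_frobenius_root:
  fixes P :: "'a :: {field, finite} poly"
  assumes "eval_ac P \<alpha> = 0"
  shows "eval_ac P (\<alpha> ^ (CARD('a) ^ j)) = 0"
  using assms by (simp flip: eval_ac_frobenius)

text \<open>The Frobenius orbit of one root already has \<open>degree P\<close> elements, which
  leaves no room for other roots.\<close>

lemma roots_irreducible:
  fixes P :: "'a :: {field, finite} poly"
  assumes "irreducible P" "eval_ac P \<alpha> = 0"
  shows "{x. eval_ac P x = 0} = (\<lambda>j. \<alpha> ^ (CARD('a) ^ j)) ` {..<degree P}" (is "?R = ?O")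
    and "card {x. eval_ac P x = 0} = degree P"
proof -
  have nz: "map_poly to_ac P \<noteq> 0" using assms(1) by auto
  have sub: "?O \<subseteq> ?R" using eval_ac_frobenius_root[OF assms(2)] by auto
  have cO: "card ?O = degree P" using card_image[OF frobenius_orbit_inj[OF assms]] by simp
  have "card ?R \<le> degree P" using card_poly_roots_bound[OF nz] by simp
  then show "?R = ?O"
    using sub cO poly_roots_finite[OF nz] by (metis card_seteq)
  then show "card ?R = degree P" using cO by simp
qed

lemma irreducible_split_ac:
  fixes P :: "'a :: {field, finite} poly"
  assumes "irreducible P" "monic P" "eval_ac P \<alpha> = 0"
  shows "map_poly to_ac P = (\<Prod>j<degree P. [:- (\<alpha> ^ (CARD('a) ^ j)), 1:])" (is "?L = ?R")
proof (rule ccontr)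
  assume "?L \<noteq> ?R"
  then have nz: "?L - ?R \<noteq> 0" by simp
  let ?n = "degree P"
  have n: "?n > 0" by (rule degree_irreducible_pos[OF assms(1)])
  have dR: "degree ?R = ?n" by (subst degree_prod_eq_sum_degree) auto
  have mR: "monic ?R" by (rule monic_prod) auto
  have "coeff (?L - ?R) ?n = 0" using assms(2) dR mR by simp
  moreover have "degree (?L - ?R) \<le> ?n" using dR by (intro degree_diff_le) auto
  ultimately have "degree (?L - ?R) < ?n"
    using n nz by (metis le_neq_implies_less leading_coeff_0_iff)
  moreover have "card {x. eval_ac P x = 0} \<le> card {x. poly (?L - ?R) x = 0}"
  proof (rule card_mono)
    show "{x. eval_ac P x = 0} \<subseteq> {x. poly (?L - ?R) x = 0}"
      unfolding roots_irreducible(1)[OF assms(1,3)]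
      using eval_ac_frobenius_root[OF assms(3)] by (auto simp: poly_prod intro!: prod_zero)
  qed (use poly_roots_finite[OF nz] in auto)
  then have "?n \<le> card {x. poly (?L - ?R) x = 0}" unfolding roots_irreducible(2)[OF assms(1,3)] .
  ultimately show False using card_poly_roots_bound[OF nz] by simp
qed

text \<open>Identifies the matrix statistic with the field trace that Stepanov's method controls:
  over the closure the companion matrix of \<open>P\<close> has the Frobenius conjugates of
  \<open>\<alpha>\<close> as eigenvalues, and evaluation of \<open>f\<close> commutes with
  Frobenius.\<close>

theorem poly_trace_companion_irreducible:
  fixes P :: "'a :: {field, finite} poly"
  assumes "irreducible P" "monic P" "eval_ac P \<alpha> = 0"
  shows "to_ac (poly_trace f (companion P)) = eval_ac (partial_trace f (degree P)) \<alpha>"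
  unfolding to_ac_poly_trace_companion irreducible_split_ac[OF assms]
  by (simp add: poly_trace_companion_prod_linear eval_ac_partial_trace eval_ac_frobenius)

text \<open>The Frobenius image of \<open>\<alpha>\<close> after \<open>degree P\<close> steps is a
  conjugate with some index \<open>j\<close>. Cancelling \<open>j\<close> steps makes
  \<open>degree P - j\<close> a period, and no positive period is below
  \<open>degree P\<close>.\<close>

lemma frobenius_period:
  fixes P :: "'a :: {field, finite} poly"
  assumes "irreducible P" "eval_ac P \<alpha> = 0"
  shows "\<alpha> ^ (CARD('a) ^ (degree P * r)) = \<alpha>"
proof -
  let ?n = "degree P"
  have "\<alpha> ^ (CARD('a) ^ ?n) \<in> (\<lambda>j. \<alpha> ^ (CARD('a) ^ j)) ` {..<?n}"
    using eval_ac_frobenius_root[OF assms(2)] unfolding roots_irreducible(1)[OF assms, symmetric] by simp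
  then obtain j where j: "j < ?n" "\<alpha> ^ (CARD('a) ^ ?n) = \<alpha> ^ (CARD('a) ^ j)" by auto
  have "CARD('a) ^ ?n = CARD('a) ^ (?n - j) * CARD('a) ^ j" using j by (simp flip: power_add)
  then have "(\<alpha> ^ (CARD('a) ^ (?n - j))) ^ (CARD('a) ^ j) = \<alpha> ^ (CARD('a) ^ j)"
    using j(2) by (simp add: power_mult)
  then have "\<alpha> ^ (CARD('a) ^ (?n - j)) = \<alpha>" by (rule frobenius_ac_inj)
  then have "j = 0" using frobenius_orbit_irreducible[OF assms, of "?n - j"] j by (cases "j = 0") auto
  then have n: "\<alpha> ^ (CARD('a) ^ ?n) = \<alpha>" using j by simp
  show ?thesis
  proof (induction r)
    case (Suc r)
    have "CARD('a) ^ (?n * Suc r) = CARD('a) ^ ?n * CARD('a) ^ (?n * r)" by (simp add: power_add)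
    then show ?case using n Suc by (simp only: power_mult)
  qed simp
qed

text \<open>Transitivity of the trace for an element of the subfield with
  \<open>q ^ degree P\<close> elements. The factor \<open>r\<close> is the one by which the
  contribution of \<open>P ^ r\<close> exceeds that of \<open>P\<close> in
  \<open>root_trace_power\<close>.\<close>

lemma partial_trace_multiple:
  fixes P :: "'a :: {field, finite} poly"
  assumes "irreducible P" "eval_ac P \<alpha> = 0"
  shows "eval_ac (partial_trace f (degree P * r)) \<alpha> = of_nat r * eval_ac (partial_trace f (degree P)) \<alpha>"
proof (induction r)
  case 0
  show ?case by (simp add: partial_trace_def)
next
  case (Suc r)
  let ?n = "degree P"
  have "eval_ac f \<alpha> ^ (CARD('a) ^ (?n * r + j)) = eval_ac f \<alpha> ^ (CARD('a) ^ j)" for j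
    unfolding power_add power_mult by (simp only: eval_ac_frobenius flip: power_mult)
      (simp only: power_mult[of _ "CARD('a) ^ (?n * r)"] frobenius_period[OF assms])
  then have "eval_ac (partial_trace f (?n * r + ?n)) \<alpha>
      = eval_ac (partial_trace f (?n * r)) \<alpha> + eval_ac (partial_trace f ?n) \<alpha>"
    by (simp add: eval_ac_partial_trace sum_lessThan_add)
  with Suc show ?case by (simp add: algebra_simps)
qed

lemma exists_root_ac:
  fixes P :: "'a :: field poly"
  assumes "irreducible P"
  shows "\<exists>\<alpha>. eval_ac P \<alpha> = 0"
proof -
  have "degree P > 0" by (rule degree_irreducible_pos[OF assms])
  then show ?thesis using alg_closed_imp_poly_has_root[of "map_poly to_ac P"] by auto
qed

section \<open>Counting monic polynomials by their trace\<close>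

definition monics :: "nat \<Rightarrow> 'a :: comm_ring_1 poly set" where
  "monics n = {F. monic F \<and> degree F = n}"

lemma monics_iff: "F \<in> monics n \<longleftrightarrow> monic F \<and> degree F = n"
  by (simp add: monics_def)

lemma bij_betw_monics: "bij_betw (\<lambda>p. monom 1 n + p) (polys_below n) (monics n :: 'a :: comm_ring_1 poly set)"
proof (rule bij_betw_byWitness[where f' = "\<lambda>p. p - monom 1 n"])
  have "degree (monom 1 n + p) = n \<and> coeff (monom 1 n + p) n = 1" if "p \<in> polys_below n" for p :: "'a poly"
  proof -
    have "coeff (monom 1 n + p) n = 1" using that by (simp add: polys_below_def)
    moreover have "coeff (monom 1 n + p) i = 0" if "i > n" for i
      using that \<open>p \<in> _\<close> by (simp add: polys_below_def)
    ultimately show ?thesis by (metis degree_le le_antisym le_degree one_neq_zero)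
  qed
  then show "(\<lambda>p. monom 1 n + p) ` polys_below n \<subseteq> (monics n :: 'a poly set)"
    by (auto simp: monics_def)
  show "(\<lambda>p. p - monom 1 n) ` monics n \<subseteq> (polys_below n :: 'a poly set)"
    by (auto simp: monics_def polys_below_def coeff_eq_0)
qed auto

lemma finite_monics [simp]: "finite (monics n :: 'a :: {field, finite} poly set)"
  using bij_betw_finite[OF bij_betw_monics[of n, where ?'a = 'a]] by simp

lemma card_monics: "card (monics n :: 'a :: {field, finite} poly set) = CARD('a) ^ n"
  using bij_betw_same_card[OF bij_betw_monics[of n, where ?'a = 'a]] by (simp add: card_polys_below)

lemma monics_mult:
  fixes F G :: "'a :: idom poly"
  assumes "F \<in> monics m" "G \<in> monics n"
  shows "F * G \<in> monics (m + n)"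
proof -
  have "F \<noteq> 0" "G \<noteq> 0" using assms by (auto simp: monics_iff)
  moreover have "lead_coeff (F * G) = lead_coeff F * lead_coeff G" by (rule lead_coeff_mult)
  ultimately show ?thesis using assms unfolding monics_iff by (auto simp: degree_mult_eq)
qed

lemma monics_power:
  fixes F :: "'a :: idom poly"
  assumes "F \<in> monics m"
  shows "F ^ r \<in> monics (r * m)"
  by (induction r) (use assms monics_mult in \<open>auto simp: monics_iff add.commute\<close>)

lemma monics_mult_cancel:
  fixes F G :: "'a :: idom poly"
  assumes "F * G \<in> monics n" "F \<in> monics m"
  shows "m \<le> n" "G \<in> monics (n - m)"
proof -
  have nz: "F \<noteq> 0" "G \<noteq> 0" using assms by (auto simp: monics_iff)
  then have "n = m + degree G" using assms by (simp add: monics_iff degree_mult_eq)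
  moreover have "lead_coeff (F * G) = lead_coeff F * lead_coeff G" by (rule lead_coeff_mult)
  then have "lead_coeff G = 1" using assms by (auto simp: monics_iff)
  ultimately show "m \<le> n" "G \<in> monics (n - m)" by (simp_all add: monics_iff)
qed

text \<open>Every exponent up to the multiplicity is listed separately. Weighting a pair by
  \<open>degree P\<close> thus gives the polynomial analogue of the von Mangoldt function, with the
  degree in the role of the logarithm.\<close>

definition prime_powers_dividing :: "'a :: field poly \<Rightarrow> ('a poly \<times> nat) set" where
  "prime_powers_dividing F = {(P, r). monic P \<and> irreducible P \<and> r > 0 \<and> P ^ r dvd F}"

lemma prime_elem_power_dvd_cancel:
  fixes p :: "'a :: idom"
  assumes "prime_elem p" "\<not> p dvd a" "p ^ n dvd a * b"
  shows "p ^ n dvd b"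
  using assms(3)
proof (induction n)
  case (Suc n)
  then have "p ^ n dvd b" by (metis power_le_dvd le_SucI order_refl)
  then obtain b' where b': "b = p ^ n * b'" by (elim dvdE)
  have "p ^ n * p dvd p ^ n * (a * b')" using Suc.prems by (simp add: b' ac_simps)
  moreover have "p \<noteq> 0" using assms(1) by auto
  ultimately have "p dvd a * b'" by (simp add: dvd_mult_cancel_left)
  then have "p dvd b'" using assms(1,2) by (simp add: prime_elem_dvd_mult_iff)
  then show ?case by (simp add: b' mult.commute mult_dvd_mono)
qed simp

lemma exists_monic_irreducible_dvd:
  fixes F :: "'a :: field poly"
  assumes "F \<noteq> 0" "degree F > 0"
  shows "\<exists>P. monic P \<and> irreducible P \<and> P dvd F"
proof -
  have "\<exists>P. (P dvd F \<and> degree P > 0) \<and> (\<forall>R. R dvd F \<and> degree R > 0 \<longrightarrow> degree P \<le> degree R)"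
    by (rule ex_has_least_nat[of _ F]) (use assms in auto)
  then obtain P where P: "P dvd F" "degree P > 0"
    and least: "\<And>R. R dvd F \<Longrightarrow> degree R > 0 \<Longrightarrow> degree P \<le> degree R" by blast
  have P0: "P \<noteq> 0" using P by auto
  have irr: "irreducible P"
  proof (rule Factorial_Ring.irreducibleI)
    show "\<not> is_unit P" using P P0 is_unit_iff_degree by force
    fix a b assume ab: "P = a * b"
    then have nz: "a \<noteq> 0" "b \<noteq> 0" using P0 by auto
    show "is_unit a \<or> is_unit b"
    proof (rule ccontr)
      assume "\<not> ?thesis"
      then have "degree a > 0" "degree b > 0" using nz is_unit_iff_degree by auto
      moreover have "degree P \<le> degree a"
        using least[of a] P(1) \<open>degree a > 0\<close> ab by (meson dvd_triv_left dvd_trans)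
      ultimately show False using ab nz by (simp add: degree_mult_eq)
    qed
  qed (rule P0)
  let ?c = "inverse (lead_coeff P)"
  have c: "?c \<noteq> 0" using P0 by simp
  have "irreducible ([:?c:] * P)"
    using irr c by (subst irreducible_mult_unit_left) (auto simp: is_unit_iff_degree)
  then have "irreducible (smult ?c P)" by simp
  moreover have "monic (smult ?c P)" using P0 by simp
  moreover have "smult ?c P dvd F" using P(1) c by (simp add: smult_dvd_iff)
  ultimately show ?thesis by blast
qed

lemma monic_irreducible_dvd_eq:
  fixes P Q :: "'a :: field poly"
  assumes "irreducible P" "irreducible Q" "monic P" "monic Q" "P dvd Q"
  shows "P = Q"
proof -
  obtain u where u: "Q = P * u" using assms(5) by (elim dvdE)
  have "\<not> is_unit P" using assms(1) unfolding Factorial_Ring.irreducible_def by blast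
  then have "is_unit u" using Factorial_Ring.irreducibleD[OF assms(2) u] by blast
  moreover have "u \<noteq> 0" using u assms(4) by auto
  ultimately have "degree u = 0" using is_unit_iff_degree by blast
  then obtain c where "u = [:c:]" by (elim degree_eq_zeroE)
  then have "Q = smult c P" using u by simp
  moreover from this have "c \<noteq> 0" using assms(4) by auto
  ultimately have "c = 1" using assms(3,4) by simp
  with \<open>Q = smult c P\<close> have "Q = P" by simp
  then show ?thesis by simp
qed

lemma finite_prime_powers_dividing [simp]:
  fixes F :: "'a :: {field, finite} poly"
  assumes "F \<noteq> 0"
  shows "finite (prime_powers_dividing F)"
proof (rule finite_subset)
  show "prime_powers_dividing F \<subseteq> polys_below (Suc (degree F)) \<times> {..degree F}"
  proof clarify
    fix P r assume "(P, r) \<in> prime_powers_dividing F"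
    then have P: "irreducible P" "r > 0" "P ^ r dvd F" by (auto simp: prime_powers_dividing_def)
    have "P \<noteq> 0" "degree P > 0" using P(1) degree_irreducible_pos by auto
    have "degree (P ^ r) \<le> degree F" using P(3) assms by (rule dvd_imp_degree_le)
    then have "degree P * r \<le> degree F" using \<open>P \<noteq> 0\<close> by (simp add: degree_power_eq mult.commute)
    moreover have "degree P * 1 \<le> degree P * r" "1 * r \<le> degree P * r"
      using \<open>r > 0\<close> \<open>degree P > 0\<close> by (intro mult_le_mono; simp)+
    ultimately have "degree P \<le> degree F" "r \<le> degree F" by linarith+
    then show "P \<in> polys_below (Suc (degree F)) \<and> r \<in> {..degree F}"
      by (auto simp: polys_below_iff)
  qed
qed simp

lemma sum_degree_prime_powers_dividing:
  fixes F :: "'a :: {field, finite} poly"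
  assumes "monic F"
  shows "(\<Sum>(P, r)\<in>prime_powers_dividing F. degree P) = degree F"
  using assms
proof (induction "degree F" arbitrary: F rule: less_induct)
  case less
  show ?case
  proof (cases "degree F = 0")
    case True
    then have F1: "F = 1" using less.prems monic_degree_0 by blast
    have "\<not> P ^ r dvd 1" if "irreducible P" "r > 0" for P :: "'a poly" and r
      using that by (metis Factorial_Ring.irreducible_def dvd_power dvd_trans)
    then have "prime_powers_dividing F = {}" unfolding F1 prime_powers_dividing_def by blast
    then show ?thesis using True by simp
  next
    case False
    then obtain P where P: "monic P" "irreducible P" "P dvd F"
      using exists_monic_irreducible_dvd[of F] by fastforce
    then obtain G where G: "F = P * G" by (elim dvdE)
    have Pe: "prime_elem P" using P(2) by (rule field_poly_irreducible_imp_prime)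
    have nz: "P \<noteq> 0" "F \<noteq> 0" "G \<noteq> 0" using P less.prems G by auto
    have mG: "monic G" using less.prems P(1) lead_coeff_mult[of P G] by (simp add: G)
    have deg: "degree F = degree P + degree G" using nz by (simp add: G degree_mult_eq)
    \<comment> \<open>Multiplying \<open>G\<close> by \<open>P\<close> raises each exponent of
      \<open>P\<close> by one and leaves the other pairs alone; \<open>(P, 1)\<close> is the only
      new pair.\<close>
    define h where "h = (\<lambda>(Q, r). if Q = P then (Q, Suc r) else (Q, r :: nat))"
    have inj: "inj h" by (auto simp: h_def inj_def split: if_splits)
    have eq: "prime_powers_dividing F = insert (P, 1) (h ` prime_powers_dividing G)"
    proof (intro Set.set_eqI iffI)
      fix x assume "x \<in> prime_powers_dividing F"
      then obtain Q r where x: "x = (Q, r)" and Q: "monic Q" "irreducible Q" "r > 0" "Q ^ r dvd P * G"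
        by (auto simp: prime_powers_dividing_def G)
      show "x \<in> insert (P, 1) (h ` prime_powers_dividing G)"
      proof (cases "Q = P")
        case True
        obtain s where s: "r = Suc s" using Q(3) gr0_conv_Suc by auto
        have "P ^ s dvd G" using Q(4) nz by (simp add: True s)
        then have "(P, s) \<in> prime_powers_dividing G" if "s > 0"
          using that P by (simp add: prime_powers_dividing_def)
        moreover have "(P, r) = h (P, s)" by (simp add: h_def s)
        ultimately show ?thesis by (cases "s = 0") (auto simp: x True s)
      next
        case False
        then have "\<not> Q dvd P" using monic_irreducible_dvd_eq[of Q P] Q P by blast
        then have "Q ^ r dvd G"
          using prime_elem_power_dvd_cancel[OF field_poly_irreducible_imp_prime[OF Q(2)] _ Q(4)] by blast
        then have "(Q, r) \<in> prime_powers_dividing G" using Q by (simp add: prime_powers_dividing_def)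
        moreover have "(Q, r) = h (Q, r)" using False by (simp add: h_def)
        ultimately show ?thesis unfolding x by (metis image_eqI insertCI)
      qed
    next
      fix x assume "x \<in> insert (P, 1) (h ` prime_powers_dividing G)"
      then show "x \<in> prime_powers_dividing F"
        using P G by (auto simp: h_def prime_powers_dividing_def split: if_splits)
    qed
    have notin: "(P, 1) \<notin> h ` prime_powers_dividing G"
      by (auto simp: h_def prime_powers_dividing_def split: if_splits)
    have "(\<Sum>(P, r)\<in>prime_powers_dividing F. degree P)
        = degree P + (\<Sum>(P, r)\<in>h ` prime_powers_dividing G. degree P)"
      unfolding eq using notin finite_prime_powers_dividing[OF nz(3)] by simp
    also have "(\<Sum>(P, r)\<in>h ` prime_powers_dividing G. degree P) = (\<Sum>(P, r)\<in>prime_powers_dividing G. degree P)"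
      by (subst sum.reindex[OF inj_on_subset[OF inj]]) (auto simp: h_def intro!: sum.cong split: if_splits)
    also have "\<dots> = degree G"
      using less.hyps[OF _ mG] deg degree_irreducible_pos[OF P(2)] by simp
    finally show ?thesis using deg by simp
  qed
qed

text \<open>The sum of \<open>f\<close> over the roots of \<open>F\<close>, with multiplicity.\<close>

abbreviation root_trace :: "'a :: field poly \<Rightarrow> 'a poly \<Rightarrow> 'a" where
  "root_trace f F \<equiv> poly_trace f (companion F)"

lemma root_trace_power:
  fixes P :: "'a :: field poly"
  assumes "monic P"
  shows "root_trace f (P ^ r) = of_nat r * root_trace f P"
proof (induction r)
  case (Suc r)
  have "monic (P ^ r)" using assms by (rule monic_power)
  then have "root_trace f (P * P ^ r) = root_trace f P + root_trace f (P ^ r)"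
    using assms by (intro poly_trace_companion_mult)
  with Suc show ?case by (simp add: algebra_simps)
qed simp

section \<open>Trace counts and their convolution recurrence\<close>

definition trace_count :: "'a :: {field, finite} poly \<Rightarrow> nat \<Rightarrow> 'a \<Rightarrow> nat" where
  "trace_count f n c = card {F \<in> monics n. root_trace f F = c}"

text \<open>A prime \<open>P\<close> occurs here on behalf of its power of degree \<open>d\<close>.\<close>

definition primes_over :: "'a :: {field, finite} poly \<Rightarrow> nat \<Rightarrow> 'a \<Rightarrow> 'a poly set" where
  "primes_over f d c = {P. monic P \<and> irreducible P \<and> degree P dvd d
     \<and> of_nat (d div degree P) * root_trace f P = c}"

text \<open>For \<open>d > 0\<close> this is the number of elements of the field with
  \<open>q ^ d\<close> elements at which the trace of \<open>f\<close> equals \<open>c\<close>: that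
  field consists of the roots of all monic irreducible polynomials of degree dividing
  \<open>d\<close>.\<close>

definition prime_weight :: "'a :: {field, finite} poly \<Rightarrow> nat \<Rightarrow> 'a \<Rightarrow> nat" where
  "prime_weight f d c = (\<Sum>P\<in>primes_over f d c. degree P)"

lemma sum_card_fibres:
  assumes "finite A"
  shows "(\<Sum>c\<in>UNIV. card {x \<in> A. g x = (c :: 'c :: finite)}) = card A"
proof -
  have "card A = card (\<Union>c\<in>UNIV. {x \<in> A. g x = c})" by (rule arg_cong[of _ _ card]) auto
  also have "\<dots> = (\<Sum>c\<in>UNIV. card {x \<in> A. g x = c})"
    using assms by (intro card_UN_disjoint) auto
  finally show ?thesis by simp
qed

lemma sum_trace_count: "(\<Sum>c\<in>UNIV. trace_count f n c) = CARD('a) ^ n"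
  for f :: "'a :: {field, finite} poly"
  unfolding trace_count_def by (subst sum_card_fibres) (auto simp: card_monics)

lemma finite_primes_over: "d > 0 \<Longrightarrow> finite (primes_over f d c)"
  by (rule finite_subset[of _ "polys_below (Suc d)"])
    (auto simp: primes_over_def polys_below_iff intro!: le_imp_less_Suc dvd_imp_le)

lemma card_multiples:
  fixes P :: "'a :: {field, finite} poly"
  assumes P: "P \<in> monics m" and mn: "m \<le> n"
  shows "card {F \<in> monics n. root_trace f F = c \<and> P dvd F} = trace_count f (n - m) (c - root_trace f P)"
proof -
  have "bij_betw ((*) P) {F \<in> monics (n - m). root_trace f F = c - root_trace f P}
    {F \<in> monics n. root_trace f F = c \<and> P dvd F}"
  proof (rule bij_betw_imageI)
    have "P \<noteq> 0" using P by (auto simp: monics_iff)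
    then show "inj_on ((*) P) {F \<in> monics (n - m). root_trace f F = c - root_trace f P}"
      by (auto simp: inj_on_def)
    show "(*) P ` {F \<in> monics (n - m). root_trace f F = c - root_trace f P}
        = {F \<in> monics n. root_trace f F = c \<and> P dvd F}"
    proof (intro Set.set_eqI iffI)
      fix F assume "F \<in> (*) P ` {F \<in> monics (n - m). root_trace f F = c - root_trace f P}"
      then obtain G where G: "F = P * G" "G \<in> monics (n - m)" "root_trace f G = c - root_trace f P" by auto
      moreover have "root_trace f F = root_trace f P + root_trace f G"
        unfolding G(1) using P G by (intro poly_trace_companion_mult) (auto simp: monics_iff)
      ultimately show "F \<in> {F \<in> monics n. root_trace f F = c \<and> P dvd F}"
        using monics_mult[OF P G(2)] mn by auto
    next
      fix F assume "F \<in> {F \<in> monics n. root_trace f F = c \<and> P dvd F}"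
      then have F: "F \<in> monics n" "root_trace f F = c" "P dvd F" by auto
      then obtain G where "F = P * G" by (elim dvdE)
      note G = this F
      have G': "G \<in> monics (n - m)" using monics_mult_cancel(2)[OF _ P] G by auto
      moreover have "root_trace f F = root_trace f P + root_trace f G"
        unfolding G(1) using P G' by (intro poly_trace_companion_mult) (auto simp: monics_iff)
      then have "root_trace f G = c - root_trace f P" using G by (simp add: algebra_simps)
      ultimately show "F \<in> (*) P ` {F \<in> monics (n - m). root_trace f F = c - root_trace f P}"
        using G(1) by (intro image_eqI[of _ _ G]) auto
    qed
  qed
  then show ?thesis unfolding trace_count_def by (rule bij_betw_same_card[symmetric])
qed

text \<open>The coefficientwise form of the logarithmic derivative of the Euler product: count pairs of a
  monic polynomial and a prime power dividing it, weighted by the degree of the prime.\<close>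

theorem trace_count_recurrence:
  fixes f :: "'a :: {field, finite} poly"
  shows "n * trace_count f n c =
    (\<Sum>d=1..n. \<Sum>c'\<in>UNIV. prime_weight f d c' * trace_count f (n - d) (c - c'))"
proof -
  define A where "A = {F \<in> monics n. root_trace f F = c}"
  have finA: "finite A" by (simp add: A_def)
  define U where "U = {(P :: 'a poly, r). monic P \<and> irreducible P \<and> r > 0 \<and> r * degree P \<le> n}"
  have Ufin: "finite U"
  proof (rule finite_subset)
    show "U \<subseteq> polys_below (Suc n) \<times> {..n}"
    proof clarify
      fix P :: "'a poly" and r assume "(P, r) \<in> U"
      then have "irreducible P" "r > 0" "r * degree P \<le> n" by (auto simp: U_def)
      moreover from this have "degree P > 0" using degree_irreducible_pos by blast
      ultimately have "degree P \<le> n" "r \<le> n"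
        by (metis le_trans mult_le_mono1 mult_1 Suc_leI One_nat_def, metis le_trans mult_le_mono2 mult.right_neutral Suc_leI One_nat_def)
      then show "P \<in> polys_below (Suc n) \<and> r \<in> {..n}" by (auto simp: polys_below_iff)
    qed
  qed simp
  have pp: "prime_powers_dividing F = {x \<in> U. fst x ^ snd x dvd F}" if "F \<in> A" for F
  proof -
    have F: "F \<noteq> 0" "degree F = n" using that by (auto simp: A_def monics_iff)
    have "r * degree P \<le> n" if "P ^ r dvd F" "irreducible P" for P r
    proof -
      have "P \<noteq> 0" using that(2) degree_irreducible_pos by force
      then show ?thesis using dvd_imp_degree_le[OF that(1) F(1)] F(2) by (simp add: degree_power_eq mult.commute)
    qed
    then show ?thesis by (auto simp: prime_powers_dividing_def U_def)
  qed
  have "n * trace_count f n c = (\<Sum>F\<in>A. degree F)"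
    by (simp add: A_def trace_count_def monics_iff)
  also have "\<dots> = (\<Sum>F\<in>A. \<Sum>x\<in>prime_powers_dividing F. degree (fst x))"
    by (intro sum.cong refl, rule sum_degree_prime_powers_dividing[symmetric, unfolded case_prod_beta])
      (auto simp: A_def monics_iff)
  also have "\<dots> = (\<Sum>F\<in>A. \<Sum>x\<in>{x \<in> U. fst x ^ snd x dvd F}. degree (fst x))"
    by (intro sum.cong refl) (simp add: pp)
  \<comment> \<open>Double counting: instead of the prime powers dividing a given \<open>F\<close>,
    the multiples of a given prime power are counted.\<close>
  also have "\<dots> = (\<Sum>x\<in>U. \<Sum>F\<in>{F \<in> A. fst x ^ snd x dvd F}. degree (fst x))"
    by (rule sum.swap_restrict[OF finA Ufin])
  also have "\<dots> = (\<Sum>x\<in>U. degree (fst x) *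
      trace_count f (n - snd x * degree (fst x)) (c - of_nat (snd x) * root_trace f (fst x)))"
  proof (intro sum.cong refl)
    fix x assume "x \<in> U"
    then obtain P r where x: "x = (P, r)" "monic P" "irreducible P" "r > 0" "r * degree P \<le> n"
      by (auto simp: U_def)
    have "P ^ r \<in> monics (r * degree P)" using x by (intro monics_power) (simp add: monics_iff)
    from card_multiples[OF this x(5), of f c]
    show "(\<Sum>F\<in>{F \<in> A. fst x ^ snd x dvd F}. degree (fst x)) =
      degree (fst x) * trace_count f (n - snd x * degree (fst x)) (c - of_nat (snd x) * root_trace f (fst x))"
      by (simp add: x(1) A_def root_trace_power[OF x(2)] conj_assoc mult.commute)
  qed
  \<comment> \<open>Pairs are regrouped by \<open>d = r * degree P\<close> and by the trace that
    \<open>P ^ r\<close> contributes; \<open>r\<close> is recovered as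
    \<open>d div degree P\<close>.\<close>
  also have "\<dots> = (\<Sum>y\<in>(SIGMA d:{1..n}. SIGMA c':UNIV. primes_over f d c').
      degree (snd (snd y)) * trace_count f (n - fst y) (c - fst (snd y)))"
  proof (rule sum.reindex_bij_witness[where
        i = "\<lambda>y. (snd (snd y), fst y div degree (snd (snd y)))" and
        j = "\<lambda>x. (snd x * degree (fst x), of_nat (snd x) * root_trace f (fst x), fst x)"])
    fix x assume "x \<in> U"
    then obtain P r where x: "x = (P, r)" "monic P" "irreducible P" "r > 0" "r * degree P \<le> n"
      by (auto simp: U_def)
    have pos: "degree P > 0" using x(3) by (rule degree_irreducible_pos)
    show "(snd (snd (snd x * degree (fst x), of_nat (snd x) * root_trace f (fst x), fst x)),
        fst (snd x * degree (fst x), of_nat (snd x) * root_trace f (fst x), fst x) div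
        degree (snd (snd (snd x * degree (fst x), of_nat (snd x) * root_trace f (fst x), fst x)))) = x"
      using pos by (simp add: x)
    show "(snd x * degree (fst x), of_nat (snd x) * root_trace f (fst x), fst x)
        \<in> (SIGMA d:{1..n}. SIGMA c':UNIV. primes_over f d c')"
      using pos x by (auto simp: primes_over_def Suc_le_eq)
  next
    fix y assume "y \<in> (SIGMA d:{1..n}. SIGMA c':UNIV. primes_over f d c')"
    then obtain d P where y: "y = (d, of_nat (d div degree P) * root_trace f P, P)" "1 \<le> d" "d \<le> n"
      "monic P" "irreducible P" "degree P dvd d"
      by (auto simp: primes_over_def)
    have dd: "d div degree P * degree P = d" using y(6) by simp
    show "(\<lambda>x. (snd x * degree (fst x), of_nat (snd x) * root_trace f (fst x), fst x))
       (snd (snd y), fst y div degree (snd (snd y))) = y" using dd by (simp add: y(1))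
    have "d div degree P > 0" using dd y(2) by (metis gr0I mult_0 not_one_le_zero)
    then show "(snd (snd y), fst y div degree (snd (snd y))) \<in> U" using dd y by (simp add: U_def)
  qed auto
  also have "\<dots> = (\<Sum>d=1..n. \<Sum>c'\<in>UNIV. \<Sum>P\<in>primes_over f d c'. degree P * trace_count f (n - d) (c - c'))"
  proof -
    have fin: "finite (primes_over f d c')" if "d \<in> {1..n}" for d c'
      using that by (intro finite_primes_over) auto
    have "(\<Sum>y\<in>(SIGMA d:{1..n}. SIGMA c':UNIV. primes_over f d c').
        degree (snd (snd y)) * trace_count f (n - fst y) (c - fst (snd y)))
      = (\<Sum>d=1..n. \<Sum>z\<in>(SIGMA c':UNIV. primes_over f d c'). degree (snd z) * trace_count f (n - d) (c - fst z))"
      using fin by (subst sum.Sigma) (auto simp: case_prod_beta)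
    also have "\<dots> = (\<Sum>d=1..n. \<Sum>c'\<in>UNIV. \<Sum>P\<in>primes_over f d c'. degree P * trace_count f (n - d) (c - c'))"
      using fin by (intro sum.cong refl, subst sum.Sigma) (auto simp: case_prod_beta)
    finally show ?thesis .
  qed
  finally show ?thesis by (simp add: prime_weight_def sum_distrib_right)
qed

text \<open>Summing the recurrence over \<open>c\<close> removes the trace. By induction each
  \<open>d < n\<close> contributes \<open>q ^ n\<close> to a total of \<open>n * q ^ n\<close>,
  which leaves \<open>q ^ n\<close> for \<open>d = n\<close>.\<close>

lemma sum_prime_weight:
  fixes f :: "'a :: {field, finite} poly"
  assumes "d > 0"
  shows "(\<Sum>c\<in>UNIV. prime_weight f d c) = CARD('a) ^ d"
  using assms
proof (induction d rule: less_induct)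
  case (less n)
  let ?q = "CARD('a)" and ?s = "\<lambda>d. \<Sum>c\<in>UNIV. prime_weight f d c"
  have shift: "(\<Sum>c\<in>UNIV. trace_count f m (c - c')) = ?q ^ m" for m c'
  proof -
    have "(\<Sum>c\<in>UNIV. trace_count f m (c - c')) = (\<Sum>c\<in>UNIV. trace_count f m c)"
      by (rule sum.reindex_bij_witness[of _ "\<lambda>c. c + c'" "\<lambda>c. c - c'"]) auto
    then show ?thesis by (simp add: sum_trace_count)
  qed
  have "n * ?q ^ n = (\<Sum>c\<in>UNIV. n * trace_count f n c)"
    by (simp add: sum_trace_count flip: sum_distrib_left)
  also have "\<dots> = (\<Sum>d=1..n. \<Sum>c'\<in>UNIV. \<Sum>c\<in>UNIV. prime_weight f d c' * trace_count f (n - d) (c - c'))"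
  proof -
    have "(\<Sum>c\<in>UNIV. n * trace_count f n c) =
      (\<Sum>d=1..n. \<Sum>c\<in>UNIV. \<Sum>c'\<in>UNIV. prime_weight f d c' * trace_count f (n - d) (c - c'))"
      unfolding trace_count_recurrence by (rule sum.swap)
    also have "\<dots> = (\<Sum>d=1..n. \<Sum>c'\<in>UNIV. \<Sum>c\<in>UNIV. prime_weight f d c' * trace_count f (n - d) (c - c'))"
      by (rule sum.cong[OF refl], rule sum.swap)
    finally show ?thesis .
  qed
  also have "\<dots> = (\<Sum>d=1..n. ?s d * ?q ^ (n - d))"
    by (simp add: shift sum_distrib_right flip: sum_distrib_left)
  also have "\<dots> = ?s n + (\<Sum>d\<in>{1..<n}. ?s d * ?q ^ (n - d))"
  proof -
    have "{1..n} = insert n {1..<n}" using less.prems by auto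
    then show ?thesis by simp
  qed
  also have "(\<Sum>d\<in>{1..<n}. ?s d * ?q ^ (n - d)) = (\<Sum>d\<in>{1..<n}. ?q ^ n)"
    by (intro sum.cong refl) (simp add: less.IH flip: power_add)
  finally have "n * ?q ^ n = ?s n + (n - 1) * ?q ^ n" by simp
  moreover have "n * ?q ^ n = ?q ^ n + (n - 1) * ?q ^ n"
    using less.prems by (cases n) auto
  ultimately show ?case by simp
qed

text \<open>Every root of a prime counted by the weight is a root of the Stepanov polynomial.\<close>

theorem prime_weight_upper:
  fixes f :: "'a :: {field, finite} poly"
  assumes deg: "degree f = k" "k > 0" and cop: "coprime k CARD('a)"
    and m: "0 < m" "m < d" and km: "k * CARD('a) ^ m \<le> CARD('a) ^ (d - m - 1)"
  shows "prime_weight f d c \<le> CARD('a) ^ (d - 1) + 2 * k * CARD('a) ^ (d - m)"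
proof -
  obtain E where E: "E \<noteq> 0" "degree E \<le> CARD('a) ^ (d - 1) + 2 * k * CARD('a) ^ (d - m)"
    and van: "\<And>\<alpha>. \<alpha> ^ (CARD('a) ^ d) = \<alpha> \<Longrightarrow> eval_ac (partial_trace f d) \<alpha> = to_ac c \<Longrightarrow> eval_ac E \<alpha> = 0"
    by (rule stepanov_auxiliary_polynomial[OF assms, of c]) blast
  let ?R = "\<lambda>P. {x. eval_ac P x = 0}"
  have Enz: "map_poly to_ac E \<noteq> 0" using E(1) by simp
  \<comment> \<open>Irreducible polynomials have as many roots as their degree, and distinct monic
    ones share none, so the weight counts points of the closure.\<close>
  have "prime_weight f d c = (\<Sum>P\<in>primes_over f d c. card (?R P))"
    unfolding prime_weight_def
  proof (rule sum.cong[OF refl])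
    fix P assume "P \<in> primes_over f d c"
    then have P: "irreducible P" by (simp add: primes_over_def)
    then obtain \<alpha> where "eval_ac P \<alpha> = 0" using exists_root_ac by blast
    then show "degree P = card (?R P)" using roots_irreducible(2)[OF P] by simp
  qed
  also have "\<dots> = card (\<Union>P\<in>primes_over f d c. ?R P)"
  proof (rule card_UN_disjoint[symmetric])
    show "finite (primes_over f d c)" using m by (intro finite_primes_over) simp
    show "\<forall>P\<in>primes_over f d c. finite (?R P)"
      by (auto simp: primes_over_def intro!: poly_roots_finite)
    have "P = Q" if PQ: "P \<in> primes_over f d c" "Q \<in> primes_over f d c" "x \<in> ?R P" "x \<in> ?R Q" for P Q x
    proof -
      have "irreducible P" "irreducible Q" "monic P" "monic Q" using PQ by (auto simp: primes_over_def)
      moreover from this have "P dvd Q" using irreducible_dvd_iff_eval_ac_eq_0[of P x Q] PQ by simp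
      ultimately show ?thesis by (rule monic_irreducible_dvd_eq)
    qed
    then show "\<forall>P\<in>primes_over f d c. \<forall>Q\<in>primes_over f d c. P \<noteq> Q \<longrightarrow> ?R P \<inter> ?R Q = {}" by blast
  qed
  also have "\<dots> \<le> card {x. eval_ac E x = 0}"
  proof (rule card_mono)
    show "finite {x. eval_ac E x = 0}" using Enz by (rule poly_roots_finite)
    show "(\<Union>P\<in>primes_over f d c. ?R P) \<subseteq> {x. eval_ac E x = 0}"
    proof clarify
      fix P \<alpha> assume P: "P \<in> primes_over f d c" and \<alpha>: "eval_ac P \<alpha> = 0"
      then have irr: "irreducible P" "monic P" and c: "of_nat (d div degree P) * root_trace f P = c"
        and dd: "d = degree P * (d div degree P)"
        by (auto simp: primes_over_def)
      have "\<alpha> ^ (CARD('a) ^ d) = \<alpha>" using frobenius_period[OF irr(1) \<alpha>] dd by metis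
      moreover have "eval_ac (partial_trace f d) \<alpha> = to_ac c"
        unfolding c[symmetric] to_ac_mult to_ac_of_nat poly_trace_companion_irreducible[OF irr \<alpha>]
        using partial_trace_multiple[OF irr(1) \<alpha>] dd by metis
      ultimately show "eval_ac E \<alpha> = 0" by (rule van)
    qed
  qed
  also have "\<dots> \<le> degree E" using card_poly_roots_bound[OF Enz] by simp
  finally show ?thesis using E(2) by simp
qed

lemma prime_weight_near_uniform:
  fixes f :: "'a :: {field, finite} poly"
  assumes "degree f = k" "k > 0" "coprime k CARD('a)"
    and m: "0 < m" "m < d" "k * CARD('a) ^ m \<le> CARD('a) ^ (d - m - 1)"
  shows "\<bar>real (prime_weight f d c) - CARD('a) ^ d / CARD('a)\<bar> \<le> 2 * k * real CARD('a) / CARD('a) ^ m * CARD('a) ^ d"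
proof -
  let ?q = "real CARD('a)"
  define e where "e = 2 * k * ?q ^ (d - m)"
  have q: "?q \<ge> 2" using CARD_ge_2[where ?'a = 'a] by simp
  have e0: "e \<ge> 0" by (simp add: e_def)
  have pd: "?q ^ d / ?q = ?q ^ (d - 1)" using q m by (cases d) auto
  have up: "real (prime_weight f d c') \<le> ?q ^ (d - 1) + e" for c'
    using of_nat_mono[OF prime_weight_upper[OF assms, of c'], where ?'a = real] by (simp add: e_def)
  have "?q ^ d = (\<Sum>c'\<in>UNIV. real (prime_weight f d c'))"
    using sum_prime_weight[of d f] m by (metis of_nat_sum of_nat_power gr_implies_not0 not_gr_zero)
  also have "\<dots> = real (prime_weight f d c) + (\<Sum>c'\<in>UNIV - {c}. real (prime_weight f d c'))"
    by (subst sum.remove[of _ c]) auto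
  also have "(\<Sum>c'\<in>UNIV - {c}. real (prime_weight f d c')) \<le> (\<Sum>c'\<in>UNIV - {c}. ?q ^ (d - 1) + e)"
    by (intro sum_mono up)
  also have "\<dots> = (?q - 1) * (?q ^ (d - 1) + e)"
    using q by (simp add: card_Diff_singleton of_nat_diff)
  finally have "?q ^ d \<le> real (prime_weight f d c) + (?q - 1) * (?q ^ (d - 1) + e)" by simp
  moreover have "?q ^ d = ?q * ?q ^ (d - 1)" using m by (cases d) auto
  \<comment> \<open>The error \<open>e\<close> from above becomes \<open>(q - 1) * e\<close> from
    below, the price of adding the upper bounds for the other \<open>q - 1\<close> values.\<close>
  ultimately have lo: "?q ^ (d - 1) - (?q - 1) * e \<le> real (prime_weight f d c)"
    by (simp add: algebra_simps)
  have "(?q - 1) * e \<le> ?q * e" using e0 by (simp add: algebra_simps)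
  moreover have "e \<le> ?q * e" using mult_right_mono[of 1 ?q e] q e0 by simp
  ultimately have "\<bar>real (prime_weight f d c) - ?q ^ d / ?q\<bar> \<le> ?q * e"
    unfolding pd using up[of c] lo by linarith
  also have "?q * e = 2 * k * ?q / ?q ^ m * ?q ^ d"
    using m q by (simp add: e_def power_diff)
  finally show ?thesis by simp
qed

text \<open>Each degree \<open>d \<ge> D\<close> contributes a relative error of at most
  \<open>\<delta>\<close>, each smaller one at most 1; the average over \<open>n\<close> degrees is
  at most \<open>D / n + \<delta>\<close>.\<close>

theorem trace_count_near_uniform:
  fixes f :: "'a :: {field, finite} poly" and D :: nat and \<delta> :: real
  assumes "n > 0" "\<delta> \<ge> 0"
    and near: "\<And>d c. d \<ge> D \<Longrightarrow> d \<ge> 1 \<Longrightarrow> \<bar>real (prime_weight f d c) - CARD('a) ^ d / CARD('a)\<bar> \<le> \<delta> * CARD('a) ^ d"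
  shows "\<bar>real (trace_count f n c) - CARD('a) ^ n / CARD('a)\<bar> \<le> (D / n + \<delta>) * CARD('a) ^ n"
proof -
  let ?q = "real CARD('a)"
  have q: "?q \<ge> 2" using CARD_ge_2[where ?'a = 'a] by simp
  have shift: "(\<Sum>c'\<in>UNIV. real (trace_count f m (c - c'))) = ?q ^ m" for m
  proof -
    have "(\<Sum>c'\<in>UNIV. trace_count f m (c - c')) = (\<Sum>c\<in>UNIV. trace_count f m c)"
      by (rule sum.reindex_bij_witness[of _ "\<lambda>x. c - x" "\<lambda>x. c - x"]) auto
    then show ?thesis using sum_trace_count[of f m] by (metis of_nat_sum of_nat_power)
  qed
  define t where "t d = (\<Sum>c'\<in>UNIV. real (prime_weight f d c') * real (trace_count f (n - d) (c - c')))" for d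
  have big: "\<bar>t d - ?q ^ n / ?q\<bar> \<le> \<delta> * ?q ^ n" if d: "d \<in> {1..n}" "d \<ge> D" for d
  proof -
    have qn: "?q ^ n = ?q ^ d * ?q ^ (n - d)" using d by (simp flip: power_add)
    \<comment> \<open>The trace counts in degree \<open>n - d\<close> add up to
      \<open>q ^ (n - d)\<close>, so subtracting the mean from every weight subtracts exactly
      \<open>q ^ n / q\<close> from \<open>t d\<close>.\<close>
    have "t d - ?q ^ n / ?q = (\<Sum>c'\<in>UNIV. (real (prime_weight f d c') - ?q ^ d / ?q) * real (trace_count f (n - d) (c - c')))"
      unfolding left_diff_distrib sum_subtractf t_def sum_distrib_left[symmetric] shift qn by simp
    also have "\<bar>\<dots>\<bar> \<le> (\<Sum>c'\<in>UNIV. (\<delta> * ?q ^ d) * real (trace_count f (n - d) (c - c')))"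
      by (rule order.trans[OF sum_abs], intro sum_mono)
        (use near d in \<open>auto simp: abs_mult intro!: mult_right_mono\<close>)
    also have "\<dots> = \<delta> * ?q ^ n" unfolding sum_distrib_left[symmetric] shift qn by simp
    finally show ?thesis .
  qed
  have small: "\<bar>t d - ?q ^ n / ?q\<bar> \<le> ?q ^ n" if d: "d \<in> {1..n}" for d
  proof -
    have "t d \<le> (\<Sum>c'\<in>UNIV. real (prime_weight f d c') * ?q ^ (n - d))"
      unfolding t_def
    proof (intro sum_mono mult_left_mono)
      fix c'
      have "real (trace_count f (n - d) (c - c')) \<le> (\<Sum>c'\<in>UNIV. real (trace_count f (n - d) (c - c')))"
        by (rule member_le_sum) auto
      then show "real (trace_count f (n - d) (c - c')) \<le> ?q ^ (n - d)" by (simp add: shift)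
    qed auto
    also have "\<dots> = real (\<Sum>c'\<in>UNIV. prime_weight f d c') * ?q ^ (n - d)" by (simp add: sum_distrib_right)
    also have "\<dots> = ?q ^ n" using d by (simp add: sum_prime_weight flip: power_add)
    finally have "t d \<le> ?q ^ n" .
    moreover have "t d \<ge> 0" by (auto simp: t_def intro!: sum_nonneg)
    moreover have "0 \<le> ?q ^ n / ?q" "?q ^ n / ?q \<le> ?q ^ n" using q by (auto simp: field_simps)
    ultimately show ?thesis by linarith
  qed
  have "real n * real (trace_count f n c) = (\<Sum>d=1..n. t d)"
    using arg_cong[OF trace_count_recurrence[of n f c], of real] by (simp add: t_def)
  then have "real n * (real (trace_count f n c) - ?q ^ n / ?q) = (\<Sum>d=1..n. t d - ?q ^ n / ?q)"
    by (simp add: sum_subtractf right_diff_distrib)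
  also have "\<bar>\<dots>\<bar> \<le> (\<Sum>d=1..n. (if d < D then ?q ^ n else 0) + \<delta> * ?q ^ n)"
    by (rule order.trans[OF sum_abs], intro sum_mono)
      (use big small assms(2) in \<open>auto simp: not_less intro: add_increasing2\<close>)
  also have "\<dots> = (\<Sum>d=1..n. (if d < D then ?q ^ n else 0)) + n * (\<delta> * ?q ^ n)"
    by (simp add: sum.distrib)
  also have "(\<Sum>d=1..n. (if d < D then ?q ^ n else 0)) = card ({1..n} \<inter> {d. d < D}) * ?q ^ n"
    by (simp add: sum.If_cases)
  also have "card ({1..n} \<inter> {d. d < D}) \<le> D"
    using card_mono[of "{..<D}" "{1..n} \<inter> {d. d < D}"] by auto
  finally have "\<bar>real n * (real (trace_count f n c) - ?q ^ n / ?q)\<bar> \<le> D * ?q ^ n + n * (\<delta> * ?q ^ n)"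
    using q by (simp add: mult_right_mono)
  then have "real n * \<bar>real (trace_count f n c) - ?q ^ n / ?q\<bar> \<le> D * ?q ^ n + n * (\<delta> * ?q ^ n)"
    by (simp only: abs_mult abs_of_nat)
  also have "\<dots> = real n * ((D / n + \<delta>) * ?q ^ n)" 
    unfolding distrib_right distrib_left mult.assoc[symmetric] using assms(1) by simp
  finally show ?thesis using assms(1) by simp
qed

section \<open>Invertible matrices and completion of columns\<close>

lemma index_mult_mat_sum:
  fixes A :: "'a :: semiring_0 mat"
  assumes "A \<in> carrier_mat n m" "B \<in> carrier_mat m p" "i < n" "j < p"
  shows "(A * B) $$ (i, j) = (\<Sum>l<m. A $$ (i, l) * B $$ (l, j))"
proof -
  have "dim_row A = n" "dim_col A = m" "dim_row B = m" "dim_col B = p" using assms by blast+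
  then show ?thesis using assms(3,4) by (simp add: scalar_prod_def lessThan_atLeast0)
qed

lemma GL_inverse:
  assumes "A \<in> GL n"
  obtains B where "B \<in> carrier_mat n n" "A * B = 1\<^sub>m n" "B * A = 1\<^sub>m n"
proof -
  have A: "A \<in> carrier_mat n n" using assms by (simp add: GL_def)
  obtain B where B: "inverts_mat A B" "inverts_mat B A"
    using assms by (auto simp: GL_def invertible_mat_def)
  have AB: "A * B = 1\<^sub>m n" using B(1) A by (simp add: inverts_mat_def)
  have BA: "B * A = 1\<^sub>m (dim_row B)" using B(2) by (simp add: inverts_mat_def)
  have "dim_col B = n" using arg_cong[OF AB, of dim_col] by simp
  moreover have "dim_row B = n" using arg_cong[OF BA, of dim_col] A by simp
  ultimately have "B \<in> carrier_mat n n" by auto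
  with that AB BA show ?thesis by auto
qed

lemma GL_intro:
  assumes "A \<in> carrier_mat n n" "B \<in> carrier_mat n n" "A * B = 1\<^sub>m n" "B * A = 1\<^sub>m n"
  shows "A \<in> GL n"
  using assms by (auto simp: GL_def invertible_mat_def inverts_mat_def)

lemma GL_iff_det: "A \<in> GL n \<longleftrightarrow> A \<in> carrier_mat n n \<and> det A \<noteq> 0"
proof
  assume A: "A \<in> GL n"
  then obtain B where B: "B \<in> carrier_mat n n" "A * B = 1\<^sub>m n" by (rule GL_inverse)
  have "A \<in> carrier_mat n n" using A by (simp add: GL_def)
  moreover from this have "det A * det B = 1" using det_mult[of A n B] B by simp
  ultimately show "A \<in> carrier_mat n n \<and> det A \<noteq> 0" by auto
next
  assume A: "A \<in> carrier_mat n n \<and> det A \<noteq> 0"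
  then obtain B where "B \<in> carrier_mat n n" "A * B = 1\<^sub>m n" "B * A = 1\<^sub>m n"
    using det_non_zero_imp_unit[of A n] by (auto simp: Units_def ring_mat_def)
  with A show "A \<in> GL n" by (intro GL_intro) auto
qed

lemma GL_mult: "A \<in> GL n \<Longrightarrow> B \<in> GL n \<Longrightarrow> A * B \<in> GL n"
  by (auto simp: GL_iff_det det_mult)

lemma GL_four_block:
  assumes "A \<in> carrier_mat n n" "B \<in> carrier_mat n m" "D \<in> carrier_mat m m"
  shows "four_block_mat A B (0\<^sub>m m n) D \<in> GL (n + m) \<longleftrightarrow> A \<in> GL n \<and> D \<in> GL m"
  using assms by (auto simp: GL_iff_det det_four_block_mat_lower_left_zero[of _ n _ m])

section \<open>Counting matrices and completing independent columns\<close>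

lemma bij_betw_carrier_mat:
  "bij_betw (mat m n) (({..<m} \<times> {..<n}) \<rightarrow>\<^sub>E UNIV) (carrier_mat m n :: 'a mat set)"
proof (rule bij_betw_byWitness[where f' = "\<lambda>A. restrict (\<lambda>ij. A $$ ij) ({..<m} \<times> {..<n})"])
  show "\<forall>f\<in>({..<m} \<times> {..<n}) \<rightarrow>\<^sub>E (UNIV :: 'a set). restrict (\<lambda>ij. mat m n f $$ ij) ({..<m} \<times> {..<n}) = f"
  proof (intro ballI ext)
    fix f and x :: "nat \<times> nat" assume f: "f \<in> ({..<m} \<times> {..<n}) \<rightarrow>\<^sub>E (UNIV :: 'a set)"
    show "restrict (\<lambda>ij. mat m n f $$ ij) ({..<m} \<times> {..<n}) x = f x"
      by (cases "x \<in> {..<m} \<times> {..<n}") (auto simp: PiE_arb[OF f])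
  qed
  show "\<forall>A\<in>carrier_mat m n. mat m n (restrict (\<lambda>ij. A $$ ij) ({..<m} \<times> {..<n})) = (A :: 'a mat)"
    by (intro ballI eq_matI) auto
  show "mat m n ` (({..<m} \<times> {..<n}) \<rightarrow>\<^sub>E (UNIV :: 'a set)) \<subseteq> carrier_mat m n"
    by auto
  show "(\<lambda>A. restrict (\<lambda>ij. A $$ ij) ({..<m} \<times> {..<n})) ` carrier_mat m n \<subseteq> ({..<m} \<times> {..<n}) \<rightarrow>\<^sub>E (UNIV :: 'a set)"
    by (intro image_subsetI) (simp add: restrict_PiE_iff)
qed

lemma finite_carrier_mat [simp]: "finite (carrier_mat m n :: 'a :: finite mat set)"
  using bij_betw_finite[OF bij_betw_carrier_mat[of m n, where ?'a = 'a]] by (simp add: finite_PiE)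

lemma card_carrier_mat: "card (carrier_mat m n :: 'a :: finite mat set) = CARD('a) ^ (m * n)"
  using bij_betw_same_card[OF bij_betw_carrier_mat[of m n, where ?'a = 'a]]
  by (simp add: card_PiE)

definition inj_mats :: "nat \<Rightarrow> nat \<Rightarrow> 'a :: field mat set" where
  "inj_mats n d = {K \<in> carrier_mat n d. \<forall>x. (\<forall>i<n. (\<Sum>j<d. K $$ (i, j) * x j) = 0) \<longrightarrow> (\<forall>j<d. x j = 0)}"

lemma inj_mats_carrier: "K \<in> inj_mats n d \<Longrightarrow> K \<in> carrier_mat n d"
  by (simp add: inj_mats_def)

lemma inj_mats_square: "inj_mats n n = (GL n :: 'a :: field mat set)"
proof -
  have iff: "K \<in> inj_mats n n \<longleftrightarrow> det K \<noteq> 0" if K: "K \<in> carrier_mat n n" for K :: "'a mat"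
  proof
    assume inj: "K \<in> inj_mats n n"
    show "det K \<noteq> 0"
    proof
      assume "det K = 0"
      then obtain v where v: "v \<in> carrier_vec n" "v \<noteq> 0\<^sub>v n" "K *\<^sub>v v = 0\<^sub>v n"
        using det_0_iff_vec_prod_zero_field[OF K] by auto
      have "(\<Sum>j<n. K $$ (i, j) * v $ j) = 0" if "i < n" for i
        using arg_cong[OF v(3), of "\<lambda>w. vec_index w i"] that K v(1)
        by (simp add: scalar_prod_def lessThan_atLeast0)
      then have "\<forall>j<n. v $ j = 0" using inj unfolding inj_mats_def by blast
      then show False using v by (auto simp: vec_eq_iff)
    qed
  next
    assume det: "det K \<noteq> 0"
    show "K \<in> inj_mats n n" unfolding inj_mats_def
    proof (intro CollectI conjI allI impI K)
      fix x j assume x: "\<forall>i<n. (\<Sum>j<n. K $$ (i, j) * x j) = 0" and j: "j < n"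
      have "K *\<^sub>v vec n x = 0\<^sub>v n"
        using x K by (intro eq_vecI) (auto simp: scalar_prod_def lessThan_atLeast0)
      then have "vec n x = 0\<^sub>v n" using det det_0_iff_vec_prod_zero_field[OF K] vec_carrier[of n x] by blast
      then show "x j = 0" using j by (metis index_vec index_zero_vec(1))
    qed
  qed
  show ?thesis
  proof (rule Set.set_eqI)
    fix K :: "'a mat"
    show "K \<in> inj_mats n n \<longleftrightarrow> K \<in> GL n"
      using iff[of K] inj_mats_carrier[of K n n] by (auto simp: GL_iff_det)
  qed
qed

lemma inj_mats_cong:
  assumes "K \<in> inj_mats n d" "K' \<in> carrier_mat n d'" "d' \<le> d"
    and "\<And>i j. i < n \<Longrightarrow> j < d' \<Longrightarrow> K' $$ (i, j) = K $$ (i, j)"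
  shows "K' \<in> inj_mats n d'"
  unfolding inj_mats_def
proof (intro CollectI conjI allI impI assms(2))
  fix x j assume x: "\<forall>i<n. (\<Sum>j<d'. K' $$ (i, j) * x j) = 0" and j: "j < d'"
  define y where "y j = (if j < d' then x j else 0)" for j
  have "(\<Sum>j<d. K $$ (i, j) * y j) = 0" if "i < n" for i
  proof -
    have "(\<Sum>j<d. K $$ (i, j) * y j) = (\<Sum>j<d'. K $$ (i, j) * y j)"
      using assms(3) by (intro sum.mono_neutral_right) (auto simp: y_def)
    also have "\<dots> = (\<Sum>j<d'. K' $$ (i, j) * x j)"
      using assms(4) that by (intro sum.cong) (auto simp: y_def)
    finally show ?thesis using x that by simp
  qed
  then have "\<forall>j<d. y j = 0" using assms(1) unfolding inj_mats_def by blast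
  then have "y j = 0" using j assms(3) by simp
  then show "x j = 0" using j by (simp add: y_def)
qed

text \<open>A proper column space has fewer than all \<open>q ^ n\<close> vectors, so a further independent column exists.\<close>

lemma inj_mats_extend:
  fixes K :: "'a :: {field, finite} mat"
  assumes K: "K \<in> inj_mats n d" and "d < n"
  shows "\<exists>K'\<in>inj_mats n (Suc d). \<forall>i<n. \<forall>j<d. K' $$ (i, j) = K $$ (i, j)"
proof -
  define im where "im x = mat n 1 (\<lambda>(i, _). \<Sum>j<d. K $$ (i, j) * x j)" for x :: "nat \<Rightarrow> 'a"
  have "im ` UNIV \<subseteq> im ` ({..<d} \<rightarrow>\<^sub>E UNIV)"
  proof (intro image_subsetI)
    fix x
    have "im x = im (restrict x {..<d})" by (simp add: im_def)
    then show "im x \<in> im ` ({..<d} \<rightarrow>\<^sub>E UNIV)" by (metis UNIV_I imageI restrict_PiE_iff)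
  qed
  then have "card (range im) \<le> card (im ` ({..<d} \<rightarrow>\<^sub>E (UNIV :: 'a set)))"
    by (intro card_mono finite_imageI finite_PiE) auto
  also have "\<dots> \<le> card ({..<d} \<rightarrow>\<^sub>E (UNIV :: 'a set))"
    by (intro card_image_le finite_PiE) auto
  also have "\<dots> = CARD('a) ^ d" by (simp add: card_PiE)
  also have "\<dots> < CARD('a) ^ n" using assms(2) CARD_ge_2[where ?'a = 'a] by (intro power_strict_increasing) auto
  also have "\<dots> = card (carrier_mat n 1 :: 'a mat set)" by (simp add: card_carrier_mat)
  finally have less: "card (range im) < card (carrier_mat n 1 :: 'a mat set)" .
  have "range im \<subseteq> carrier_mat n 1" by (auto simp: im_def)
  then have "finite (range im)" by (rule finite_subset) simp
  then have "\<not> carrier_mat n 1 \<subseteq> range im" using less card_mono[of "range im" "carrier_mat n 1"] by auto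
  then obtain w where w: "w \<in> carrier_mat n 1" "w \<notin> range im" by auto
  define K' where "K' = mat n (Suc d) (\<lambda>(i, j). if j < d then K $$ (i, j) else w $$ (i, 0))"
  have "K' \<in> inj_mats n (Suc d)" unfolding inj_mats_def
  proof (intro CollectI conjI allI impI)
    show "K' \<in> carrier_mat n (Suc d)" by (simp add: K'_def)
    fix x j assume x: "\<forall>i<n. (\<Sum>j<Suc d. K' $$ (i, j) * x j) = 0" and j: "j < Suc d"
    have eq: "(\<Sum>j<d. K $$ (i, j) * x j) + w $$ (i, 0) * x d = 0" if "i < n" for i
      using x that by (simp add: K'_def)
    have xd: "x d = 0"
    proof (rule ccontr)
      assume "x d \<noteq> 0"
      have "w = im (\<lambda>j. - x j / x d)"
      proof (rule eq_matI)
        fix i j assume "i < dim_row (im (\<lambda>j. - x j / x d))" "j < dim_col (im (\<lambda>j. - x j / x d))"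
        then have ij: "i < n" "j = 0" by (auto simp: im_def)
        have "(\<Sum>j<d. K $$ (i, j) * (- x j / x d)) = - (\<Sum>j<d. K $$ (i, j) * x j) / x d"
          by (simp add: sum_divide_distrib sum_negf)
        also have "\<dots> = w $$ (i, 0)"
        proof -
          have "(\<Sum>j<d. K $$ (i, j) * x j) = - (w $$ (i, 0) * x d)"
            using eq[OF ij(1)] by (simp add: eq_neg_iff_add_eq_0)
          then show ?thesis using \<open>x d \<noteq> 0\<close> by simp
        qed
        finally show "w $$ (i, j) = im (\<lambda>j. - x j / x d) $$ (i, j)" using ij by (simp add: im_def)
      qed (use w in \<open>auto simp: im_def\<close>)
      with w show False by blast
    qed
    then have "\<forall>i<n. (\<Sum>j<d. K $$ (i, j) * x j) = 0" using eq by simp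
    then have "\<forall>j<d. x j = 0" using K unfolding inj_mats_def by blast
    then show "x j = 0" using xd j by (cases "j = d") auto
  qed
  moreover have "\<forall>i<n. \<forall>j<d. K' $$ (i, j) = K $$ (i, j)" by (simp add: K'_def)
  ultimately show ?thesis by blast
qed

lemma inj_mats_complete:
  fixes K :: "'a :: {field, finite} mat"
  assumes "K \<in> inj_mats n d" "d \<le> n"
  shows "\<exists>M\<in>GL n. \<forall>i<n. \<forall>j<d. M $$ (i, j) = K $$ (i, j)"
  using assms
proof (induction "n - d" arbitrary: d K)
  case 0
  then show ?case using inj_mats_square by auto
next
  case (Suc m)
  then have "d < n" by simp
  then obtain K' where K': "K' \<in> inj_mats n (Suc d)" "\<forall>i<n. \<forall>j<d. K' $$ (i, j) = K $$ (i, j)"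
    using inj_mats_extend[OF Suc.prems(1)] by auto
  obtain M where M: "M \<in> GL n" "\<forall>i<n. \<forall>j<Suc d. M $$ (i, j) = K' $$ (i, j)"
  proof -
    have "m = n - Suc d" "Suc d \<le> n" using Suc.hyps(2) by auto
    then show ?thesis using Suc.hyps(1)[of "Suc d" K'] K'(1) that by blast
  qed
  show ?case using K'(2) M by (intro bexI[of _ M]) auto
qed

text \<open>The choice depends only on \<open>n\<close>, \<open>d\<close> and \<open>K\<close>.
  Recovering \<open>K\<close> from a matrix built with this completion thus recovers the base change
  as well, which makes the parametrisation by \<open>glue\<close> injective.\<close>

definition column_completion :: "nat \<Rightarrow> nat \<Rightarrow> 'a :: field mat \<Rightarrow> 'a mat" where
  "column_completion n d K = (SOME M. M \<in> GL n \<and> (\<forall>i<n. \<forall>j<d. M $$ (i, j) = K $$ (i, j)))"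

lemma column_completion:
  fixes K :: "'a :: {field, finite} mat"
  assumes "K \<in> inj_mats n d" "d \<le> n"
  shows "column_completion n d K \<in> GL n" "\<And>i j. i < n \<Longrightarrow> j < d \<Longrightarrow> column_completion n d K $$ (i, j) = K $$ (i, j)"
  using someI_ex[OF inj_mats_complete[OF assms, unfolded Bex_def]] unfolding column_completion_def by auto

section \<open>Inverses and the order of the general linear group\<close>

definition matrix_inverse :: "nat \<Rightarrow> 'a :: field mat \<Rightarrow> 'a mat" where
  "matrix_inverse n M = (SOME N. N \<in> carrier_mat n n \<and> M * N = 1\<^sub>m n \<and> N * M = 1\<^sub>m n)"

lemma matrix_inverse:
  assumes "M \<in> GL n"
  shows "matrix_inverse n M \<in> carrier_mat n n" "M * matrix_inverse n M = 1\<^sub>m n" "matrix_inverse n M * M = 1\<^sub>m n"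
proof -
  have "\<exists>N. N \<in> carrier_mat n n \<and> M * N = 1\<^sub>m n \<and> N * M = 1\<^sub>m n" using GL_inverse[OF assms] by metis
  from someI_ex[OF this] show "matrix_inverse n M \<in> carrier_mat n n"
    "M * matrix_inverse n M = 1\<^sub>m n" "matrix_inverse n M * M = 1\<^sub>m n"
    unfolding matrix_inverse_def by auto
qed

lemma matrix_inverse_mult_cancel:
  assumes "M \<in> GL n" "A \<in> carrier_mat n n"
  shows "matrix_inverse n M * (M * A) = A" "M * (matrix_inverse n M * A) = A"
proof -
  have M: "M \<in> carrier_mat n n" using assms(1) by (simp add: GL_def)
  note N = matrix_inverse[OF assms(1)]
  show "matrix_inverse n M * (M * A) = A"
    unfolding assoc_mult_mat[OF N(1) M assms(2), symmetric] N(3) using assms(2) by simp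
  show "M * (matrix_inverse n M * A) = A"
    unfolding assoc_mult_mat[OF M N(1) assms(2), symmetric] N(2) using assms(2) by simp
qed

lemma GL_mult_left_cancel:
  assumes "M \<in> GL n" "A \<in> carrier_mat n n" "B \<in> carrier_mat n n" "M * A = M * B"
  shows "A = B"
  using matrix_inverse_mult_cancel(1)[OF assms(1,2)] matrix_inverse_mult_cancel(1)[OF assms(1,3)] assms(4)
  by metis

lemma four_block_mat_inject:
  assumes "A \<in> carrier_mat n n" "A' \<in> carrier_mat n n" "B \<in> carrier_mat n m" "B' \<in> carrier_mat n m"
    "D \<in> carrier_mat m m" "D' \<in> carrier_mat m m"
    and eq: "four_block_mat A B C D = four_block_mat A' B' C' D'"
  shows "A = A' \<and> B = B' \<and> D = D'"
proof -
  have dims: "dim_row A = n" "dim_col A = n" "dim_row A' = n" "dim_col A' = n"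
    "dim_row D = m" "dim_col D = m" "dim_row D' = m" "dim_col D' = m" using assms by blast+
  have e: "four_block_mat A B C D $$ (i, j) = four_block_mat A' B' C' D' $$ (i, j)" for i j using eq by simp
  have "A $$ (i, j) = A' $$ (i, j)" if "i < n" "j < n" for i j
    using e[of i j] that dims by simp
  moreover have "B $$ (i, j) = B' $$ (i, j)" if "i < n" "j < m" for i j
    using e[of i "j + n"] that dims by simp
  moreover have "D $$ (i, j) = D' $$ (i, j)" if "i < m" "j < m" for i j
    using e[of "i + n" "j + n"] that dims by simp
  ultimately show ?thesis using assms by (auto intro!: eq_matI)
qed

text \<open>Multiply the completion of a nonzero column \<open>v\<close> by a block matrix that
  fixes the first basis vector, with a free row \<open>r\<close> and a free invertible block
  \<open>D\<close>. The product has first column \<open>v\<close>, so all three data can be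
  recovered from it.\<close>

lemma card_GL_Suc:
  "(CARD('a) ^ Suc n - 1) * CARD('a) ^ n * card (GL n :: 'a :: {field, finite} mat set)
    \<le> card (GL (Suc n) :: 'a mat set)"
proof -
  let ?V = "carrier_mat (Suc n) 1 - {0\<^sub>m (Suc n) 1} :: 'a mat set"
  let ?R = "carrier_mat 1 n :: 'a mat set"
  define h where "h = (\<lambda>(v, r, D). column_completion (Suc n) 1 v * four_block_mat (1\<^sub>m 1) r (0\<^sub>m n 1) (D :: 'a mat))"
  have Vinj: "v \<in> inj_mats (Suc n) 1" if "v \<in> ?V" for v
  proof -
    have "\<exists>i<Suc n. v $$ (i, 0) \<noteq> 0"
    proof (rule ccontr)
      assume "\<not> ?thesis"
      then have "v = 0\<^sub>m (Suc n) 1" using that by (intro eq_matI) auto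
      with that show False by simp
    qed
    with that show ?thesis by (auto simp: inj_mats_def)
  qed
  have blk: "four_block_mat (1\<^sub>m 1) r (0\<^sub>m n 1) D \<in> GL (Suc n)" if "r \<in> ?R" "D \<in> GL n" for r D
    using GL_four_block[of "1\<^sub>m 1" 1 r n D] that by (simp add: GL_iff_det)
  have "inj_on h (?V \<times> ?R \<times> GL n)"
  proof (rule inj_onI)
    fix x y assume xy: "x \<in> ?V \<times> ?R \<times> GL n" "y \<in> ?V \<times> ?R \<times> GL n" "h x = h y"
    obtain v r D where x: "x = (v, r, D)" by (cases x)
    obtain v' r' D' where y: "y = (v', r', D')" by (cases y)
    have c: "v \<in> ?V" "v' \<in> ?V" "r \<in> ?R" "r' \<in> ?R" "D \<in> GL n" "D' \<in> GL n" using xy x y by auto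
    have D: "D \<in> carrier_mat n n" "D' \<in> carrier_mat n n" using c by (auto simp: GL_def)
    have col: "(column_completion (Suc n) 1 v * four_block_mat (1\<^sub>m 1) r (0\<^sub>m n 1) D) $$ (i, 0) = v $$ (i, 0)"
      if v: "v \<in> ?V" and r: "r \<in> ?R" and D: "D \<in> carrier_mat n n" and i: "i < Suc n" for v r D i
    proof -
      note C = column_completion[OF Vinj[OF v], simplified]
      have CC: "column_completion (Suc n) 1 v \<in> carrier_mat (Suc n) (Suc n)" using C(1) by (simp add: GL_def)
      have T: "four_block_mat (1\<^sub>m 1) r (0\<^sub>m n 1) D \<in> carrier_mat (Suc n) (Suc n)"
        using four_block_carrier_mat[of "1\<^sub>m 1" 1 1 D n n r "0\<^sub>m n 1"] D by simp
      have dimD: "dim_row D = n" "dim_col D = n" using D by auto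
      have "(column_completion (Suc n) 1 v * four_block_mat (1\<^sub>m 1) r (0\<^sub>m n 1) D) $$ (i, 0)
          = (\<Sum>l<Suc n. column_completion (Suc n) 1 v $$ (i, l) * four_block_mat (1\<^sub>m 1) r (0\<^sub>m n 1) D $$ (l, 0))"
        by (rule index_mult_mat_sum[OF CC T i]) simp
      also have "\<dots> = (\<Sum>l<Suc n. if l = 0 then column_completion (Suc n) 1 v $$ (i, 0) else 0)"
        by (intro sum.cong refl) (auto simp: dimD)
      also have "\<dots> = v $$ (i, 0)" using C(2)[OF i] by (subst sum.delta) auto
      finally show ?thesis .
    qed
    have "v $$ (i, 0) = v' $$ (i, 0)" if "i < Suc n" for i
      using col[OF c(1,3) D(1) that] col[OF c(2,4) D(2) that] xy(3) by (simp add: h_def x y)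
    then have v: "v = v'" using c by (intro eq_matI) auto
    let ?M = "column_completion (Suc n) 1 v"
    have M: "?M \<in> GL (Suc n)" using column_completion(1)[OF Vinj[OF c(1)]] by simp
    have "?M * four_block_mat (1\<^sub>m 1) r (0\<^sub>m n 1) D = ?M * four_block_mat (1\<^sub>m 1) r' (0\<^sub>m n 1) D'"
      using xy(3) unfolding h_def x y v by simp
    moreover have "four_block_mat (1\<^sub>m 1) r (0\<^sub>m n 1) D \<in> carrier_mat (Suc n) (Suc n)"
      "four_block_mat (1\<^sub>m 1) r' (0\<^sub>m n 1) D' \<in> carrier_mat (Suc n) (Suc n)"
      using blk[OF c(3,5)] blk[OF c(4,6)] unfolding GL_def by blast+
    ultimately have "four_block_mat (1\<^sub>m 1) r (0\<^sub>m n 1) D = four_block_mat (1\<^sub>m 1) r' (0\<^sub>m n 1) D'"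
      by - (rule GL_mult_left_cancel[OF M])
    then have "r = r' \<and> D = D'"
      using four_block_mat_inject[of "1\<^sub>m 1" 1 "1\<^sub>m 1" r n r' D D'] c D by simp
    with v show "x = y" by (simp add: x y)
  qed
  moreover have "h ` (?V \<times> ?R \<times> GL n) \<subseteq> GL (Suc n)"
    unfolding h_def using column_completion(1)[OF Vinj] blk by (auto intro!: GL_mult)
  ultimately have "card (?V \<times> ?R \<times> (GL n :: 'a mat set)) \<le> card (GL (Suc n) :: 'a mat set)"
    by (intro card_inj_on_le) auto
  moreover have "card ?V = CARD('a) ^ Suc n - 1"
    by (simp add: card_Diff_singleton card_carrier_mat)
  ultimately show ?thesis by (simp add: card_cartesian_product card_carrier_mat mult.assoc)
qed

text \<open>The proportion of invertible matrices is bounded below by a product of factors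
  \<open>1 - 1 / 2 ^ i\<close>, which stays above \<open>1 / 4\<close>. The bound
  \<open>1 / 4\<close> alone is not inductive, so \<open>main\<close> carries the extra term
  \<open>1 / 2 ^ (n + 2)\<close>.\<close>

lemma card_GL_lower: "real CARD('a) ^ (n * n) \<le> 4 * real (card (GL n :: 'a :: {field, finite} mat set))"
proof -
  let ?q = "real CARD('a)" and ?g = "\<lambda>n. real (card (GL n :: 'a mat set))"
  have q: "?q \<ge> 2" using CARD_ge_2[where ?'a = 'a] by simp
  have step: "(1 - 1 / 2 ^ Suc n) * (?q ^ (2 * n + 1)) * ?g n \<le> ?g (Suc n)" for n
  proof -
    have "1 \<le> CARD('a) ^ Suc n" by simp
    have "(?q ^ Suc n - 1) * ?q ^ n * ?g n = real ((CARD('a) ^ Suc n - 1) * CARD('a) ^ n * card (GL n :: 'a mat set))"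
      using \<open>1 \<le> CARD('a) ^ Suc n\<close> by (simp only: of_nat_mult of_nat_diff of_nat_power of_nat_1)
    also have "\<dots> \<le> ?g (Suc n)" using card_GL_Suc by (simp only: of_nat_le_iff)
    finally have 1: "(?q ^ Suc n - 1) * ?q ^ n * ?g n \<le> ?g (Suc n)" .
    have "(2 :: real) ^ Suc n \<le> ?q ^ Suc n" using q by (intro power_mono) auto
    then have "1 \<le> ?q ^ Suc n / 2 ^ Suc n" by (simp add: field_simps)
    then have "(1 - 1 / 2 ^ Suc n) * ?q ^ Suc n \<le> ?q ^ Suc n - 1" by (simp add: left_diff_distrib)
    then have "(1 - 1 / 2 ^ Suc n) * ?q ^ Suc n * (?q ^ n * ?g n) \<le> (?q ^ Suc n - 1) * (?q ^ n * ?g n)"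
      by (intro mult_right_mono) auto
    moreover have "?q ^ (2 * n + 1) = ?q ^ Suc n * ?q ^ n"
      unfolding power_add[symmetric] by (rule arg_cong[of _ _ "power ?q"]) simp
    ultimately show ?thesis using 1 by (simp only: mult.assoc)
  qed
  have pos: "1 \<le> ?g 0"
    using card_gt_0_iff[of "GL 0 :: 'a mat set"] by (simp add: Suc_le_eq)
  have main: "?q ^ (Suc n * Suc n) * (1 / 4 + 1 / 2 ^ (n + 2)) \<le> ?g (Suc n)" for n
  proof (induction n)
    case 0
    have "?q * 1 \<le> ?q * ?g 0" using q pos by (intro mult_left_mono) auto
    also have "?q * ?g 0 \<le> 2 * ?g 1" using step[of 0] by simp
    finally show ?case by simp
  next
    case (Suc n)
    define u :: real where "u = 1 / 2 ^ (n + 2)"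
    have u: "0 \<le> u" "u \<le> 1 / 4" by (simp_all add: u_def field_simps one_le_power power_add)
    have uS: "1 / 2 ^ (Suc n + 2) = u / 2" "1 / 2 ^ Suc (Suc n) = u" by (simp_all add: u_def)
    \<comment> \<open>The right side exceeds the left by \<open>u * (1 / 4 - u)\<close>.\<close>
    have "1 / 4 + u / 2 \<le> (1 / 4 + u) * (1 - u)"
    proof -
      have "4 * u * u \<le> 1 * u" using u by (intro mult_right_mono) auto
      then have "1 + 2 * u \<le> (1 + 4 * u) * (1 - u)" by (simp add: algebra_simps)
      then have "(1 + 2 * u) / 4 \<le> (1 + 4 * u) * (1 - u) / 4" by (rule divide_right_mono) simp
      moreover have "1 / 4 + u / 2 = (1 + 2 * u) / 4" "1 / 4 + u = (1 + 4 * u) / 4" by simp_all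
      ultimately show ?thesis by (simp only: times_divide_eq_left)
    qed
    then have "?q ^ (Suc (Suc n) * Suc (Suc n)) * (1 / 4 + u / 2) \<le> ?q ^ (Suc (Suc n) * Suc (Suc n)) * ((1 / 4 + u) * (1 - u))"
      by (intro mult_left_mono) auto
    also have "?q ^ (Suc (Suc n) * Suc (Suc n)) * ((1 / 4 + u) * (1 - u))
        = ((1 - u) * ?q ^ (2 * Suc n + 1)) * (?q ^ (Suc n * Suc n) * (1 / 4 + u))"
    proof -
      have ex: "Suc (Suc n) * Suc (Suc n) = (2 * Suc n + 1) + Suc n * Suc n" by simp
      show ?thesis unfolding ex power_add by (simp only: mult_ac)
    qed
    also have "\<dots> \<le> ((1 - u) * ?q ^ (2 * Suc n + 1)) * ?g (Suc n)"
      using Suc.IH u unfolding u_def[symmetric] by (intro mult_left_mono mult_nonneg_nonneg) auto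
    also have "\<dots> \<le> ?g (Suc (Suc n))" using step[of "Suc n"] unfolding uS .
    finally show ?case unfolding uS .
  qed
  show ?thesis
  proof (cases n)
    case 0
    then show ?thesis using pos by simp
  next
    case (Suc m)
    have "?q ^ (Suc m * Suc m) * (1 / 4) \<le> ?q ^ (Suc m * Suc m) * (1 / 4 + 1 / 2 ^ (m + 2))"
      by (intro mult_left_mono) auto
    with main[of m] show ?thesis unfolding Suc by linarith
  qed
qed


lemma companion_carrier': "degree F = d \<Longrightarrow> companion F \<in> carrier_mat d d"
  using companion_carrier by blast

section \<open>Decomposition along a Krylov space\<close>

lemma pow_mat_Suc_left:
  assumes "A \<in> carrier_mat n n"
  shows "A ^\<^sub>m Suc j = A * A ^\<^sub>m j"
proof (induction j)
  case (Suc j)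
  have "A ^\<^sub>m Suc (Suc j) = A * A ^\<^sub>m j * A" using Suc by simp
  also have "\<dots> = A * (A ^\<^sub>m j * A)"
    by (rule assoc_mult_mat[OF assms pow_carrier_mat[OF assms] assms])
  finally show ?case by simp
qed (use assms in simp)

definition krylov :: "nat \<Rightarrow> 'a :: field mat \<Rightarrow> nat \<Rightarrow> 'a mat" where
  "krylov n g d = mat n d (\<lambda>(i, j). (g ^\<^sub>m j) $$ (i, 0))"

lemma krylov_carrier [simp]: "krylov n g d \<in> carrier_mat n d"
  by (simp add: krylov_def)

lemma krylov_index [simp]: "i < n \<Longrightarrow> j < d \<Longrightarrow> krylov n g d $$ (i, j) = (g ^\<^sub>m j) $$ (i, 0)"
  by (simp add: krylov_def)

lemma krylov_mono: "krylov n g d \<in> inj_mats n d \<Longrightarrow> d' \<le> d \<Longrightarrow> krylov n g d' \<in> inj_mats n d'"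
  by (rule inj_mats_cong) auto

text \<open>Dimension of the cyclic subspace generated by the first basis vector. The minimum exists
  because \<open>n + 1\<close> vectors are always dependent.\<close>

definition krylov_dim :: "nat \<Rightarrow> 'a :: field mat \<Rightarrow> nat" where
  "krylov_dim n g = (LEAST d. krylov n g (Suc d) \<notin> inj_mats n (Suc d))"

lemma krylov_Suc_not_inj: "krylov n g (Suc n) \<notin> inj_mats n (Suc n)"
  for g :: "'a :: field mat"
proof
  assume inj: "krylov n g (Suc n) \<in> inj_mats n (Suc n)"
  \<comment> \<open>A zero row makes the matrix square without affecting the independence of its
    columns, and forces its determinant to vanish.\<close>
  define K' where "K' = mat (Suc n) (Suc n) (\<lambda>(i, j). if i < n then krylov n g (Suc n) $$ (i, j) else 0)"
  have K': "K' \<in> carrier_mat (Suc n) (Suc n)" by (simp add: K'_def)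
  have "K' \<in> inj_mats (Suc n) (Suc n)" unfolding inj_mats_def
  proof (intro CollectI conjI allI impI K')
    fix x j assume x: "\<forall>i<Suc n. (\<Sum>j<Suc n. K' $$ (i, j) * x j) = 0" and j: "j < Suc n"
    have "(\<Sum>j<Suc n. krylov n g (Suc n) $$ (i, j) * x j) = 0" if "i < n" for i
    proof -
      have "(\<Sum>j<Suc n. krylov n g (Suc n) $$ (i, j) * x j) = (\<Sum>j<Suc n. K' $$ (i, j) * x j)"
        using that by (intro sum.cong) (auto simp: K'_def)
      then show ?thesis using x that by simp
    qed
    then show "x j = 0" using inj j unfolding inj_mats_def by blast
  qed
  then have "det K' \<noteq> 0" by (simp add: inj_mats_square GL_iff_det)
  moreover have "det K' = 0"
  proof -
    have "det K' = det (transpose_mat K')" using det_transpose[OF K'] by simp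
    moreover have "transpose_mat K' *\<^sub>v unit_vec (Suc n) n = 0\<^sub>v (Suc n)"
      by (intro eq_vecI) (auto simp: K'_def)
    moreover have "unit_vec (Suc n) n \<noteq> (0\<^sub>v (Suc n) :: 'a vec)" by simp
    ultimately show ?thesis
      using det_0_iff_vec_prod_zero_field[of "transpose_mat K'" "Suc n"] K' unit_vec_carrier[of "Suc n" n]
      by (metis transpose_carrier_mat)
  qed
  ultimately show False by simp
qed

lemma krylov_dim_eq_iff:
  fixes g :: "'a :: field mat"
  assumes "d > 0"
  shows "krylov_dim n g = d \<longleftrightarrow>
    krylov n g d \<in> inj_mats n d \<and> krylov n g (Suc d) \<notin> inj_mats n (Suc d)"
proof -
  show ?thesis
  proof
    assume d: "krylov_dim n g = d"
    have "krylov n g (Suc (d - 1)) \<in> inj_mats n (Suc (d - 1))"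
      using not_less_Least[of "d - 1" "\<lambda>d. krylov n g (Suc d) \<notin> inj_mats n (Suc d)"] d assms
      unfolding krylov_dim_def by auto
    moreover have "krylov n g (Suc d) \<notin> inj_mats n (Suc d)"
      using LeastI[of "\<lambda>d. krylov n g (Suc d) \<notin> inj_mats n (Suc d)", OF krylov_Suc_not_inj] d
      unfolding krylov_dim_def by simp
    ultimately show "krylov n g d \<in> inj_mats n d \<and> krylov n g (Suc d) \<notin> inj_mats n (Suc d)"
      using assms by simp
  next
    assume d: "krylov n g d \<in> inj_mats n d \<and> krylov n g (Suc d) \<notin> inj_mats n (Suc d)"
    show "krylov_dim n g = d" unfolding krylov_dim_def
    proof (rule Least_equality)
      fix e assume e: "krylov n g (Suc e) \<notin> inj_mats n (Suc e)"
      show "d \<le> e"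
      proof (rule ccontr)
        assume "\<not> d \<le> e"
        then have "Suc e \<le> d" by simp
        with d e krylov_mono show False by blast
      qed
    qed (use d in simp)
  qed
qed


lemma krylov_1_inj:
  fixes g :: "'a :: field mat"
  assumes "g \<in> carrier_mat n n" "n > 0"
  shows "krylov n g 1 \<in> inj_mats n 1"
proof -
  have "krylov n g 1 $$ (0, 0) = 1" using assms by simp
  then show ?thesis using assms(2) unfolding inj_mats_def by force
qed

lemma krylov_dim_bounds:
  fixes g :: "'a :: field mat"
  assumes "g \<in> carrier_mat n n" "n > 0"
  shows "krylov_dim n g \<in> {1..n}"
proof -
  have "krylov_dim n g \<noteq> 0"
    using LeastI[of "\<lambda>d. krylov n g (Suc d) \<notin> inj_mats n (Suc d)", OF krylov_Suc_not_inj] krylov_1_inj[OF assms]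
    unfolding krylov_dim_def by (metis One_nat_def)
  moreover have "krylov_dim n g \<le> n"
    unfolding krylov_dim_def by (rule Least_le) (rule krylov_Suc_not_inj)
  ultimately show ?thesis by simp
qed

text \<open>The first \<open>d\<close> columns of \<open>T\<close> are those of a block triangular matrix with the companion matrix
  of \<open>F\<close> in the upper left corner.\<close>

definition companion_shape :: "nat \<Rightarrow> nat \<Rightarrow> 'a :: field poly \<Rightarrow> 'a mat \<Rightarrow> bool" where
  "companion_shape n d F T \<longleftrightarrow> (\<forall>l<n. \<forall>j<d. T $$ (l, j) =
     (if Suc j < d then if l = Suc j then 1 else 0 else if l < d then - coeff F l else 0))"

lemma companion_shape_four_block:
  assumes "degree F = d" "d \<le> n" "B \<in> carrier_mat d (n - d)" "D \<in> carrier_mat (n - d) (n - d)"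
  shows "companion_shape n d F (four_block_mat (companion F) B (0\<^sub>m (n - d) d) D)"
proof -
  have "dim_row D = n - d" "dim_col D = n - d" using assms by blast+
  then show ?thesis unfolding companion_shape_def using assms(1,2) by (auto simp: companion_def)
qed

lemma companion_shape_imp_four_block:
  assumes "companion_shape n d F T" "T \<in> carrier_mat n n" "degree F = d" "d \<le> n"
  shows "T = four_block_mat (companion F) (mat d (n - d) (\<lambda>(i, j). T $$ (i, j + d))) (0\<^sub>m (n - d) d)
    (mat (n - d) (n - d) (\<lambda>(i, j). T $$ (i + d, j + d)))"
proof (rule eq_matI)
  fix i j
  assume "i < dim_row (four_block_mat (companion F) (mat d (n - d) (\<lambda>(i, j). T $$ (i, j + d))) (0\<^sub>m (n - d) d)
      (mat (n - d) (n - d) (\<lambda>(i, j). T $$ (i + d, j + d))))"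
    and "j < dim_col (four_block_mat (companion F) (mat d (n - d) (\<lambda>(i, j). T $$ (i, j + d))) (0\<^sub>m (n - d) d)
      (mat (n - d) (n - d) (\<lambda>(i, j). T $$ (i + d, j + d))))"
  then have ij: "i < n" "j < n" using assms(3,4) by (auto simp: companion_def)
  have dims: "dim_row (companion F) = d" "dim_col (companion F) = d" using assms(3) by (auto simp: companion_def)
  show "T $$ (i, j) = four_block_mat (companion F) (mat d (n - d) (\<lambda>(i, j). T $$ (i, j + d))) (0\<^sub>m (n - d) d)
      (mat (n - d) (n - d) (\<lambda>(i, j). T $$ (i + d, j + d))) $$ (i, j)"
  proof (cases "j < d")
    case True
    have "T $$ (i, j) = (if Suc j < d then if i = Suc j then 1 else 0 else if i < d then - coeff F i else 0)"
      using assms(1) ij True unfolding companion_shape_def by blast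
    then show ?thesis using ij True assms(3,4) by (auto simp: dims) (auto simp: companion_def)
  next
    case False
    then show ?thesis using ij assms(4) by (auto simp: dims)
  qed
qed (use assms in \<open>auto simp: companion_def\<close>)

text \<open>Under \<open>g * M = M * T\<close> the shape of \<open>T\<close> says that
  \<open>g\<close> maps each of the first \<open>d - 1\<close> columns of \<open>M\<close> to the
  next one, and the column with index \<open>d - 1\<close> to the combination prescribed by
  \<open>F\<close>. Starting from the first basis vector, these columns are the Krylov
  vectors.\<close>

lemma krylov_of_shape:
  assumes g: "g \<in> carrier_mat n n" and M: "M \<in> carrier_mat n n" and T: "T \<in> carrier_mat n n"
    and gM: "g * M = M * T" and d: "0 < d" "d \<le> n"
    and M0: "\<And>i. i < n \<Longrightarrow> M $$ (i, 0) = (if i = 0 then 1 else 0)"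
    and shape: "companion_shape n d F T" and i: "i < n"
  shows "j < d \<Longrightarrow> (g ^\<^sub>m j) $$ (i, 0) = M $$ (i, j)"
    and "(g ^\<^sub>m d) $$ (i, 0) = - (\<Sum>l<d. M $$ (i, l) * coeff F l)"
proof -
  have n0: "0 < n" using i by simp
  have next_col: "(g ^\<^sub>m Suc j) $$ (i, 0) = (\<Sum>l<n. M $$ (i, l) * T $$ (l, j))"
    if "j < n" "i < n" "\<And>i. i < n \<Longrightarrow> (g ^\<^sub>m j) $$ (i, 0) = M $$ (i, j)" for i j
  proof -
    have "(g ^\<^sub>m Suc j) $$ (i, 0) = (\<Sum>l<n. g $$ (i, l) * (g ^\<^sub>m j) $$ (l, 0))"
      unfolding pow_mat_Suc_left[OF g] by (rule index_mult_mat_sum[OF g pow_carrier_mat[OF g] that(2) n0])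
    also have "\<dots> = (\<Sum>l<n. g $$ (i, l) * M $$ (l, j))" using that(3) by simp
    also have "\<dots> = (g * M) $$ (i, j)" by (rule index_mult_mat_sum[OF g M that(2,1), symmetric])
    also have "\<dots> = (\<Sum>l<n. M $$ (i, l) * T $$ (l, j))" unfolding gM by (rule index_mult_mat_sum[OF M T that(2,1)])
    finally show ?thesis .
  qed
  have col: "(g ^\<^sub>m j) $$ (i, 0) = M $$ (i, j)" if "j < d" "i < n" for i j
    using that
  proof (induction j arbitrary: i)
    case 0
    then show ?case using g M0 n0 by simp
  next
    case (Suc j)
    have "(g ^\<^sub>m Suc j) $$ (i, 0) = (\<Sum>l<n. M $$ (i, l) * T $$ (l, j))"
      using Suc d by (intro next_col) auto
    also have "\<dots> = (\<Sum>l<n. if l = Suc j then M $$ (i, Suc j) else 0)"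
      using shape Suc.prems unfolding companion_shape_def by (intro sum.cong refl) auto
    also have "\<dots> = M $$ (i, Suc j)" using Suc.prems d by (subst sum.delta) auto
    finally show ?case .
  qed
  then show "j < d \<Longrightarrow> (g ^\<^sub>m j) $$ (i, 0) = M $$ (i, j)" using i by blast
  have "(g ^\<^sub>m Suc (d - 1)) $$ (i, 0) = (\<Sum>l<n. M $$ (i, l) * T $$ (l, d - 1))"
    using d i col by (intro next_col) auto
  also have "\<dots> = (\<Sum>l<n. if l < d then - (M $$ (i, l) * coeff F l) else 0)"
    using shape d unfolding companion_shape_def by (intro sum.cong refl) auto
  also have "\<dots> = (\<Sum>l<d. - (M $$ (i, l) * coeff F l))"
    using d by (intro sum.mono_neutral_cong_right) auto
  finally show "(g ^\<^sub>m d) $$ (i, 0) = - (\<Sum>l<d. M $$ (i, l) * coeff F l)" using d by (simp add: sum_negf)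
qed

section \<open>Parametrising matrices of given Krylov dimension\<close>

definition start_mats :: "nat \<Rightarrow> nat \<Rightarrow> 'a :: field mat set" where
  "start_mats n d = {K \<in> inj_mats n d. \<forall>i<n. K $$ (i, 0) = (if i = 0 then 1 else 0)}"

definition unit_monics :: "nat \<Rightarrow> 'a :: field poly set" where
  "unit_monics d = {F \<in> monics d. coeff F 0 \<noteq> 0}"

lemma companion_in_GL_iff:
  fixes F :: "'a :: field poly"
  assumes "F \<in> monics d" "d > 0"
  shows "companion F \<in> GL d \<longleftrightarrow> coeff F 0 \<noteq> 0"
proof -
  obtain m where m: "d = Suc m" using assms(2) gr0_conv_Suc by auto
  have deg: "degree F = Suc m" using assms(1) m by (simp add: monics_iff)
  have C: "companion F \<in> carrier_mat d d" using deg m by (intro companion_carrier') simp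
  have row: "(\<Sum>j<d. companion F $$ (i, j) * x j) = (if i = 0 then 0 else x (i - 1)) - coeff F i * x m"
    if i: "i < d" for i x
  proof -
    let ?X = "mat d 1 (\<lambda>(i, _). x i)"
    have "(\<Sum>j<d. companion F $$ (i, j) * x j) = (companion F * ?X) $$ (i, 0)"
      using i by (subst index_mult_mat_sum[OF C, of _ 1]) auto
    also have "\<dots> = (if i = 0 then 0 else ?X $$ (i - 1, 0)) - coeff F i * ?X $$ (m, 0)"
      using i by (intro companion_mult_index[OF deg, of _ 1]) (auto simp: m)
    finally show ?thesis using i by (auto simp: m)
  qed
  show ?thesis unfolding inj_mats_square[symmetric]
  proof
    assume inj: "companion F \<in> inj_mats d d"
    show "coeff F 0 \<noteq> 0"
    proof
      assume 0: "coeff F 0 = 0"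
      \<comment> \<open>\<open>F\<close> is \<open>x\<close> times the polynomial with these
        coefficients, so multiplication by \<open>x\<close> modulo \<open>F\<close> kills that
        polynomial.\<close>
      define x where "x j = (if j = m then 1 else coeff F (Suc j))" for j
      have "(\<Sum>j<d. companion F $$ (i, j) * x j) = 0" if "i < d" for i
        unfolding row[OF that] using that 0 m by (auto simp: x_def)
      then have "\<forall>j<d. x j = 0" using inj unfolding inj_mats_def by blast
      then show False using m by (auto simp: x_def)
    qed
  next
    assume 0: "coeff F 0 \<noteq> 0"
    show "companion F \<in> inj_mats d d" unfolding inj_mats_def
    proof (intro CollectI conjI allI impI C)
      fix x j assume x: "\<forall>i<d. (\<Sum>j<d. companion F $$ (i, j) * x j) = 0" and j: "j < d"
      have eq: "(if i = 0 then 0 else x (i - 1)) - coeff F i * x m = 0" if "i < d" for i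
        using x that unfolding row[OF that, symmetric] by blast
      have xm: "x m = 0" using eq[of 0] 0 m by simp
      show "x j = 0"
      proof (cases "j = m")
        case False
        then show ?thesis using eq[of "Suc j"] xm j m by simp
      qed (simp add: xm)
    qed
  qed
qed

lemma companion_inj:
  fixes F G :: "'a :: field poly"
  assumes "F \<in> monics d" "G \<in> monics d" "companion F = companion G"
  shows "F = G"
proof (rule poly_eqI)
  fix i
  consider "i < d" | "i = d" | "i > d" by linarith
  then show "coeff F i = coeff G i"
  proof cases
    case 1
    then show ?thesis using arg_cong[OF assms(3), of "\<lambda>A. A $$ (i, d - 1)"] assms(1,2)
      by (simp add: companion_def monics_iff)
  qed (use assms(1,2) in \<open>auto simp: monics_iff coeff_eq_0\<close>)
qed

text \<open>\<open>K\<close> supplies the Krylov basis, \<open>F\<close> the action on the cyclic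
  subspace, \<open>D\<close> the action on the quotient and \<open>B\<close> the remaining freedom.
  \<open>F\<close> is kept apart from the triple because it alone varies when traces are
  counted.\<close>

definition glue :: "nat \<Rightarrow> nat \<Rightarrow> 'a :: field mat \<times> 'a mat \<times> 'a mat \<Rightarrow> 'a poly \<Rightarrow> 'a mat" where
  "glue n d = (\<lambda>(K, B, D) F. column_completion n d K
     * four_block_mat (companion F) B (0\<^sub>m (n - d) d) D * matrix_inverse n (column_completion n d K))"

lemma glue_properties:
  fixes K :: "'a :: {field, finite} mat"
  assumes d: "0 < d" "d \<le> n" and K: "K \<in> start_mats n d" and B: "B \<in> carrier_mat d (n - d)"
    and D: "D \<in> GL (n - d)" and F: "F \<in> unit_monics d"
  defines "M \<equiv> column_completion n d K" and "T \<equiv> four_block_mat (companion F) B (0\<^sub>m (n - d) d) D"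
    and "g \<equiv> glue n d (K, B, D) F"
  shows "M \<in> GL n" "T \<in> carrier_mat n n" "g \<in> GL n" "g * M = M * T" "krylov n g d = K" "krylov_dim n g = d"
    "poly_trace f g = root_trace f F + poly_trace f D"
proof -
  have Kinj: "K \<in> inj_mats n d" and K0: "\<And>i. i < n \<Longrightarrow> K $$ (i, 0) = (if i = 0 then 1 else 0)"
    using K by (auto simp: start_mats_def)
  have Fm: "F \<in> monics d" "coeff F 0 \<noteq> 0" using F by (auto simp: unit_monics_def)
  then have degF: "degree F = d" by (simp add: monics_iff)
  have CC: "companion F \<in> carrier_mat d d" using degF by (rule companion_carrier')
  have DC: "D \<in> carrier_mat (n - d) (n - d)" using D by (simp add: GL_def)
  note Mc = column_completion[OF Kinj d(2), folded M_def]
  show M: "M \<in> GL n" by (rule Mc)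
  have MC: "M \<in> carrier_mat n n" using M by (simp add: GL_def)
  let ?N = "matrix_inverse n M"
  note N = matrix_inverse[OF M]
  have "T \<in> GL (d + (n - d))"
    unfolding T_def using GL_four_block[OF CC B DC] companion_in_GL_iff[OF Fm(1) d(1)] Fm(2) D by simp
  then have TGL: "T \<in> GL n" using d by simp
  then show TC: "T \<in> carrier_mat n n" by (simp add: GL_def)
  have NGL: "?N \<in> GL n" using N MC by (intro GL_intro[of _ _ M])
  have g: "g = M * T * ?N" by (simp add: g_def glue_def M_def T_def)
  show gGL: "g \<in> GL n" unfolding g by (intro GL_mult M TGL NGL)
  then have gC: "g \<in> carrier_mat n n" by (simp add: GL_def)
  have "g * M = M * T * (?N * M)"
    unfolding g using MC TC N by (intro assoc_mult_mat[of _ n n _ n _ n]) auto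
  then show gM: "g * M = M * T" using N MC TC by simp
  have shape: "companion_shape n d F T"
    unfolding T_def by (rule companion_shape_four_block[OF degF d(2) B DC])
  have M0: "M $$ (i, 0) = (if i = 0 then 1 else 0)" if "i < n" for i
    using Mc(2)[OF that d(1)] K0[OF that] by simp
  note kr = krylov_of_shape[OF gC MC TC gM d M0 shape]
  show kry: "krylov n g d = K"
  proof (rule eq_matI)
    fix i j assume "i < dim_row K" "j < dim_col K"
    then have ij: "i < n" "j < d" using inj_mats_carrier[OF Kinj] by auto
    then show "krylov n g d $$ (i, j) = K $$ (i, j)" using kr(1)[OF _ ij] Mc(2)[OF ij] by simp
  qed (use inj_mats_carrier[OF Kinj] in \<open>auto simp: krylov_def\<close>)
  have "krylov n g (Suc d) \<notin> inj_mats n (Suc d)"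
  proof
    assume inj: "krylov n g (Suc d) \<in> inj_mats n (Suc d)"
    \<comment> \<open>The coefficients of \<open>F\<close>, with leading coefficient 1 at index
      \<open>d\<close>, give a relation between the first \<open>d + 1\<close> Krylov
      vectors.\<close>
    define x where "x j = (if j < d then coeff F j else 1)" for j
    have "(\<Sum>j<Suc d. krylov n g (Suc d) $$ (i, j) * x j) = 0" if i: "i < n" for i
    proof -
      have "(\<Sum>j<Suc d. krylov n g (Suc d) $$ (i, j) * x j)
          = (\<Sum>j<d. M $$ (i, j) * coeff F j) + (g ^\<^sub>m d) $$ (i, 0)"
        using i kr(1)[OF _ i] by (simp add: x_def)
      then show ?thesis using kr(2)[OF _ i] by simp
    qed
    then have "\<forall>j<Suc d. x j = 0" using inj unfolding inj_mats_def by blast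
    then show False by (auto simp: x_def)
  qed
  then show "krylov_dim n g = d" using kry Kinj krylov_dim_eq_iff[OF d(1)] by blast
  have "similar_mat_wit g T M ?N"
    using N MC TC gC g by (intro similar_mat_witI[of _ _ n]) auto
  then have "poly_trace f g = poly_trace f T" by (rule poly_trace_similar)
  also have "\<dots> = root_trace f F + poly_trace f D"
    unfolding T_def by (rule poly_trace_block_upper[OF CC B DC])
  finally show "poly_trace f g = root_trace f F + poly_trace f D" .
qed

text \<open>\<open>K\<close> is recovered as the Krylov matrix, hence so is the base change.
  Cancelling it leaves the block matrix, from which \<open>F\<close>, \<open>B\<close> and
  \<open>D\<close> can be read off.\<close>

lemma glue_inj:
  fixes n d
  assumes d: "0 < d" "d \<le> n"
  shows "inj_on (\<lambda>(y, F). glue n d y F)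
    ((start_mats n d \<times> carrier_mat d (n - d) \<times> GL (n - d)) \<times> (unit_monics d :: 'a :: {field, finite} poly set))"
proof (rule inj_onI)
  fix u v assume u: "u \<in> (start_mats n d \<times> carrier_mat d (n - d) \<times> GL (n - d)) \<times> (unit_monics d :: 'a poly set)"
    and v: "v \<in> (start_mats n d \<times> carrier_mat d (n - d) \<times> GL (n - d)) \<times> (unit_monics d :: 'a poly set)"
    and uv: "(case u of (y, F) \<Rightarrow> glue n d y F) = (case v of (y, F) \<Rightarrow> glue n d y F)"
  obtain K B D F where u': "u = ((K, B, D), F)" by (metis surj_pair)
  obtain K' B' D' F' where v': "v = ((K', B', D'), F')" by (metis surj_pair)
  have x: "K \<in> start_mats n d" "B \<in> carrier_mat d (n - d)" "D \<in> GL (n - d)" "F \<in> unit_monics d"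
    using u u' by auto
  have y: "K' \<in> start_mats n d" "B' \<in> carrier_mat d (n - d)" "D' \<in> GL (n - d)" "F' \<in> unit_monics d"
    using v v' by auto
  have eq: "glue n d (K, B, D) F = glue n d (K', B', D') F'" using uv by (simp add: u' v')
  note px = glue_properties[OF d x] and py = glue_properties[OF d y]
  have KK: "K = K'" using px(5) py(5) eq by simp
  let ?M = "column_completion n d K"
  let ?T = "four_block_mat (companion F) B (0\<^sub>m (n - d) d) D"
  let ?T' = "four_block_mat (companion F') B' (0\<^sub>m (n - d) d) D'"
  have MC: "?M \<in> carrier_mat n n" using px(1) by (simp add: GL_def)
  have "?M * ?T = ?M * ?T'" using px(4) py(4) eq KK by simp
  then have "?T = ?T'" by (rule GL_mult_left_cancel[OF px(1,2) py(2)])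
  moreover have "companion F \<in> carrier_mat d d" "companion F' \<in> carrier_mat d d"
    using x(4) y(4) by (auto simp: unit_monics_def monics_iff intro!: companion_carrier')
  ultimately have "companion F = companion F' \<and> B = B' \<and> D = D'"
    using x y by (intro four_block_mat_inject[of _ d _ _ "n - d"]) (auto simp: GL_def)
  moreover from this have "F = F'" using x(4) y(4) by (auto simp: unit_monics_def intro: companion_inj)
  ultimately show "u = v" using KK by (simp add: u' v')
qed

text \<open>Conjugating \<open>g\<close> by a completion of its Krylov basis produces the block
  form. The polynomial \<open>F\<close> comes from the first linear relation among the Krylov
  vectors.\<close>

lemma glue_surj:
  fixes g :: "'a :: {field, finite} mat"
  assumes g: "g \<in> GL n" and d: "krylov_dim n g = d" "0 < d" "d \<le> n"
  shows "\<exists>K\<in>start_mats n d. \<exists>B\<in>carrier_mat d (n - d). \<exists>D\<in>GL (n - d). \<exists>F\<in>unit_monics d. g = glue n d (K, B, D) F"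
proof -
  have gC: "g \<in> carrier_mat n n" using g by (simp add: GL_def)
  have n0: "0 < n" using d by simp
  let ?K = "krylov n g d"
  have Kinj: "?K \<in> inj_mats n d" and notinj: "krylov n g (Suc d) \<notin> inj_mats n (Suc d)"
    using d krylov_dim_eq_iff[OF d(2)] by blast+
  have K: "?K \<in> start_mats n d"
    using Kinj d gC by (auto simp: start_mats_def)
  let ?M = "column_completion n d ?K"
  note Mc = column_completion[OF Kinj d(3)]
  have Mk: "?M $$ (i, j) = (g ^\<^sub>m j) $$ (i, 0)" if "i < n" "j < d" for i j using Mc(2)[OF that] that by simp
  have MC: "?M \<in> carrier_mat n n" using Mc(1) by (simp add: GL_def)
  let ?N = "matrix_inverse n ?M"
  note N = matrix_inverse[OF Mc(1)]
  obtain x where x: "\<And>i. i < n \<Longrightarrow> (\<Sum>j<Suc d. krylov n g (Suc d) $$ (i, j) * x j) = 0" "\<exists>j<Suc d. x j \<noteq> 0"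
    using notinj unfolding inj_mats_def by auto
  have x': "(\<Sum>j<d. (g ^\<^sub>m j) $$ (i, 0) * x j) + (g ^\<^sub>m d) $$ (i, 0) * x d = 0" if "i < n" for i
    using x(1)[OF that] that by simp
  \<comment> \<open>A relation not involving the last vector would contradict the independence of
    the first \<open>d\<close>; hence it can be normalised to a monic \<open>F\<close>.\<close>
  have xd: "x d \<noteq> 0"
  proof
    assume 0: "x d = 0"
    then have "\<forall>i<n. (\<Sum>j<d. ?K $$ (i, j) * x j) = 0" using x' by simp
    then have "\<forall>j<d. x j = 0" using Kinj unfolding inj_mats_def by blast
    then show False using x(2) 0 less_Suc_eq by auto
  qed
  define F where "F = monom 1 d + (\<Sum>l<d. monom (x l / x d) l)"
  have Fin: "(\<Sum>l<d. monom (x l / x d) l) \<in> polys_below d"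
    by (simp add: polys_below_def coeff_sum)
  then have Fm: "F \<in> monics d" using bij_betw_monics[of d, where ?'a = 'a] unfolding F_def bij_betw_def by blast
  have cF: "coeff F l = x l / x d" if "l < d" for l
    using that by (simp add: F_def coeff_sum)
  have gd: "(g ^\<^sub>m d) $$ (i, 0) = - (\<Sum>l<d. ?M $$ (i, l) * coeff F l)" if i: "i < n" for i
  proof -
    have "(\<Sum>l<d. ?M $$ (i, l) * coeff F l) = (\<Sum>l<d. (g ^\<^sub>m l) $$ (i, 0) * x l) / x d"
      unfolding sum_divide_distrib using Mk[OF i] cF by (intro sum.cong) auto
    also have "(\<Sum>l<d. (g ^\<^sub>m l) $$ (i, 0) * x l) = - ((g ^\<^sub>m d) $$ (i, 0) * x d)"
      using x'[OF i] by (simp add: eq_neg_iff_add_eq_0)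
    finally show ?thesis using xd by simp
  qed
  define T where "T = ?N * (g * ?M)"
  have TC: "T \<in> carrier_mat n n" unfolding T_def using N gC MC by auto
  have MT: "?M * T = g * ?M"
    unfolding T_def using gC MC by (intro matrix_inverse_mult_cancel(2)[OF Mc(1)]) auto
  have NM: "(\<Sum>i<n. ?N $$ (l, i) * ?M $$ (i, j)) = (if l = j then 1 else 0)" if "l < n" "j < n" for l j
    using index_mult_mat_sum[OF N(1) MC that] N(3) that by simp
  \<comment> \<open>Column \<open>j\<close> of \<open>T\<close> holds the coordinates of the Krylov
    vector with index \<open>Suc j\<close> in the completed basis.\<close>
  have Tcol: "T $$ (l, j) = (\<Sum>i<n. ?N $$ (l, i) * (g ^\<^sub>m Suc j) $$ (i, 0))" if l: "l < n" and j: "j < d" for l j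
  proof -
    have jn: "j < n" using j d by simp
    have "(g * ?M) $$ (i, j) = (g ^\<^sub>m Suc j) $$ (i, 0)" if i: "i < n" for i
    proof -
      have "(g * ?M) $$ (i, j) = (\<Sum>l<n. g $$ (i, l) * (g ^\<^sub>m j) $$ (l, 0))"
        using index_mult_mat_sum[OF gC MC i jn] Mk j by simp
      also have "\<dots> = (g ^\<^sub>m Suc j) $$ (i, 0)"
        unfolding pow_mat_Suc_left[OF gC] by (rule index_mult_mat_sum[OF gC pow_carrier_mat[OF gC] i n0, symmetric])
      finally show ?thesis .
    qed
    moreover have "g * ?M \<in> carrier_mat n n" using gC MC by auto
    ultimately show ?thesis unfolding T_def using index_mult_mat_sum[OF N(1) _ l jn] by simp
  qed
  have shape: "companion_shape n d F T" unfolding companion_shape_def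
  proof (intro allI impI)
    fix l j assume l: "l < n" and j: "j < d"
    show "T $$ (l, j) = (if Suc j < d then if l = Suc j then 1 else 0 else if l < d then - coeff F l else 0)"
    proof (cases "Suc j < d")
      case True
      then have "T $$ (l, j) = (\<Sum>i<n. ?N $$ (l, i) * ?M $$ (i, Suc j))"
        unfolding Tcol[OF l j] by (intro sum.cong refl) (simp only: Mk lessThan_iff)
      then show ?thesis using NM[OF l, of "Suc j"] True d by simp
    next
      case False
      then have "Suc j = d" using j by simp
      then have "T $$ (l, j) = (\<Sum>i<n. ?N $$ (l, i) * - (\<Sum>m<d. ?M $$ (i, m) * coeff F m))"
        unfolding Tcol[OF l j] by (intro sum.cong refl) (simp only: gd lessThan_iff)
      also have "\<dots> = - (\<Sum>i<n. \<Sum>m<d. ?N $$ (l, i) * ?M $$ (i, m) * coeff F m)"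
        by (simp add: sum_negf sum_distrib_left mult.assoc)
      also have "(\<Sum>i<n. \<Sum>m<d. ?N $$ (l, i) * ?M $$ (i, m) * coeff F m)
          = (\<Sum>m<d. (\<Sum>i<n. ?N $$ (l, i) * ?M $$ (i, m)) * coeff F m)"
        unfolding sum_distrib_right by (rule sum.swap)
      also have "\<dots> = (\<Sum>m<d. if m = l then coeff F l else 0)"
        using NM[OF l] d by (intro sum.cong) auto
      finally show ?thesis using False by simp
    qed
  qed
  let ?B = "mat d (n - d) (\<lambda>(i, j). T $$ (i, j + d))"
  let ?D = "mat (n - d) (n - d) (\<lambda>(i, j). T $$ (i + d, j + d))"
  have degF: "degree F = d" using Fm by (simp add: monics_iff)
  have Tblk: "T = four_block_mat (companion F) ?B (0\<^sub>m (n - d) d) ?D"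
    by (rule companion_shape_imp_four_block[OF shape TC degF d(3)])
  have "T \<in> GL n" unfolding T_def using g Mc(1) N MC by (intro GL_mult GL_intro[of ?N n ?M])
  then have "four_block_mat (companion F) ?B (0\<^sub>m (n - d) d) ?D \<in> GL (d + (n - d))" using Tblk d by simp
  moreover have "companion F \<in> carrier_mat d d" using degF by (rule companion_carrier')
  ultimately have "companion F \<in> GL d" "?D \<in> GL (n - d)"
    using GL_four_block[of "companion F" d ?B "n - d" ?D] by auto
  then have Fu: "F \<in> unit_monics d"
    using companion_in_GL_iff[OF Fm d(2)] Fm by (simp add: unit_monics_def)
  have "g = g * (?M * ?N)" using N gC by simp
  also have "\<dots> = g * ?M * ?N" using N gC MC by (intro assoc_mult_mat[symmetric]) auto
  also have "\<dots> = glue n d (?K, ?B, ?D) F" unfolding MT[symmetric] glue_def using Tblk by simp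
  finally have "g = glue n d (?K, ?B, ?D) F" .
  moreover have "?B \<in> carrier_mat d (n - d)" by simp
  ultimately show ?thesis using K \<open>?D \<in> GL (n - d)\<close> Fu by blast
qed

section \<open>From polynomials to matrices\<close>

text \<open>For fixed \<open>y\<close> the values of \<open>t\<close> are those of \<open>u\<close>
  shifted by a constant, so every slice inherits the relative error. The shift depends on
  \<open>y\<close>, which is why \<open>near\<close> is assumed for every value.\<close>

lemma card_fibre_near_uniform:
  fixes t :: "'x \<Rightarrow> 'a :: {field, finite}" and u :: "'f \<Rightarrow> 'a" and \<eta> :: real
  assumes bij: "bij_betw (\<lambda>(y, F). G y F) (Y \<times> P) Z" and fin: "finite Y" "finite P"
    and tr: "\<And>y F. y \<in> Y \<Longrightarrow> F \<in> P \<Longrightarrow> t (G y F) = u F + v y"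
    and near: "\<And>c. \<bar>real (card {F \<in> P. u F = c}) - card P / CARD('a)\<bar> \<le> \<eta> * card P"
  shows "\<bar>real (card {x \<in> Z. t x = c}) - card Z / CARD('a)\<bar> \<le> \<eta> * card Z"
proof -
  have cZ: "real (card Z) = (\<Sum>y\<in>Y. real (card P))"
    using arg_cong[OF bij_betw_same_card[OF bij], of real] by (simp add: card_cartesian_product)
  have "bij_betw (\<lambda>(y, F). G y F) (SIGMA y:Y. {F \<in> P. u F = c - v y}) {x \<in> Z. t x = c}"
    using bij tr unfolding bij_betw_def inj_on_def
    by (auto simp: algebra_simps image_iff)
  then have "card {x \<in> Z. t x = c} = (\<Sum>y\<in>Y. card {F \<in> P. u F = c - v y})"
    using fin by (simp add: bij_betw_same_card[symmetric] card_SigmaI)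
  then have "real (card {x \<in> Z. t x = c}) - card Z / CARD('a)
      = (\<Sum>y\<in>Y. real (card {F \<in> P. u F = c - v y}) - card P / CARD('a))"
    by (simp add: cZ sum_subtractf)
  also have "\<bar>\<dots>\<bar> \<le> (\<Sum>y\<in>Y. \<eta> * card P)"
    by (rule order.trans[OF sum_abs]) (intro sum_mono near)
  also have "\<dots> = \<eta> * card Z" by (simp add: cZ)
  finally show ?thesis .
qed

lemma finite_unit_monics [simp]: "finite (unit_monics d :: 'a :: {field, finite} poly set)"
  by (rule finite_subset[OF _ finite_monics[of d]]) (auto simp: unit_monics_def)

text \<open>The polynomials with vanishing constant term are the multiples of \<open>x\<close>, whose trace is \<open>0\<close>.\<close>

lemma card_unit_monics_trace:
  fixes f :: "'a :: {field, finite} poly"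
  assumes "coeff f 0 = 0" "d \<ge> 1"
  shows "card {F \<in> unit_monics d. root_trace f F = c} + trace_count f (d - 1) c = trace_count f d c"
proof -
  have "[:0, 1:] \<in> (monics 1 :: 'a poly set)" by (simp add: monics_iff)
  moreover have "root_trace f [:0, 1:] = 0"
    using poly_trace_companion_linear[of f 0] assms(1) by (simp add: poly_0_coeff_0)
  ultimately have "card {F \<in> monics d. root_trace f F = c \<and> [:0, 1:] dvd F} = trace_count f (d - 1) c"
    using card_multiples[of "[:0, 1:]" 1 d f c] assms(2) by simp
  moreover have dvd: "[:0, 1:] dvd F \<longleftrightarrow> coeff F 0 = 0" for F :: "'a poly"
    using poly_eq_0_iff_dvd[of F 0] by (simp add: poly_0_coeff_0)
  have "{F \<in> monics d. root_trace f F = c} = {F \<in> unit_monics d. root_trace f F = c}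
      \<union> {F \<in> monics d. root_trace f F = c \<and> [:0, 1:] dvd F}"
    by (auto simp: unit_monics_def dvd)
  then have "trace_count f d c = card {F \<in> unit_monics d. root_trace f F = c}
      + card {F \<in> monics d. root_trace f F = c \<and> [:0, 1:] dvd F}"
    unfolding trace_count_def by (simp only:) (rule card_Un_disjoint, auto simp: unit_monics_def dvd)
  ultimately show ?thesis by simp
qed

lemma card_unit_monics:
  assumes "d \<ge> 1"
  shows "card (unit_monics d :: 'a :: {field, finite} poly set) + CARD('a) ^ (d - 1) = CARD('a) ^ d"
proof -
  \<comment> \<open>Summation over \<open>c\<close> forgets the trace, so the simplest choice
    \<open>f = 0\<close> serves.\<close>
  have "(\<Sum>c\<in>UNIV. card {F \<in> unit_monics d. root_trace (0 :: 'a poly) F = c} + trace_count (0 :: 'a poly) (d - 1) c)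
      = (\<Sum>c\<in>UNIV. trace_count (0 :: 'a poly) d c)"
    using card_unit_monics_trace[of "0 :: 'a poly" d] assms by simp
  then show ?thesis by (simp add: sum.distrib sum_card_fibres sum_trace_count)
qed

text \<open>Removing the multiples of \<open>x\<close> subtracts the count in degree
  \<open>d - 1\<close>, so that degree enters the hypothesis too. At least half of the polynomials
  remain, so the relative error grows only by a constant factor.\<close>

lemma unit_monics_near_uniform:
  fixes f :: "'a :: {field, finite} poly" and \<eta> :: real
  assumes "coeff f 0 = 0" "d \<ge> 1"
    and near: "\<And>m c. m \<in> {d - 1, d} \<Longrightarrow> \<bar>real (trace_count f m c) - CARD('a) ^ m / CARD('a)\<bar> \<le> \<eta> * CARD('a) ^ m"
  shows "\<bar>real (card {F \<in> unit_monics d. root_trace f F = c}) - card (unit_monics d :: 'a poly set) / CARD('a)\<bar>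
    \<le> 4 * \<eta> * card (unit_monics d :: 'a poly set)"
proof -
  let ?q = "real CARD('a)" and ?u = "real (card (unit_monics d :: 'a poly set))"
  have q: "?q \<ge> 2" using CARD_ge_2[where ?'a = 'a] by simp
  have \<eta>: "\<eta> \<ge> 0"
  proof -
    have "0 \<le> \<eta> * ?q ^ d" using order.trans[OF abs_ge_zero near[of d 0]] by simp
    moreover have "\<not> ?q ^ d \<le> 0" using q by (simp add: not_le)
    ultimately show ?thesis by (simp add: zero_le_mult_iff)
  qed
  have u: "?u = ?q ^ d - ?q ^ (d - 1)"
    using arg_cong[OF card_unit_monics[OF assms(2), where ?'a = 'a], of real] by simp
  have qd: "?q ^ d = ?q * ?q ^ (d - 1)" using assms(2) by (cases d) auto
  have "2 * ?q ^ (d - 1) \<le> ?q * ?q ^ (d - 1)" using q by (intro mult_right_mono) auto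
  then have half: "2 * ?q ^ (d - 1) \<le> ?q ^ d" unfolding qd .
  have "real (card {F \<in> unit_monics d. root_trace f F = c}) = real (trace_count f d c) - real (trace_count f (d - 1) c)"
    using arg_cong[OF card_unit_monics_trace[OF assms(1,2), of c], of real] by simp
  then have "real (card {F \<in> unit_monics d. root_trace f F = c}) - ?u / ?q
      = (real (trace_count f d c) - ?q ^ d / ?q) - (real (trace_count f (d - 1) c) - ?q ^ (d - 1) / ?q)"
    by (simp add: u diff_divide_distrib)
  also have "\<bar>\<dots>\<bar> \<le> \<eta> * ?q ^ d + \<eta> * ?q ^ (d - 1)"
    by (rule order.trans[OF abs_triangle_ineq4]) (use near[of d c] near[of "d - 1" c] in \<open>auto intro: add_mono\<close>)
  also have "\<dots> = \<eta> * (?q ^ d + ?q ^ (d - 1))" by (simp add: distrib_left)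
  also have "\<dots> \<le> \<eta> * (4 * ?u)" 
  proof (rule mult_left_mono[OF _ \<eta>])
    have "x + y \<le> 4 * (x - y)" if "0 \<le> y" "2 * y \<le> x" for x y :: real using that by argo
    from this[OF _ half] show "?q ^ d + ?q ^ (d - 1) \<le> 4 * ?u" unfolding u by simp
  qed
  finally show ?thesis by (simp add: mult.left_commute mult.assoc)
qed

section \<open>Strata of given Krylov dimension\<close>

definition krylov_stratum :: "nat \<Rightarrow> nat \<Rightarrow> 'a :: field mat set" where
  "krylov_stratum n d = {g \<in> GL n. krylov_dim n g = d}"

lemma bij_betw_glue:
  fixes n d :: nat
  assumes "0 < d" "d \<le> n"
  shows "bij_betw (\<lambda>(y, F). glue n d y F)
    ((start_mats n d \<times> carrier_mat d (n - d) \<times> GL (n - d)) \<times> unit_monics d)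
    (krylov_stratum n d :: 'a :: {field, finite} mat set)"
proof (rule bij_betw_imageI[OF glue_inj[OF assms]], intro equalityI subsetI)
  fix g :: "'a mat"
  assume "g \<in> (\<lambda>(y, F). glue n d y F) ` ((start_mats n d \<times> carrier_mat d (n - d) \<times> GL (n - d)) \<times> unit_monics d)"
  then show "g \<in> krylov_stratum n d"
    using glue_properties(3,6)[OF assms] by (auto simp: krylov_stratum_def)
next
  fix g :: "'a mat"
  assume "g \<in> krylov_stratum n d"
  then have "g \<in> GL n" "krylov_dim n g = d" by (auto simp: krylov_stratum_def)
  then obtain K B D F where "K \<in> start_mats n d" "B \<in> carrier_mat d (n - d)" "D \<in> GL (n - d)"
    "F \<in> unit_monics d" "g = glue n d (K, B, D) F"
    using glue_surj[OF _ _ assms] by blast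
  then show "g \<in> (\<lambda>(y, F). glue n d y F) ` ((start_mats n d \<times> carrier_mat d (n - d) \<times> GL (n - d)) \<times> unit_monics d)"
    by (intro image_eqI[of _ _ "((K, B, D), F)"]) auto
qed

lemma finite_start_mats [simp]: "finite (start_mats n d :: 'a :: {field, finite} mat set)"
  by (rule finite_subset[OF _ finite_carrier_mat[of n d]]) (auto simp: start_mats_def inj_mats_def)

lemma card_start_mats:
  assumes "d > 0"
  shows "card (start_mats n d :: 'a :: {field, finite} mat set) \<le> CARD('a) ^ (n * (d - 1))"
proof -
  define tail where "tail K = mat n (d - 1) (\<lambda>(i, j). K $$ (i, Suc j))" for K :: "'a mat"
  have "inj_on tail (start_mats n d)"
  proof (rule inj_onI)
    fix K K' assume K: "K \<in> start_mats n d" "K' \<in> start_mats n d" "tail K = tail K'"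
    have car: "K \<in> carrier_mat n d" "K' \<in> carrier_mat n d" using K by (auto simp: start_mats_def inj_mats_def)
    show "K = K'"
    proof (rule eq_matI)
      fix i j assume "i < dim_row K'" "j < dim_col K'"
      then have ij: "i < n" "j < d" using car by auto
      show "K $$ (i, j) = K' $$ (i, j)"
      proof (cases j)
        case 0
        then show ?thesis using K(1,2) ij by (simp add: start_mats_def)
      next
        case (Suc l)
        then have l: "l < d - 1" using ij by simp
        have "tail K $$ (i, l) = tail K' $$ (i, l)" using K(3) by simp
        then show ?thesis using ij l Suc by (simp add: tail_def)
      qed
    qed (use car in auto)
  qed
  then have "card (start_mats n d :: 'a mat set) \<le> card (carrier_mat n (d - 1) :: 'a mat set)"
    by (rule card_inj_on_le) (auto simp: tail_def)
  then show ?thesis by (simp add: card_carrier_mat)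
qed

text \<open>The fixed first column saves a factor \<open>q ^ n\<close>, and \<open>F\<close> has at
  most \<open>q ^ d\<close> choices: the exponents add up to \<open>n * n - n + d\<close>. Together
  with \<open>card_GL_lower\<close> this gives a stratum probability at most
  \<open>4 * q ^ d / q ^ n\<close>.\<close>

lemma card_krylov_stratum:
  assumes d: "0 < d" "d \<le> n"
  shows "card (krylov_stratum n d :: 'a :: {field, finite} mat set) * CARD('a) ^ n \<le> CARD('a) ^ (n * n + d)"
proof -
  let ?q = "CARD('a)"
  have "card (krylov_stratum n d :: 'a mat set) = card (start_mats n d :: 'a mat set) *
      (?q ^ (d * (n - d)) * card (GL (n - d) :: 'a mat set)) * card (unit_monics d :: 'a poly set)"
    using bij_betw_same_card[OF bij_betw_glue[OF d, where ?'a = 'a]]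
    by (simp add: card_cartesian_product card_carrier_mat)
  also have "\<dots> \<le> ?q ^ (n * (d - 1)) * (?q ^ (d * (n - d)) * ?q ^ ((n - d) * (n - d))) * ?q ^ d"
  proof (intro mult_le_mono card_start_mats d order.refl)
    have "card (GL (n - d) :: 'a mat set) \<le> card (carrier_mat (n - d) (n - d) :: 'a mat set)"
      by (rule card_mono) (auto simp: GL_def)
    then show "card (GL (n - d) :: 'a mat set) \<le> ?q ^ ((n - d) * (n - d))" by (simp add: card_carrier_mat)
    have "card (unit_monics d :: 'a poly set) \<le> card (monics d :: 'a poly set)"
      by (rule card_mono) (auto simp: unit_monics_def)
    then show "card (unit_monics d :: 'a poly set) \<le> ?q ^ d" by (simp add: card_monics)
  qed
  also have "\<dots> = ?q ^ (n * (d - 1) + (d * (n - d) + (n - d) * (n - d)) + d)" by (simp only: power_add)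
  finally have "card (krylov_stratum n d :: 'a mat set) * ?q ^ n
      \<le> ?q ^ (n * (d - 1) + (d * (n - d) + (n - d) * (n - d)) + d) * ?q ^ n" by (rule mult_le_mono1)
  also have "\<dots> = ?q ^ (n * (d - 1) + (d * (n - d) + (n - d) * (n - d)) + d + n)" by (simp only: power_add)
  also have "n * (d - 1) + (d * (n - d) + (n - d) * (n - d)) + d + n = n * n + d"
  proof -
    obtain e where e: "n = d + e" using d(2) le_Suc_ex by blast
    obtain d' where d': "d = Suc d'" using d(1) gr0_conv_Suc by auto
    show ?thesis unfolding e d' by (simp add: algebra_simps)
  qed
  finally show ?thesis .
qed

lemma sum_powers_le:
  fixes q :: real
  assumes "q \<ge> 2"
  shows "(\<Sum>d=1..h. q ^ d) \<le> 2 * q ^ h"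
proof (induction h)
  case (Suc h)
  have "2 * q ^ h \<le> q * q ^ h" using assms by (intro mult_right_mono) auto
  then show ?case using Suc by simp
qed simp

text \<open>Strata with \<open>d \<le> h\<close> are bounded by their size, and the geometric sum
  turns the constant 4 into 8. The stratum \<open>d = h\<close> belongs to them because
  near-uniformity on \<open>unit_monics d\<close> also requires
  \<open>d - 1 \<ge> h\<close>.\<close>

theorem GL_trace_near_uniform:
  fixes f :: "'a :: {field, finite} poly" and \<eta> :: real
  assumes f0: "coeff f 0 = 0" and n: "n > 0" and h: "h \<le> n" and \<eta>: "\<eta> \<ge> 0"
    and near: "\<And>m c. m \<ge> h \<Longrightarrow> \<bar>real (trace_count f m c) - CARD('a) ^ m / CARD('a)\<bar> \<le> \<eta> * CARD('a) ^ m"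
  shows "\<bar>real (card {g \<in> GL n. poly_trace f g = c}) - card (GL n :: 'a mat set) / CARD('a)\<bar>
    \<le> (4 * \<eta> + 8 * CARD('a) ^ h / CARD('a) ^ n) * card (GL n :: 'a mat set)"
proof -
  let ?q = "real CARD('a)" and ?G = "real (card (GL n :: 'a mat set))"
  let ?X = "\<lambda>d. krylov_stratum n d :: 'a mat set"
  have q: "?q \<ge> 2" using CARD_ge_2[where ?'a = 'a] by simp
  have finX: "finite (?X d)" for d by (rule finite_subset[OF _ finite_GL[of n]]) (auto simp: krylov_stratum_def)
  have split: "card {g \<in> GL n. Q g} = (\<Sum>d=1..n. card {g \<in> ?X d. Q g})" for Q :: "'a mat \<Rightarrow> bool"
  proof -
    have "krylov_dim n g \<in> {1..n}" if "g \<in> GL n" for g :: "'a mat"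
      using that n by (intro krylov_dim_bounds) (auto simp: GL_def)
    then have "{g \<in> GL n. Q g} = (\<Union>d\<in>{1..n}. {g \<in> ?X d. Q g})" by (auto simp: krylov_stratum_def)
    then show ?thesis using finX by (simp only:) (intro card_UN_disjoint, auto simp: krylov_stratum_def)
  qed
  have GX: "?G = (\<Sum>d=1..n. real (card (?X d)))" using split[of "\<lambda>_. True"] by simp
  have strat: "\<bar>real (card {g \<in> ?X d. poly_trace f g = c}) - card (?X d) / ?q\<bar>
      \<le> 4 * \<eta> * card (?X d) + (if d \<le> h then 4 * ?G / ?q ^ n * ?q ^ d else 0)" if d: "d \<in> {1..n}" for d
  proof (cases "d \<le> h")
    case True
    have "real (card {g \<in> ?X d. poly_trace f g = c}) \<le> card (?X d)"
      using finX by (simp add: card_mono)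
    moreover have "card (?X d) / ?q \<le> card (?X d) / 1" using q by (intro divide_left_mono) auto
    moreover have "0 \<le> card (?X d) / ?q" by simp
    ultimately have "\<bar>real (card {g \<in> ?X d. poly_trace f g = c}) - card (?X d) / ?q\<bar> \<le> card (?X d)"
      by linarith
    also have "real (card (?X d)) \<le> 4 * ?G / ?q ^ n * ?q ^ d"
    proof -
      have "real (card (?X d) * CARD('a) ^ n) \<le> real (CARD('a) ^ (n * n + d))"
        using card_krylov_stratum[of d n, where ?'a = 'a] d by (intro of_nat_mono) auto
      then have "card (?X d) * ?q ^ n \<le> ?q ^ (n * n) * ?q ^ d" by (simp add: power_add)
      also have "\<dots> \<le> 4 * ?G * ?q ^ d" using card_GL_lower by (intro mult_right_mono) auto
      finally show ?thesis using q by (simp add: field_simps)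
    qed
    also have "\<dots> \<le> 4 * \<eta> * card (?X d) + 4 * ?G / ?q ^ n * ?q ^ d" using \<eta> by simp
    finally show ?thesis using True by simp
  next
    case False
    have "\<bar>real (card {g \<in> ?X d. poly_trace f g = c}) - card (?X d) / ?q\<bar> \<le> (4 * \<eta>) * card (?X d)"
    proof (rule card_fibre_near_uniform[where u = "root_trace f" and v = "\<lambda>(K, B, D). poly_trace f D"])
      show "bij_betw (\<lambda>(y, F). glue n d y F)
        ((start_mats n d \<times> carrier_mat d (n - d) \<times> GL (n - d)) \<times> unit_monics d) (?X d)"
        using d by (intro bij_betw_glue) auto
      show "poly_trace f (glue n d y F) = root_trace f F + (case y of (K, B, D) \<Rightarrow> poly_trace f D)"
        if "y \<in> start_mats n d \<times> carrier_mat d (n - d) \<times> GL (n - d)" "F \<in> unit_monics d" for y F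
        using that d by (auto intro!: glue_properties(7))
      show "\<bar>real (card {F \<in> unit_monics d. root_trace f F = c}) - card (unit_monics d :: 'a poly set) / ?q\<bar>
        \<le> (4 * \<eta>) * card (unit_monics d :: 'a poly set)" for c
        using d False near by (intro unit_monics_near_uniform[OF f0]) auto
    qed auto
    then show ?thesis using False by simp
  qed
  have "real (card {g \<in> GL n. poly_trace f g = c}) - ?G / ?q
      = (\<Sum>d=1..n. real (card {g \<in> ?X d. poly_trace f g = c}) - card (?X d) / ?q)"
    unfolding GX split by (simp add: sum_subtractf sum_divide_distrib)
  also have "\<bar>\<dots>\<bar> \<le> (\<Sum>d=1..n. 4 * \<eta> * card (?X d) + (if d \<le> h then 4 * ?G / ?q ^ n * ?q ^ d else 0))"
    by (rule order.trans[OF sum_abs]) (intro sum_mono strat)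
  also have "\<dots> = 4 * \<eta> * ?G + (\<Sum>d=1..n. if d \<le> h then 4 * ?G / ?q ^ n * ?q ^ d else 0)"
    unfolding GX sum.distrib sum_distrib_left ..
  also have "(\<Sum>d=1..n. if d \<le> h then 4 * ?G / ?q ^ n * ?q ^ d else 0) = (\<Sum>d=1..h. 4 * ?G / ?q ^ n * ?q ^ d)"
    using h by (intro sum.mono_neutral_cong_right) auto
  also have "\<dots> = 4 * ?G / ?q ^ n * (\<Sum>d=1..h. ?q ^ d)" by (rule sum_distrib_left[symmetric])
  also have "\<dots> \<le> 4 * ?G / ?q ^ n * (2 * ?q ^ h)" using sum_powers_le[OF q] by (intro mult_left_mono) auto
  also have "4 * \<eta> * ?G + 4 * ?G / ?q ^ n * (2 * ?q ^ h) = (4 * \<eta> + 8 * ?q ^ h / ?q ^ n) * ?G"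
    by (simp add: distrib_right)
  finally show ?thesis by simp
qed

section \<open>The limit\<close>

lemma trace_equidistribution_bound:
  fixes f :: "'a :: {field, finite} poly"
  assumes deg: "degree f = k" "k > 0" and cop: "coprime k CARD('a)" and f0: "coeff f 0 = 0"
    and L: "k \<le> CARD('a) ^ L" and t: "t > 0" and n: "n \<ge> 2"
  shows "\<bar>real (card {g \<in> GL n. poly_trace f g = c}) / card (GL n :: 'a mat set) - 1 / CARD('a)\<bar>
    \<le> 12 * real (3 * L + 2 * t + 1) / n + 8 * real CARD('a) / CARD('a) ^ t + 16 / n"
proof -
  let ?q = "real CARD('a)" and ?G = "real (card (GL n :: 'a mat set))"
  have q: "?q \<ge> 2" and qn: "CARD('a) \<ge> 2" using CARD_ge_2[where ?'a = 'a] by simp_all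
  have G: "?G > 0" by (simp add: card_gt_0_iff)
  \<comment> \<open>As \<open>k \<le> q ^ L\<close>, the condition of Stepanov's bound follows from
    \<open>L + m \<le> d - m - 1\<close>, that is, from \<open>d \<ge> D\<close>; and
    \<open>m = L + t\<close> makes \<open>k / q ^ m\<close> at most \<open>1 / q ^ t\<close>.
    Halving \<open>n\<close> keeps both \<open>h\<close> and \<open>n - h\<close> of order
    \<open>n\<close>.\<close>
  define m D h where "m = L + t" and "D = 3 * L + 2 * t + 1" and "h = n div 2"
  define \<delta> where "\<delta> = 2 * ?q / ?q ^ t"
  define \<eta> where "\<eta> = D / h + \<delta>"
  have h: "h \<ge> 1" "h \<le> n" "n \<le> 3 * h" using n by (auto simp: h_def)
  have \<delta>: "\<delta> \<ge> 0" using q by (simp add: \<delta>_def)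
  have w: "\<bar>real (prime_weight f d c) - CARD('a) ^ d / CARD('a)\<bar> \<le> \<delta> * CARD('a) ^ d" if d: "d \<ge> D" for d c
  proof -
    have "k * CARD('a) ^ m \<le> CARD('a) ^ L * CARD('a) ^ m" using L by simp
    also have "\<dots> = CARD('a) ^ (L + m)" by (simp add: power_add)
    also have "\<dots> \<le> CARD('a) ^ (d - m - 1)"
      using d qn by (intro power_increasing) (auto simp: m_def D_def)
    finally have km: "k * CARD('a) ^ m \<le> CARD('a) ^ (d - m - 1)" .
    have "0 < m" "m < d" using d t by (auto simp: m_def D_def)
    from prime_weight_near_uniform[OF deg cop this km, of c]
    have "\<bar>real (prime_weight f d c) - CARD('a) ^ d / CARD('a)\<bar> \<le> 2 * k * ?q / CARD('a) ^ m * CARD('a) ^ d" by simp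
    also have "\<dots> \<le> \<delta> * CARD('a) ^ d"
    proof (intro mult_right_mono)
      have "real k \<le> ?q ^ L" using of_nat_mono[OF L, where ?'a = real] by simp
      then have "2 * ?q * real k \<le> 2 * ?q * ?q ^ L" using q by (intro mult_left_mono) auto
      then have "2 * ?q * real k / (?q ^ L * ?q ^ t) \<le> 2 * ?q * ?q ^ L / (?q ^ L * ?q ^ t)"
        using q by (intro divide_right_mono) auto
      then show "2 * k * ?q / real (CARD('a) ^ m) \<le> \<delta>"
        using q by (simp add: \<delta>_def m_def power_add mult_ac)
    qed auto
    finally show ?thesis .
  qed
  have near: "\<bar>real (trace_count f j c) - CARD('a) ^ j / CARD('a)\<bar> \<le> \<eta> * CARD('a) ^ j" if j: "j \<ge> h" for j c
  proof -
    have "\<bar>real (trace_count f j c) - CARD('a) ^ j / CARD('a)\<bar> \<le> (D / j + \<delta>) * CARD('a) ^ j"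
      using j h w \<delta> by (intro trace_count_near_uniform) auto
    also have "\<dots> \<le> \<eta> * CARD('a) ^ j"
      unfolding \<eta>_def using j h by (intro mult_right_mono add_right_mono divide_left_mono) auto
    finally show ?thesis .
  qed
  have "\<bar>real (card {g \<in> GL n. poly_trace f g = c}) - ?G / ?q\<bar> \<le> (4 * \<eta> + 8 * ?q ^ h / ?q ^ n) * ?G"
    using GL_trace_near_uniform[OF f0 _ h(2) _ near, of c] n \<delta> by (simp add: \<eta>_def)
  then have "\<bar>real (card {g \<in> GL n. poly_trace f g = c}) - ?G / ?q\<bar> / ?G \<le> 4 * \<eta> + 8 * ?q ^ h / ?q ^ n"
    using G by (simp add: pos_divide_le_eq)
  moreover have "\<bar>real (card {g \<in> GL n. poly_trace f g = c}) - ?G / ?q\<bar> / ?G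
      = \<bar>real (card {g \<in> GL n. poly_trace f g = c}) / ?G - 1 / ?q\<bar>"
  proof -
    have "real (card {g \<in> GL n. poly_trace f g = c}) / ?G - 1 / ?q
      = (real (card {g \<in> GL n. poly_trace f g = c}) - ?G / ?q) / ?G"
      using G by (simp add: diff_divide_distrib)
    then show ?thesis using G by simp
  qed
  \<comment> \<open>The factor \<open>12\<close> is \<open>4 * 3\<close>, where 3 comes from
    \<open>n \<le> 3 * h\<close>; equality occurs at \<open>n = 3\<close>.\<close>
  moreover have "4 * \<eta> \<le> 12 * real D / n + 8 * ?q / ?q ^ t"
  proof -
    have "real n \<le> 3 * real h" using h by (metis of_nat_le_iff of_nat_mult of_nat_numeral)
    then have "3 * real D / (3 * real h) \<le> 3 * real D / n" using h n by (intro divide_left_mono) auto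
    then have "real D / h \<le> 3 * real D / n" by simp
    then show ?thesis by (simp add: \<eta>_def \<delta>_def)
  qed
  \<comment> \<open>The left side is exponentially small, but order \<open>1 / n\<close> is
    enough.\<close>
  moreover have "8 * ?q ^ h / ?q ^ n \<le> 16 / n"
  proof -
    have "?q ^ n = ?q ^ h * ?q ^ (n - h)" using h by (simp flip: power_add)
    then have "8 * ?q ^ h / ?q ^ n = 8 / ?q ^ (n - h)" using q by simp
    also have "\<dots> \<le> 8 / 2 ^ (n - h)" using q by (intro divide_left_mono power_mono) auto
    also have "\<dots> \<le> 8 / (n / 2)"
    proof (rule divide_left_mono)
      have "real (n - h) < 2 ^ (n - h)" by (rule of_nat_less_two_power)
      moreover have "n / 2 \<le> real (n - h)" unfolding h_def by linarith
      ultimately show "n / 2 \<le> 2 ^ (n - h)" by linarith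
    qed (use n in auto)
    finally show ?thesis by simp
  qed
  ultimately show ?thesis unfolding D_def of_nat_power by linarith
qed

theorem theorem1p2:
  fixes k :: "nat \<Rightarrow> nat"
    and a :: "nat \<Rightarrow> nat \<Rightarrow> 'a :: {field, finite}"
  assumes "\<And>n. n \<ge> 1 \<Longrightarrow> k n > 0"
    and "\<And>n. n \<ge> 1 \<Longrightarrow> \<not> CHAR('a) dvd k n"
    and "(\<lambda>n. ln (real (k n))) \<in> o(\<lambda>n. real n)"
    and "\<And>n. n \<ge> 1 \<Longrightarrow> a n (k n) \<noteq> 0"
  shows "\<forall>c :: 'a. (\<lambda>n. pmf (map_pmf (\<lambda>g. \<Sum>i=1..k n. a n i * mat_trace (g ^\<^sub>m i)) (pmf_of_set (GL n))) c)
           \<longlonglongrightarrow> pmf (pmf_of_set (UNIV :: 'a set)) c"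
proof
  fix c :: 'a
  let ?q = "real CARD('a)"
  let ?p = "\<lambda>n. pmf (map_pmf (\<lambda>g. \<Sum>i=1..k n. a n i * mat_trace (g ^\<^sub>m i)) (pmf_of_set (GL n))) c"
  have q: "?q \<ge> 2" using CARD_ge_2[where ?'a = 'a] by simp
  define f where "f n = (\<Sum>i=1..k n. monom (a n i) i)" for n
  have cf: "coeff (f n) i = (if i \<in> {1..k n} then a n i else 0)" for n i
    by (simp add: f_def coeff_sum)
  have degf: "degree (f n) = k n" if "n \<ge> 1" for n
  proof (rule antisym)
    show "degree (f n) \<le> k n" by (rule degree_le) (simp add: cf)
    show "k n \<le> degree (f n)" using assms(1,4)[OF that] by (intro le_degree) (simp add: cf)
  qed
  have tr: "(\<Sum>i=1..k n. a n i * mat_trace (g ^\<^sub>m i)) = poly_trace (f n) g" if "n \<ge> 1" for n and g :: "'a mat"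
    unfolding poly_trace_def degf[OF that]
    by (rule sum.mono_neutral_cong_left) (auto simp: cf)
  have p: "?p n = real (card {g \<in> GL n. poly_trace (f n) g = c}) / card (GL n :: 'a mat set)" if "n \<ge> 1" for n
  proof -
    have "GL n \<inter> (\<lambda>g. \<Sum>i=1..k n. a n i * mat_trace (g ^\<^sub>m i)) -` {c} = {g \<in> GL n. poly_trace (f n) g = c}"
      unfolding tr[OF that] by auto
    then show ?thesis by (simp add: pmf_map measure_pmf_of_set)
  qed
  \<comment> \<open>For \<open>n \<ge> 1\<close> this is the least exponent with
    \<open>k n \<le> q ^ L n\<close>, hence of the order of \<open>ln (k n)\<close> up to
    rounding.\<close>
  define L where "L n = nat \<lceil>log ?q (k n)\<rceil>" for n
  have L: "k n \<le> CARD('a) ^ L n" "real (L n) \<le> ln (k n) / ln ?q + 1" if "n \<ge> 1" for n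
  proof -
    have kp: "real (k n) \<ge> 1" using assms(1)[OF that] by simp
    then have l0: "log ?q (k n) \<ge> 0" using q by simp
    then have "log ?q (k n) \<le> real (L n)" unfolding L_def by linarith
    then have "?q powr log ?q (k n) \<le> ?q powr real (L n)" using q by (intro powr_mono) auto
    then have "real (k n) \<le> real (CARD('a) ^ L n)" using kp q by (simp add: powr_realpow)
    then show "k n \<le> CARD('a) ^ L n" by (simp only: of_nat_le_iff)
    have "real (L n) \<le> log ?q (k n) + 1" unfolding L_def using l0 by linarith
    then show "real (L n) \<le> ln (k n) / ln ?q + 1" by (simp add: log_def)
  qed
  have lim: "(\<lambda>n. ln (real (k n)) / real n) \<longlonglongrightarrow> 0"
    using smalloD_tendsto[OF assms(3)] .
  show "?p \<longlonglongrightarrow> pmf (pmf_of_set (UNIV :: 'a set)) c"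
  proof (rule LIMSEQ_I)
    fix \<epsilon> :: real assume \<epsilon>: "0 < \<epsilon>"
    \<comment> \<open>Choosing \<open>t\<close> first disposes of the one error term that does not
      decay in \<open>n\<close>; the others are collected in \<open>b\<close>, where
      \<open>t\<close> is a constant.\<close>
    have "(\<lambda>t. 8 * ?q * (1 / ?q) ^ t) \<longlonglongrightarrow> 8 * ?q * 0"
      using q by (intro tendsto_mult tendsto_const LIMSEQ_power_zero) auto
    then have "eventually (\<lambda>t. 8 * ?q * (1 / ?q) ^ t < \<epsilon> / 2) sequentially"
      using \<epsilon> by (intro order_tendstoD(2)[of _ "8 * ?q * 0"]) auto
    then have "eventually (\<lambda>t. 8 * ?q * (1 / ?q) ^ t < \<epsilon> / 2 \<and> t > 0) sequentially"
      using eventually_gt_at_top[of "0 :: nat"] by (rule eventually_conj)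
    then obtain t where t: "8 * ?q * (1 / ?q) ^ t < \<epsilon> / 2" "t > 0"
      by (auto simp: eventually_sequentially)
    \<comment> \<open>\<open>36\<close> is \<open>12 * 3\<close>, and \<open>64\<close> collects
      \<open>12\<close>, \<open>16\<close> and the \<open>36\<close> caused by rounding
      \<open>L n\<close> up.\<close>
    define b where "b n = 36 / ln ?q * (ln (real (k n)) / real n) + real (24 * t + 64) * (1 / real n)" for n
    have "b \<longlonglongrightarrow> 36 / ln ?q * 0 + real (24 * t + 64) * 0"
      unfolding b_def by (intro tendsto_intros lim lim_1_over_n)
    then have "eventually (\<lambda>n. b n < \<epsilon> / 2) sequentially"
      using \<epsilon> by (intro order_tendstoD(2)[of b "36 / ln ?q * 0 + real (24 * t + 64) * 0"]) auto
    then have "eventually (\<lambda>n. b n < \<epsilon> / 2 \<and> n \<ge> 2) sequentially"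
      using eventually_ge_at_top[of 2] by (rule eventually_conj)
    then have "eventually (\<lambda>n. norm (?p n - pmf (pmf_of_set (UNIV :: 'a set)) c) < \<epsilon>) sequentially"
    proof (rule eventually_mono)
      fix n assume n: "b n < \<epsilon> / 2 \<and> n \<ge> 2"
      then have n1: "n \<ge> 1" by simp
      have "\<bar>real (card {g \<in> GL n. poly_trace (f n) g = c}) / card (GL n :: 'a mat set) - 1 / ?q\<bar>
        \<le> 12 * real (3 * L n + 2 * t + 1) / n + 8 * ?q / CARD('a) ^ t + 16 / n"
      proof (rule trace_equidistribution_bound)
        show "degree (f n) = k n" by (rule degf[OF n1])
        show "k n > 0" by (rule assms(1)[OF n1])
        show "coprime (k n) CARD('a)" by (rule coprime_CARD[OF assms(2)[OF n1]])
        show "coeff (f n) 0 = 0" by (simp add: cf)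
      qed (use n t L(1)[OF n1] in auto)
      also have "\<dots> = (36 * real (L n) + 24 * real t + 28) / n + 8 * ?q * (1 / ?q) ^ t"
        by (simp add: power_divide add_divide_distrib algebra_simps)
      also have "(36 * real (L n) + 24 * real t + 28) / n \<le> (36 * (ln (k n) / ln ?q + 1) + 24 * real t + 28) / n"
        using L(2)[OF n1] by (intro divide_right_mono) auto
      also have "\<dots> = b n"
        by (simp add: b_def add_divide_distrib algebra_simps)
      finally have "\<bar>real (card {g \<in> GL n. poly_trace (f n) g = c}) / card (GL n :: 'a mat set) - 1 / ?q\<bar> < \<epsilon>"
        using n t by linarith
      then show "norm (?p n - pmf (pmf_of_set (UNIV :: 'a set)) c) < \<epsilon>"
        unfolding p[OF n1] by simp
    qed
    then show "\<exists>no. \<forall>n\<ge>no. norm (?p n - pmf (pmf_of_set (UNIV :: 'a set)) c) < \<epsilon>"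
      by (simp add: eventually_sequentially)
  qed
qed

end
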